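(* Let $\phi(\xi)=e^{-|\xi|}$, let $\widetilde H^1=\{v\in H^1(\mathbb{R}):v(0)=0\}$, and let $Lv=(1-\phi^2)v'+\phi\phi' v$ with domain $\mathrm{Dom}(L)=\{v\in\widetilde H^1:(1-\phi^2)v'\in\widetilde H^1\}$. For every $\mathfrak{v}_0\in\mathrm{Dom}(L)$, the initial-value problem $$v_t=Lv,\qquad v(\xi,0)=\mathfrak{v}_0(\xi),$$ admits a unique global solution $v$, and it satisfies $\|v(\cdot,t)\|_{\widetilde H^1}=\|\mathfrak{v}_0\|_{\widetilde H^1}$ for all $t\ge 0$.
   Context: Functions are complex-valued on $\mathbb{R}$ (variable $\xi$); $\phi'(\xi)=-\operatorname{sgn}(\xi)e^{-|\xi|}$ for $\xi\ne0$. The space $\widetilde H^1$ carries the norm $\|v\|_{\widetilde H^1}=\|v\|_{H^1(\mathbb{R})}=(\|v\|_{L^2}^2+\|v'\|_{L^2}^2)^{1/2}$. A global solution is a function $v\in C([0,\infty),\mathrm{Dom}(L))$ ($\mathrm{Dom}(L)$ with the graph norm), continuously differentiable in $t$ with values in $\widetilde H^1$, satisfying the equation and the initial condition. *)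

theory Defs
  imports "HOL-Analysis.Analysis"
begin

text \<open>
  \<open>L2\<close> consists of Borel functions rather than of classes modulo null sets (every class has a
  Borel representative); equality of classes is written as equality almost everywhere.
\<close>

definition L2 :: "(real \<Rightarrow> complex) set" where
  "L2 = {f. f \<in> borel_measurable lborel \<and> integrable lborel (\<lambda>x. (cmod (f x))\<^sup>2)}"

definition test_function :: "(real \<Rightarrow> real) \<Rightarrow> bool" where
  "test_function \<psi> \<longleftrightarrow>
     (\<forall>n x. ((deriv ^^ n) \<psi>) differentiable (at x)) \<and> compact (closure {x. \<psi> x \<noteq> 0})"

definition is_weak_deriv :: "(real \<Rightarrow> complex) \<Rightarrow> (real \<Rightarrow> complex) \<Rightarrow> bool" where
  "is_weak_deriv v g \<longleftrightarrow>
     (\<forall>\<psi>. test_function \<psi> \<longrightarrow>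
        (LINT x|lborel. v x * complex_of_real (deriv \<psi> x)) =
        - (LINT x|lborel. g x * complex_of_real (\<psi> x)))"

text \<open>
  An element of the Sobolev space is represented by its continuous representative, so that
  \<open>v 0\<close> is meaningful and equality in the space is equality of functions.
\<close>

definition H1 :: "(real \<Rightarrow> complex) set" where
  "H1 = {v. continuous_on UNIV v \<and> v \<in> L2 \<and> (\<exists>g\<in>L2. is_weak_deriv v g)}"

text \<open>
  For \<open>v \<in> H1\<close> this is some square integrable weak derivative; it is determined only up to null
  sets, hence is used only under integrals and in almost-everywhere statements.
\<close>

definition weak_deriv :: "(real \<Rightarrow> complex) \<Rightarrow> real \<Rightarrow> complex" where
  "weak_deriv v = (SOME g. g \<in> L2 \<and> is_weak_deriv v g)"

definition H1_norm :: "(real \<Rightarrow> complex) \<Rightarrow> real" where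
  "H1_norm v = sqrt ((LINT x|lborel. (cmod (v x))\<^sup>2) + (LINT x|lborel. (cmod (weak_deriv v x))\<^sup>2))"

definition H1_tilde :: "(real \<Rightarrow> complex) set" where
  "H1_tilde = {v \<in> H1. v 0 = 0}"

definition phi :: "real \<Rightarrow> real" where
  "phi \<xi> = exp (- \<bar>\<xi>\<bar>)"

text \<open>At the origin, where \<open>phi\<close> is not differentiable, the value is \<open>0\<close>; it is irrelevant.\<close>

definition phi' :: "real \<Rightarrow> real" where
  "phi' \<xi> = - sgn \<xi> * exp (- \<bar>\<xi>\<bar>)"

definition Dom_L :: "(real \<Rightarrow> complex) set" where
  "Dom_L = {v \<in> H1_tilde. \<exists>w\<in>H1_tilde.
     AE \<xi> in lborel. w \<xi> = complex_of_real (1 - (phi \<xi>)\<^sup>2) * weak_deriv v \<xi>}"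

text \<open>
  \<open>L v\<close> is the continuous representative of \<open>(1 - phi\<^sup>2) v' + phi phi' v\<close>, which belongs to
  \<open>H1_tilde\<close> for \<open>v \<in> Dom_L\<close> (the jump of \<open>phi'\<close> is compensated by \<open>v 0 = 0\<close>).
\<close>

definition op_L :: "(real \<Rightarrow> complex) \<Rightarrow> real \<Rightarrow> complex" where
  "op_L v = (THE w. w \<in> H1_tilde \<and>
     (AE \<xi> in lborel. w \<xi> = complex_of_real (1 - (phi \<xi>)\<^sup>2) * weak_deriv v \<xi>
                           + complex_of_real (phi \<xi> * phi' \<xi>) * v \<xi>))"

definition graph_norm :: "(real \<Rightarrow> complex) \<Rightarrow> real" where
  "graph_norm v = H1_norm v + H1_norm (op_L v)"

text \<open>
  Continuity and differentiability on \<open>[0,\<infinity>)\<close> (one-sided at \<open>0\<close>) of curves in a function space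
  with norm \<open>N\<close>.
\<close>

definition continuous_wrt ::
  "((real \<Rightarrow> complex) \<Rightarrow> real) \<Rightarrow> (real \<Rightarrow> real \<Rightarrow> complex) \<Rightarrow> bool" where
  "continuous_wrt N u \<longleftrightarrow>
     (\<forall>t\<ge>0. ((\<lambda>s. N (\<lambda>\<xi>. u s \<xi> - u t \<xi>)) \<longlongrightarrow> 0) (at t within {0..}))"

definition has_time_deriv_wrt ::
  "((real \<Rightarrow> complex) \<Rightarrow> real) \<Rightarrow> (real \<Rightarrow> real \<Rightarrow> complex) \<Rightarrow> (real \<Rightarrow> real \<Rightarrow> complex) \<Rightarrow> bool" where
  "has_time_deriv_wrt N u u' \<longleftrightarrow>
     (\<forall>t\<ge>0. ((\<lambda>s. N (\<lambda>\<xi>. (u s \<xi> - u t \<xi>) / complex_of_real (s - t) - u' t \<xi>)) \<longlongrightarrow> 0)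
              (at t within {0..}))"

text \<open>Curves are written \<open>u t \<xi>\<close>; their values at negative times play no role.\<close>

definition global_solution :: "(real \<Rightarrow> complex) \<Rightarrow> (real \<Rightarrow> real \<Rightarrow> complex) \<Rightarrow> bool" where
  "global_solution v0 u \<longleftrightarrow>
     (\<forall>t\<ge>0. u t \<in> Dom_L) \<and> continuous_wrt graph_norm u \<and>
     (\<exists>u'. (\<forall>t\<ge>0. u' t \<in> H1_tilde) \<and> continuous_wrt H1_norm u' \<and>
           has_time_deriv_wrt H1_norm u u' \<and>
           (\<forall>t\<ge>0. u' t = op_L (u t))) \<and>
     u 0 = v0"

end

(*
  Fold the line at the origin.  On x > 0 put y = e^(2x) - 1 and w(y) = e^x v(x).  Since
  |v|^2 + |v'|^2 = |v + v'|^2 - (|v|^2)', the H^1 norm of v on the half line is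
  sqrt 2 times the L^2 norm of h = w', and L v corresponds to 2 y w' - w.
  Hence the evolution is the scaling w |-> e^(-t) w(e^(2t) y), on h the unitary dilation
  h |-> e^t h(e^(2t) y).  On x < 0 the reflected function evolves backwards in time.
  Existence and conservation of the norm are then read off, the time derivative from
  ((D_t h - h)/t)(y) = (integral over [0,1] of D_(ts) k (y) ds), where k is the function
  belonging to L v, and strong continuity of dilations.  For uniqueness, let S be this group
  and w any solution: s |-> S(-s) w(s) has derivative 0, because w(s) and S(s - t) w(t) agree
  to first order at s = t.
*)
theory Submission
  imports Defs
begin

text \<open>With w = e^x v one has v + v' = e^(-x) w', which is why the energy becomes a norm of w'
  alone; the boundary terms of (|v|^2)' vanish at 0 by v(0) = 0 and at infinity because v is square
  integrable. The variable y is the one for which (1 - e^(-2x)) d/dx = 2 y d/dy. Reflection changes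
  the sign of both d/dx and \<open>phi * phi'\<close>, so it turns L into -L; hence the reversed
  time on the left. The coefficient 1 - phi^2 vanishes at the origin, so classical derivatives of
  elements of the domain are available only away from it, while the definitions speak of weak
  derivatives. The proof therefore works with absolutely continuous functions in integral form:
  products, changes of variables and cutting at a zero are then at hand, and classical derivatives
  are recovered off the origin. In the variable s with y = e^(2s) dilations are translations, and
  the averaged formula for the difference quotient is the fundamental theorem of calculus in
  s.\<close>

subsection \<open>Absolutely continuous functions\<close>

text \<open>Local absolute continuity encoded by the fundamental theorem of calculus, so that no
  theorem on differentiation almost everywhere is involved. Borel measurability of \<open>g\<close>
  keeps compositions such as \<open>g (\<phi> x)\<close> measurable; Lebesgue measurability would
  not.\<close>

definition has_ac_deriv :: "(real \<Rightarrow> complex) \<Rightarrow> (real \<Rightarrow> complex) \<Rightarrow> bool" where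
  "has_ac_deriv v g \<longleftrightarrow> g \<in> borel_measurable borel \<and>
     (\<forall>a b. a \<le> b \<longrightarrow> set_integrable lborel {a..b} g \<and> (LINT x:{a..b}|lborel. g x) = v b - v a)"

lemma has_ac_derivD:
  assumes "has_ac_deriv v g"
  shows "g \<in> borel_measurable borel"
    and "a \<le> b \<Longrightarrow> set_integrable lborel {a..b} g"
    and "a \<le> b \<Longrightarrow> (LINT x:{a..b}|lborel. g x) = v b - v a"
  using assms by (auto simp: has_ac_deriv_def)

lemma set_integrable_continuous_mult:
  fixes g :: "real \<Rightarrow> complex"
  assumes g: "set_integrable lborel {a..b} g" and v: "continuous_on UNIV v"
  shows "set_integrable lborel {a..b} (\<lambda>x. v x * g x)"
proof -
  have "bounded (v ` {a..b})"
    by (intro compact_imp_bounded compact_continuous_image continuous_on_subset[OF v]) auto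
  then obtain C where C: "\<And>x. x \<in> {a..b} \<Longrightarrow> norm (v x) \<le> C"
    unfolding bounded_iff by fast
  have [measurable]: "v \<in> borel_measurable borel"
    using v by (rule borel_measurable_continuous_onI)
  have [measurable]: "(\<lambda>x. indicator {a..b} x *\<^sub>R g x) \<in> borel_measurable lborel"
    using g by (auto simp: set_integrable_def)
  have eq: "indicator {a..b} x *\<^sub>R (v x * g x) = v x * (indicator {a..b} x *\<^sub>R g x)" for x
    by (simp add: indicator_def)
  show ?thesis
    unfolding set_integrable_def eq
  proof (rule Bochner_Integration.integrable_bound)
    show "integrable lborel (\<lambda>x. C * norm (indicator {a..b} x *\<^sub>R g x))"
      using g by (intro integrable_mult_right integrable_norm) (simp add: set_integrable_def)
    show "AE x in lborel. norm (v x * (indicator {a..b} x *\<^sub>R g x))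
            \<le> norm (C * norm (indicator {a..b} x *\<^sub>R g x))"
    proof (rule AE_I2)
      fix x :: real
      show "norm (v x * (indicator {a..b} x *\<^sub>R g x))
            \<le> norm (C * norm (indicator {a..b} x *\<^sub>R g x))"
        using C[of x] by (cases "x \<in> {a..b}") (auto simp: norm_mult abs_mult intro!: mult_right_mono)
    qed
  qed measurable
qed

text \<open>Bridge to the gauge integral, where the fundamental theorem and the continuity of
  indefinite integrals are available.\<close>

lemma has_ac_deriv_has_integral:
  assumes "has_ac_deriv v g" "a \<le> b"
  shows "(g has_integral (v b - v a)) {a..b}"
  using set_borel_integral_eq_integral[OF has_ac_derivD(2)[OF assms]] has_ac_derivD(3)[OF assms]
  by (metis has_integral_integrable_integral)

lemma has_ac_deriv_continuous:
  assumes "has_ac_deriv v g"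
  shows "continuous_on UNIV v"
proof -
  have "isCont v x" for x
  proof -
    have "continuous_on {x-1..x+1} (\<lambda>y. integral {x-1..y} g)"
      by (rule indefinite_integral_continuous_1)
         (use has_ac_deriv_has_integral[OF assms, of "x-1" "x+1"] in \<open>auto simp: has_integral_integrable_integral\<close>)
    hence "continuous_on {x-1..x+1} (\<lambda>y. v (x-1) + integral {x-1..y} g)"
      by (intro continuous_intros)
    moreover have "v (x-1) + integral {x-1..y} g = v y" if "y \<in> {x-1..x+1}" for y
      using has_ac_deriv_has_integral[OF assms, of "x-1" y] that
      by (auto simp: has_integral_integrable_integral)
    ultimately have "continuous_on {x-1..x+1} v"
      by (rule continuous_on_eq)
    thus "isCont v x"
      by (rule continuous_on_interior) auto
  qed
  thus ?thesis by (simp add: continuous_at_imp_continuous_on)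
qed

lemma has_ac_deriv_measurable:
  assumes "has_ac_deriv v g" shows "v \<in> borel_measurable borel"
  by (rule borel_measurable_continuous_onI[OF has_ac_deriv_continuous[OF assms]])

lemma has_ac_deriv_add:
  assumes "has_ac_deriv v g" "has_ac_deriv u k"
  shows "has_ac_deriv (\<lambda>x. v x + u x) (\<lambda>x. g x + k x)"
  using assms by (auto simp: has_ac_deriv_def set_integral_add)

lemma has_ac_deriv_cmult:
  assumes "has_ac_deriv v g"
  shows "has_ac_deriv (\<lambda>x. c * v x) (\<lambda>x. c * g x)"
  using assms by (auto simp: has_ac_deriv_def right_diff_distrib)

lemma has_ac_deriv_diff:
  assumes "has_ac_deriv v g" "has_ac_deriv u k"
  shows "has_ac_deriv (\<lambda>x. v x - u x) (\<lambda>x. g x - k x)"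
  using has_ac_deriv_add[OF assms(1) has_ac_deriv_cmult[OF assms(2), of "-1"]] by simp

lemma has_ac_deriv_cnj:
  assumes "has_ac_deriv v g"
  shows "has_ac_deriv (\<lambda>x. cnj (v x)) (\<lambda>x. cnj (g x))"
proof -
  have eq: "indicator A x *\<^sub>R cnj (g x) = cnj (indicator A x *\<^sub>R g x)" for A :: "real set" and x
    by simp
  have cnj: "cnj \<in> borel_measurable borel"
    by (intro borel_measurable_continuous_onI continuous_intros)
  show ?thesis
    using assms unfolding has_ac_deriv_def set_integrable_def set_lebesgue_integral_def eq
    by (auto simp del: complex_cnj_scaleR intro: measurable_compose[OF _ cnj])
qed

lemma has_ac_deriv_cong_AE:
  assumes "has_ac_deriv v g" "k \<in> borel_measurable borel" "AE x in lborel. g x = k x"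
  shows "has_ac_deriv v k"
proof -
  note [measurable] = has_ac_derivD(1)[OF assms(1)] assms(2)
  have "set_integrable lborel {a..b} k" "(LINT x:{a..b}|lborel. k x) = v b - v a" if "a \<le> b" for a b
  proof -
    have "set_integrable lborel {a..b} g \<longleftrightarrow> set_integrable lborel {a..b} k"
      by (rule set_integrable_cong_AE) (use assms(3) in auto)
    thus "set_integrable lborel {a..b} k" using has_ac_derivD(2)[OF assms(1) that] by simp
    have "(LINT x:{a..b}|lborel. g x) = (LINT x:{a..b}|lborel. k x)"
      by (rule set_lebesgue_integral_cong_AE) (use assms(3) in \<open>auto simp: set_borel_measurable_def\<close>)
    thus "(LINT x:{a..b}|lborel. k x) = v b - v a"
      using has_ac_derivD(3)[OF assms(1) that] by simp
  qed
  thus ?thesis using assms(2) by (auto simp: has_ac_deriv_def)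
qed

lemma has_ac_deriv_smooth:
  assumes "\<And>x. (v has_vector_derivative g x) (at x)" "continuous_on UNIV g"
  shows "has_ac_deriv v g"
proof -
  have "set_integrable lborel {a..b} g" "(LINT x:{a..b}|lborel. g x) = v b - v a" if "a \<le> b" for a b
  proof -
    show 1: "set_integrable lborel {a..b} g"
      by (rule borel_integrable_atLeastAtMost') (rule continuous_on_subset[OF assms(2)], simp)
    have "(g has_integral (v b - v a)) {a..b}"
      using that assms(1) by (intro fundamental_theorem_of_calculus) (auto intro: has_vector_derivative_at_within)
    thus "(LINT x:{a..b}|lborel. g x) = v b - v a"
      using set_borel_integral_eq_integral[OF 1] by (simp add: has_integral_integrable_integral)
  qed
  thus ?thesis
    using borel_measurable_continuous_onI[OF assms(2)] by (auto simp: has_ac_deriv_def)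
qed

section \<open>Product rule and affine substitution\<close>

text \<open>Integration by parts through Fubini: \<open>g x * k y\<close> is integrated over the
  triangle \<open>a \<le> x \<le> y \<le> b\<close> in both orders, with inner integrals
  \<open>v y - v a\<close> and \<open>u b - u x\<close>. No pointwise derivative occurs.\<close>

lemma has_ac_deriv_mult:
  assumes v: "has_ac_deriv v g" and u: "has_ac_deriv u k"
  shows "has_ac_deriv (\<lambda>x. v x * u x) (\<lambda>x. v x * k x + u x * g x)"
proof -
  note [measurable] = has_ac_derivD(1)[OF v] has_ac_derivD(1)[OF u] has_ac_deriv_measurable[OF v] has_ac_deriv_measurable[OF u]
  have I: "set_integrable lborel {a..b} (\<lambda>x. v x * k x)" "set_integrable lborel {a..b} (\<lambda>x. u x * g x)" if "a \<le> b" for a b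
    by (intro set_integrable_continuous_mult has_ac_deriv_continuous[OF v] has_ac_deriv_continuous[OF u]
        has_ac_derivD(2)[OF u that] has_ac_derivD(2)[OF v that])+
  have E: "(LINT x:{a..b}|lborel. v x * k x + u x * g x) = v b * u b - v a * u a" if ab: "a \<le> b" for a b
  proof -
    define f where "f x = indicator {a..b} x *\<^sub>R g x" for x
    define h where "h x = indicator {a..b} x *\<^sub>R k x" for x
    have [measurable]: "f \<in> borel_measurable borel" "h \<in> borel_measurable borel"
      unfolding f_def h_def by measurable
    have fi: "integrable lborel f" and hi: "integrable lborel h"
      using has_ac_derivD(2)[OF v ab] has_ac_derivD(2)[OF u ab]
      unfolding f_def h_def set_integrable_def .
    \<comment> \<open>The truncations \<open>f\<close>, \<open>h\<close> and the condition
      \<open>x \<le> y\<close> together cut out the triangle.\<close>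
    define F where "F = (\<lambda>(x::real,y::real). (if x \<le> y then f x * h y else 0))"
    have [measurable]: "F \<in> borel_measurable (lborel \<Otimes>\<^sub>M lborel)"
      unfolding F_def by measurable
    have Fi: "integrable (lborel \<Otimes>\<^sub>M lborel) F"
    proof (rule Bochner_Integration.integrable_bound)
      show "integrable (lborel \<Otimes>\<^sub>M lborel) (\<lambda>(x,y). f x * h y)"
      proof (rule lborel_pair.Fubini_integrable)
        show "integrable lborel (\<lambda>x. LINT y|lborel. norm (case (x, y) of (x, y) \<Rightarrow> f x * h y))"
          using fi by (simp add: norm_mult integrable_norm)
        show "AE x in lborel. integrable lborel (\<lambda>y. case (x, y) of (x, y) \<Rightarrow> f x * h y)"
          using hi by simp
      qed measurable
    qed (auto simp: F_def)
    have "(LINT x:{a..b}|lborel. v x * k x - v a * k x) = (LINT y|lborel. (LINT x|lborel. F (x, y)))"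
      unfolding set_lebesgue_integral_def
    proof (rule Bochner_Integration.integral_cong[OF refl])
      fix y :: real
      show "indicat_real {a..b} y *\<^sub>R (v y * k y - v a * k y) = (LINT x|lborel. F (x, y))"
      proof (cases "y \<in> {a..b}")
        case True
        have "(LINT x|lborel. F (x, y)) = (LINT x|lborel. (indicator {a..y} x *\<^sub>R g x) * h y)"
          using True by (intro Bochner_Integration.integral_cong) (auto simp: F_def f_def indicator_def)
        also have "\<dots> = (LINT x:{a..y}|lborel. g x) * h y"
          by (simp add: set_lebesgue_integral_def del: mult_scaleR_left)
        also have "\<dots> = (v y - v a) * k y"
          using has_ac_derivD(3)[OF v, of a y] True by (simp add: h_def)
        finally show ?thesis using True by (simp add: algebra_simps)
      next
        case False
        hence "h y = 0" by (simp add: h_def)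
        hence "F (x, y) = 0" for x by (simp add: F_def)
        thus ?thesis using False by simp
      qed
    qed
    also have "\<dots> = (LINT x|lborel. (LINT y|lborel. F (x, y)))"
      using lborel_pair.Fubini_integral[of "\<lambda>x y. F (x,y)"] Fi by simp
    also have "\<dots> = (LINT x:{a..b}|lborel. u b * g x - u x * g x)"
      unfolding set_lebesgue_integral_def
    proof (rule Bochner_Integration.integral_cong[OF refl])
      fix x :: real
      show "(LINT y|lborel. F (x, y)) = indicat_real {a..b} x *\<^sub>R (u b * g x - u x * g x)"
      proof (cases "x \<in> {a..b}")
        case True
        have "(LINT y|lborel. F (x, y)) = (LINT y|lborel. f x * (indicator {x..b} y *\<^sub>R k y))"
          using True by (intro Bochner_Integration.integral_cong) (auto simp: F_def h_def indicator_def)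
        also have "\<dots> = f x * (LINT y:{x..b}|lborel. k y)"
          by (simp add: set_lebesgue_integral_def del: mult_scaleR_right)
        also have "\<dots> = g x * (u b - u x)"
          using has_ac_derivD(3)[OF u, of x b] True by (simp add: f_def)
        finally show ?thesis using True by (simp add: algebra_simps)
      next
        case False
        hence "F (x, y) = 0" for y by (simp add: F_def f_def)
        thus ?thesis using False by simp
      qed
    qed
    finally have "(LINT x:{a..b}|lborel. v x * k x) - v a * (LINT x:{a..b}|lborel. k x)
       = u b * (LINT x:{a..b}|lborel. g x) - (LINT x:{a..b}|lborel. u x * g x)"
      using I[OF ab] has_ac_derivD(2)[OF v ab] has_ac_derivD(2)[OF u ab]
      by (simp add: set_integral_diff)
    thus ?thesis
      using I[OF ab] has_ac_derivD(3)[OF v ab] has_ac_derivD(3)[OF u ab]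
      by (simp add: set_integral_add algebra_simps)
  qed
  show ?thesis unfolding has_ac_deriv_def using I E by (auto simp: set_integral_add)
qed

text \<open>For negative \<open>c\<close> the map exchanges the endpoints, and this sign cancels
  against that of the factor \<open>c\<close>. The case \<open>c = -1\<close> is the reflection of
  the line.\<close>

lemma has_ac_deriv_affine:
  assumes v: "has_ac_deriv v g" and c: "c \<noteq> 0"
  shows "has_ac_deriv (\<lambda>x. v (t + c * x)) (\<lambda>x. complex_of_real c * g (t + c * x))"
proof -
  note [measurable] = has_ac_derivD(1)[OF v]
  have "set_integrable lborel {a..b} (\<lambda>x. g (t + c * x)) \<and>
      (LINT x:{a..b}|lborel. complex_of_real c * g (t + c * x)) = v (t + c * b) - v (t + c * a)"
    if ab: "a \<le> b" for a b
  proof (cases "c > 0")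
    case True
    have ind: "indicat_real {t + c * a..t + c * b} (t + c * x) = indicat_real {a..b} x" for x
      using True by (auto simp: indicator_def)
    have le: "t + c * a \<le> t + c * b" using ab True by simp
    show ?thesis
      using has_ac_derivD(2)[OF v le] lborel_integral_real_affine[OF c, of "\<lambda>x. indicat_real {t + c * a..t + c * b} x *\<^sub>R g x" t]
        has_ac_derivD(3)[OF v le]
        lborel_integrable_real_affine_iff[OF c, of "\<lambda>x. indicat_real {t + c * a..t + c * b} x *\<^sub>R g x" t] True
      by (simp add: set_integrable_def set_lebesgue_integral_def ind scaleR_conv_of_real)
  next
    case False
    hence c0: "c < 0" using c by simp
    have ind: "indicat_real {t + c * b..t + c * a} (t + c * x) = indicat_real {a..b} x" for x
      using c0 by (auto simp: indicator_def)
    have le: "t + c * b \<le> t + c * a" using ab c0 by simp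
    have "(LINT x|lborel. indicat_real {a..b} x *\<^sub>R g (t + c * x)) * (- complex_of_real c) = v (t + c * a) - v (t + c * b)"
      using has_ac_derivD(3)[OF v le] lborel_integral_real_affine[OF c, of "\<lambda>x. indicat_real {t + c * b..t + c * a} x *\<^sub>R g x" t] c0
      by (simp add: set_lebesgue_integral_def ind scaleR_conv_of_real)
    hence "complex_of_real c * (LINT x|lborel. indicat_real {a..b} x *\<^sub>R g (t + c * x)) = v (t + c * b) - v (t + c * a)"
      by (simp add: algebra_simps)
    moreover have "set_integrable lborel {a..b} (\<lambda>x. g (t + c * x))"
      using has_ac_derivD(2)[OF v le]
        lborel_integrable_real_affine_iff[OF c, of "\<lambda>x. indicat_real {t + c * b..t + c * a} x *\<^sub>R g x" t]
      by (simp add: set_integrable_def ind)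
    ultimately show ?thesis by (simp add: set_lebesgue_integral_def)
  qed
  thus ?thesis by (auto simp: has_ac_deriv_def)
qed

section \<open>Almost everywhere uniqueness and classical derivatives\<close>

text \<open>The integrals of the truncation \<open>f\<close> vanish on compact intervals, which
  generate the Borel sets; hence they vanish on every Borel set, and this forces \<open>f\<close> to
  be zero almost everywhere.\<close>

lemma AE_zero_if_interval_integrals_zero:
  fixes d :: "real \<Rightarrow> complex"
  assumes d: "set_integrable lborel {a..b} d"
    and z: "\<And>p q. a \<le> p \<Longrightarrow> p \<le> q \<Longrightarrow> q \<le> b \<Longrightarrow> (LINT x:{p..q}|lborel. d x) = 0"
  shows "AE x in lborel. x \<in> {a..b} \<longrightarrow> d x = 0"
proof -
  define f where "f x = indicator {a..b} x *\<^sub>R d x" for x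
  have fi: "integrable lborel f" using d by (simp add: f_def[abs_def] set_integrable_def)
  hence fA: "set_integrable lborel A f" if "A \<in> sets borel" for A
    unfolding set_integrable_def using that by (intro integrable_mult_indicator) auto
  have Icc: "(LINT x:{p..q}|lborel. f x) = 0" for p q
  proof -
    have "indicat_real {p..q} x *\<^sub>R f x = indicat_real {max a p..min b q} x *\<^sub>R d x" for x
      by (auto simp: f_def indicator_def)
    hence "(LINT x:{p..q}|lborel. f x) = (LINT x:{max a p..min b q}|lborel. d x)"
      by (simp add: set_lebesgue_integral_def)
    thus ?thesis
      using z[of "max a p" "min b q"]
      by (cases "max a p \<le> min b q") (simp_all add: set_lebesgue_integral_def)
  qed
  \<comment> \<open>The integral over the whole line enters the complement step of the induction
    below.\<close>
  have f0: "(LINT x|lborel. f x) = 0"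
  proof -
    have "(LINT x|lborel. f x) = (LINT x:{a..b}|lborel. f x)"
      unfolding set_lebesgue_integral_def
      by (intro Bochner_Integration.integral_cong) (auto simp: f_def indicator_def)
    thus ?thesis using Icc by simp
  qed
  have "AE x in lborel. f x = 0"
  proof (rule sigma_finite_measure.density_zero[OF sigma_finite_lborel fi])
    fix A :: "real set" assume "A \<in> sets lborel"
    hence "A \<in> sets borel" by simp
    thus "set_lebesgue_integral lborel A f = 0"
    proof (induction A rule: borel_set_induct)
      case empty
      show ?case by (simp add: set_lebesgue_integral_def)
    next
      case (interval p q)
      show ?case by (rule Icc)
    next
      case (compl A)
      have "(LINT x:A \<union> -A|lborel. f x) = (LINT x:A|lborel. f x) + (LINT x:-A|lborel. f x)"
        using compl by (intro set_integral_Un fA) auto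
      thus ?case using compl f0 by (simp add: set_lebesgue_integral_def)
    next
      case (union A)
      have "(LINT x:(\<Union>i. A i)|lborel. f x) = (\<Sum>i. (LINT x:(A i)|lborel. f x))"
        using union by (intro lebesgue_integral_countable_add fA) (auto simp: disjoint_family_on_def)
      thus ?case using union by simp
    qed
  qed
  thus ?thesis
    by eventually_elim (auto simp: f_def)
qed

text \<open>Local in \<open>k\<close>, because \<open>k\<close> will be a classical derivative on an
  open set, with no control near the boundary of that set.\<close>

lemma has_ac_deriv_unique_on_interval:
  assumes v: "has_ac_deriv v g" and k: "set_integrable lborel {a..b} k"
    and eq: "\<And>p q. a \<le> p \<Longrightarrow> p \<le> q \<Longrightarrow> q \<le> b \<Longrightarrow> (LINT x:{p..q}|lborel. k x) = v q - v p"
  shows "AE x in lborel. x \<in> {a..b} \<longrightarrow> g x = k x"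
proof (cases "a \<le> b")
  case True
  have "AE x in lborel. x \<in> {a..b} \<longrightarrow> g x - k x = 0"
  proof (rule AE_zero_if_interval_integrals_zero)
    show "set_integrable lborel {a..b} (\<lambda>x. g x - k x)"
      using has_ac_derivD(2)[OF v True] k by (rule set_integral_diff)
    fix p q assume "a \<le> p" "p \<le> q" "q \<le> b"
    moreover from this have "set_integrable lborel {p..q} k"
      by (intro set_integrable_subset[OF k]) auto
    ultimately show "(LINT x:{p..q}|lborel. g x - k x) = 0"
      using has_ac_derivD[OF v] eq[of p q] by (simp add: set_integral_diff)
  qed
  thus ?thesis by simp
qed auto

lemma has_ac_deriv_unique:
  assumes v: "has_ac_deriv v g" and k: "has_ac_deriv v k"
  shows "AE x in lborel. g x = k x"
proof -
  have "AE x in lborel. \<forall>n::nat. x \<in> {-real n..real n} \<longrightarrow> g x = k x"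
    unfolding AE_all_countable
    by (intro allI has_ac_deriv_unique_on_interval[OF v] has_ac_derivD[OF k]) auto
  thus ?thesis
  proof eventually_elim
    case (elim x)
    obtain n :: nat where "\<bar>x\<bar> \<le> n" using real_arch_simple by blast
    thus ?case using elim[rule_format, of n] by (simp add: abs_le_iff)
  qed
qed

text \<open>The intervals with rational endpoints inside \<open>S\<close> are countable in number
  and cover \<open>S\<close>; on each of them the fundamental theorem gives \<open>g\<close> and
  \<open>k\<close> the same increments.\<close>

lemma has_ac_deriv_AE_classical:
  assumes v: "has_ac_deriv v g" and S: "open S"
    and k: "\<And>x. x \<in> S \<Longrightarrow> (v has_vector_derivative k x) (at x)" "continuous_on S k"
  shows "AE x in lborel. x \<in> S \<longrightarrow> g x = k x"
proof -
  have "AE x in lborel. {real_of_rat (fst r)..real_of_rat (snd r)} \<subseteq> S \<longrightarrow>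
          x \<in> {real_of_rat (fst r)..real_of_rat (snd r)} \<longrightarrow> g x = k x" for r
  proof (cases "{real_of_rat (fst r)..real_of_rat (snd r)} \<subseteq> S")
    case True
    let ?a = "real_of_rat (fst r)" and ?b = "real_of_rat (snd r)"
    have I: "set_integrable lborel {p..q} k" if "{p..q} \<subseteq> S" for p q
      by (rule borel_integrable_atLeastAtMost') (rule continuous_on_subset[OF k(2) that])
    have "AE x in lborel. x \<in> {?a..?b} \<longrightarrow> g x = k x"
    proof (rule has_ac_deriv_unique_on_interval[OF v I[OF True]])
      fix p q assume *: "?a \<le> p" "p \<le> q" "q \<le> ?b"
      hence sub: "{p..q} \<subseteq> S" using True by force
      have "(k has_integral (v q - v p)) {p..q}"
        by (intro fundamental_theorem_of_calculus has_vector_derivative_at_within[OF k(1)]) (use * sub in auto)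
      thus "(LINT x:{p..q}|lborel. k x) = v q - v p"
        using set_borel_integral_eq_integral[OF I[OF sub]] by (simp add: has_integral_integrable_integral)
    qed
    thus ?thesis by eventually_elim auto
  qed auto
  hence "AE x in lborel. \<forall>r. {real_of_rat (fst r)..real_of_rat (snd r)} \<subseteq> S \<longrightarrow>
          x \<in> {real_of_rat (fst r)..real_of_rat (snd r)} \<longrightarrow> g x = k x"
    unfolding AE_all_countable by blast
  thus ?thesis
  proof eventually_elim
    case (elim x)
    show ?case
    proof
      assume "x \<in> S"
      then obtain e where e: "e > 0" "ball x e \<subseteq> S" using S openE by blast
      obtain p where p: "x - e < real_of_rat p" "real_of_rat p < x" using of_rat_dense[of "x - e" x] e by auto
      obtain q where q: "x < real_of_rat q" "real_of_rat q < x + e" using of_rat_dense[of x "x + e"] e by auto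
      have "{real_of_rat p..real_of_rat q} \<subseteq> ball x e"
        using p q by (auto simp: dist_real_def)
      thus "g x = k x" using elim[rule_format, of "(p,q)"] p q e by auto
    qed
  qed
qed

text \<open>Changing \<open>g\<close> on a null set does not affect increments, so near
  \<open>x\<close> the function \<open>v\<close> is a primitive of the continuous
  \<open>k\<close>.\<close>

lemma has_ac_deriv_imp_classical:
  assumes v: "has_ac_deriv v g" and S: "open S" "x \<in> S"
    and k: "AE x in lborel. x \<in> S \<longrightarrow> g x = k x" "continuous_on S k"
  shows "(v has_vector_derivative k x) (at x)"
proof -
  obtain e where e: "e > 0" "cball x e \<subseteq> S" using S open_contains_cball by blast
  define a b where "a = x - e" and "b = x + e"
  have sub: "{a..b} \<subseteq> S" using e by (auto simp: a_def b_def cball_eq_atLeastAtMost)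
  have eq: "v a + integral {a..y} k = v y" if y: "y \<in> {a..b}" for y
  proof -
    have "(g has_integral (v y - v a)) {a..y}"
      using y by (intro has_ac_deriv_has_integral[OF v]) auto
    moreover have I: "set_integrable lborel {a..y} k"
      by (rule borel_integrable_atLeastAtMost') (rule continuous_on_subset[OF k(2)], use y sub in auto)
    have "(LINT x:{a..y}|lborel. g x) = (LINT x:{a..y}|lborel. k x)"
      unfolding set_lebesgue_integral_def
    proof (rule integral_cong_AE)
      show "AE x in lborel. indicat_real {a..y} x *\<^sub>R g x = indicat_real {a..y} x *\<^sub>R k x"
        using k(1)
      proof eventually_elim
        case (elim x)
        have "x \<in> {a..y} \<Longrightarrow> x \<in> S" using sub y by auto
        thus ?case using elim by (auto simp: indicator_def)
      qed
      show "(\<lambda>x. indicat_real {a..y} x *\<^sub>R k x) \<in> borel_measurable lborel"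
        using I by (auto simp: set_integrable_def)
      show "(\<lambda>x. indicat_real {a..y} x *\<^sub>R g x) \<in> borel_measurable lborel"
        using has_ac_derivD(2)[OF v, of a y] y by (auto simp: set_integrable_def)
    qed
    ultimately show ?thesis
      using set_borel_integral_eq_integral[OF I] has_ac_derivD(3)[OF v, of a y] y by simp
  qed
  have "((\<lambda>u. integral {a..u} k) has_vector_derivative k x) (at x within {a..b})"
    by (rule integral_has_vector_derivative) (use continuous_on_subset[OF k(2) sub] e in \<open>auto simp: a_def b_def\<close>)
  hence "((\<lambda>u. v a + integral {a..u} k) has_vector_derivative k x) (at x within {a..b})"
    by (auto intro!: derivative_eq_intros)
  hence "(v has_vector_derivative k x) (at x within {a..b})"
    by (rule has_vector_derivative_transform[rotated 2]) (use e eq in \<open>auto simp: a_def b_def\<close>)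
  moreover have "at x within {a..b} = at x"
    by (rule at_within_interior) (use e in \<open>auto simp: a_def b_def\<close>)
  ultimately show ?thesis by simp
qed

section \<open>Changes of variables and cutting at a zero\<close>

text \<open>The general change of variables theorem concerns Lebesgue absolute integrability over an
  image. Monotonicity and the intermediate value theorem identify the image of the interval, and
  Borel measurability of the integrand brings the result back to \<open>lborel\<close>.\<close>

lemma has_ac_deriv_substitution:
  assumes v: "has_ac_deriv v g" and ab: "a \<le> b"
    and [measurable]: "\<phi> \<in> borel_measurable borel" "\<phi>' \<in> borel_measurable borel"
    and der: "\<And>x. x \<in> {a..b} \<Longrightarrow> (\<phi> has_real_derivative \<phi>' x) (at x)"
    and pos: "\<And>x. x \<in> {a..b} \<Longrightarrow> \<phi>' x > 0"
  shows "set_integrable lborel {a..b} (\<lambda>x. complex_of_real (\<phi>' x) * g (\<phi> x))"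
    and "(LINT x:{a..b}|lborel. complex_of_real (\<phi>' x) * g (\<phi> x)) = v (\<phi> b) - v (\<phi> a)"
proof -
  note [measurable] = has_ac_derivD(1)[OF v]
  have mono: "\<phi> x < \<phi> y" if "a \<le> x" "x < y" "y \<le> b" for x y
  proof (rule DERIV_pos_imp_increasing[OF that(2)])
    fix t assume "x \<le> t" "t \<le> y"
    hence "t \<in> {a..b}" using that by auto
    thus "\<exists>z. (\<phi> has_real_derivative z) (at t) \<and> z > 0" using der pos by blast
  qed
  have le: "\<phi> a \<le> \<phi> b" using mono[of a b] ab by (cases "a = b") auto
  have inj: "inj_on \<phi> {a..b}"
  proof (rule linorder_inj_onI)
    fix x y assume "x < y" "x \<in> {a..b}" "y \<in> {a..b}"
    thus "\<phi> x \<noteq> \<phi> y" using mono[of x y] by auto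
  qed auto
  have cont: "continuous_on {a..b} \<phi>"
    by (intro continuous_at_imp_continuous_on ballI DERIV_isCont[OF der])
  have img: "\<phi> ` {a..b} = {\<phi> a..\<phi> b}"
  proof (intro equalityI subsetI)
    fix y assume "y \<in> \<phi> ` {a..b}"
    then obtain x where x: "x \<in> {a..b}" "y = \<phi> x" by blast
    thus "y \<in> {\<phi> a..\<phi> b}"
      using mono[of a x] mono[of x b] le by (cases "a = x"; cases "x = b"; simp)
  next
    fix y assume "y \<in> {\<phi> a..\<phi> b}"
    hence "\<phi> a \<le> y" "y \<le> \<phi> b" by simp_all
    from IVT'[OF this ab cont] obtain x where "a \<le> x" "x \<le> b" "\<phi> x = y" by blast
    thus "y \<in> \<phi> ` {a..b}" by (intro image_eqI[of _ _ x]) simp_all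
  qed
  have gI: "g absolutely_integrable_on {\<phi> a..\<phi> b}"
    using has_ac_derivD(2)[OF v le] unfolding set_integrable_def
    by (subst integrable_completion) auto
  moreover have "integral {\<phi> a..\<phi> b} g = v (\<phi> b) - v (\<phi> a)"
    using has_ac_deriv_has_integral[OF v le] by (simp add: has_integral_integrable_integral)
  ultimately have *: "(\<lambda>x. \<bar>\<phi>' x\<bar> *\<^sub>R g (\<phi> x)) absolutely_integrable_on {a..b} \<and>
     integral {a..b} (\<lambda>x. \<bar>\<phi>' x\<bar> *\<^sub>R g (\<phi> x)) = v (\<phi> b) - v (\<phi> a)"
    unfolding img[symmetric]
    by (subst has_absolute_integral_change_of_variables_real[OF _ has_field_derivative_at_within[OF der] inj]) simp_all
  have "set_integrable lebesgue {a..b} (\<lambda>x. complex_of_real (\<phi>' x) * g (\<phi> x)) \<longleftrightarrow>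
        set_integrable lebesgue {a..b} (\<lambda>x. \<bar>\<phi>' x\<bar> *\<^sub>R g (\<phi> x))"
    by (rule set_integrable_cong) (use pos in \<open>auto simp: scaleR_conv_of_real less_imp_le\<close>)
  hence "set_integrable lebesgue {a..b} (\<lambda>x. complex_of_real (\<phi>' x) * g (\<phi> x))" using * by blast
  thus 1: "set_integrable lborel {a..b} (\<lambda>x. complex_of_real (\<phi>' x) * g (\<phi> x))"
    unfolding set_integrable_def by (subst (asm) integrable_completion) simp_all
  have "integral {a..b} (\<lambda>x. complex_of_real (\<phi>' x) * g (\<phi> x)) = integral {a..b} (\<lambda>x. \<bar>\<phi>' x\<bar> *\<^sub>R g (\<phi> x))"
    by (rule Henstock_Kurzweil_Integration.integral_cong) (use pos in \<open>auto simp: scaleR_conv_of_real less_imp_le\<close>)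
  with * show "(LINT x:{a..b}|lborel. complex_of_real (\<phi>' x) * g (\<phi> x)) = v (\<phi> b) - v (\<phi> a)"
    using set_borel_integral_eq_integral[OF 1] by simp
qed

text \<open>Both functions vanish on the left, so only the part of an interval in the right half
  line contributes.\<close>

lemma has_ac_deriv_halfI:
  assumes [measurable]: "g \<in> borel_measurable borel"
    and z: "\<And>x. x \<le> 0 \<Longrightarrow> v x = 0" "\<And>x. x \<le> 0 \<Longrightarrow> g x = 0"
    and I: "\<And>a b. 0 \<le> a \<Longrightarrow> a \<le> b \<Longrightarrow> set_integrable lborel {a..b} g \<and> (LINT x:{a..b}|lborel. g x) = v b - v a"
  shows "has_ac_deriv v g"
  unfolding has_ac_deriv_def
proof (intro conjI allI impI)
  fix a b :: real assume ab: "a \<le> b"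
  have eq: "indicat_real {a..b} x *\<^sub>R g x = indicat_real {max 0 a..max 0 b} x *\<^sub>R g x" for x
    using z(2)[of x] by (cases "x \<le> 0") (auto simp: indicator_def)
  \<comment> \<open>A negative endpoint may be moved to 0, since \<open>v\<close> vanishes there as
    well.\<close>
  have m: "v (max 0 c) = v c" for c using z(1)[of c] z(1)[of 0] by (auto simp: max_def)
  have "set_integrable lborel {max 0 a..max 0 b} g \<and> (LINT x:{max 0 a..max 0 b}|lborel. g x) = v (max 0 b) - v (max 0 a)"
    using ab by (intro I) auto
  thus "set_integrable lborel {a..b} g" "(LINT x:{a..b}|lborel. g x) = v b - v a"
    unfolding set_integrable_def set_lebesgue_integral_def eq m by auto
qed fact

text \<open>The hypotheses \<open>v 0 = 0\<close> and \<open>\<phi> 0 = 0\<close> make the extension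
  by zero continuous at the origin, so cutting produces no point mass in the derivative; the value
  of the derivative at 0 itself affects only a null set.\<close>

lemma has_ac_deriv_half_comp:
  assumes v: "has_ac_deriv v g" "v 0 = 0" "\<phi> 0 = 0"
    and [measurable]: "\<phi> \<in> borel_measurable borel" "\<phi>' \<in> borel_measurable borel"
    and der: "\<And>x. x \<ge> 0 \<Longrightarrow> (\<phi> has_real_derivative \<phi>' x) (at x)"
    and pos: "\<And>x. x \<ge> 0 \<Longrightarrow> \<phi>' x > 0"
  shows "has_ac_deriv (\<lambda>x. if x > 0 then v (\<phi> x) else 0)
            (\<lambda>x. if x > 0 then complex_of_real (\<phi>' x) * g (\<phi> x) else 0)"
proof (rule has_ac_deriv_halfI)
  note [measurable] = has_ac_derivD(1)[OF v(1)]
  let ?g = "\<lambda>x. if x > 0 then complex_of_real (\<phi>' x) * g (\<phi> x) else 0"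
  show meas: "?g \<in> borel_measurable borel" by measurable
  fix a b :: real assume ab: "0 \<le> a" "a \<le> b"
  have AE: "AE x\<in>{a..b} in lborel. complex_of_real (\<phi>' x) * g (\<phi> x) = ?g x"
    using AE_lborel_singleton[of "0::real"] by eventually_elim (use ab in auto)
  have S: "set_integrable lborel {a..b} (\<lambda>x. complex_of_real (\<phi>' x) * g (\<phi> x))"
    "(LINT x:{a..b}|lborel. complex_of_real (\<phi>' x) * g (\<phi> x)) = v (\<phi> b) - v (\<phi> a)"
    by (rule has_ac_deriv_substitution[OF v(1) ab(2)]; use ab(1) der pos in simp)+
  have "set_integrable lborel {a..b} (\<lambda>x. complex_of_real (\<phi>' x) * g (\<phi> x)) \<longleftrightarrow> set_integrable lborel {a..b} ?g"
    using AE by (intro set_integrable_cong_AE) auto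
  moreover have "(LINT x:{a..b}|lborel. complex_of_real (\<phi>' x) * g (\<phi> x)) = (LINT x:{a..b}|lborel. ?g x)"
    using AE by (intro set_lebesgue_integral_cong_AE) auto
  ultimately show "set_integrable lborel {a..b} ?g \<and> (LINT x:{a..b}|lborel. ?g x)
     = (if b > 0 then v (\<phi> b) else 0) - (if a > 0 then v (\<phi> a) else 0)"
    using S ab v(2,3) by (cases "b = 0"; cases "a = 0"; simp)
qed simp_all

lemma has_ac_deriv_half:
  assumes "has_ac_deriv v g" "v 0 = 0"
  shows "has_ac_deriv (\<lambda>x. if x > 0 then v x else 0) (\<lambda>x. if x > 0 then g x else 0)"
proof -
  have "has_ac_deriv (\<lambda>x. if x > 0 then v x else 0) (\<lambda>x. if x > 0 then complex_of_real 1 * g x else 0)"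
    by (rule has_ac_deriv_half_comp[OF assms]) auto
  thus ?thesis by (simp cong: if_cong)
qed

subsection \<open>Test functions and weak derivatives\<close>

text \<open>This is n + 1 times differentiability. Holding for every \<open>n\<close> it is the
  smoothness clause of \<open>test_function\<close>; the finite order makes induction
  possible.\<close>

definition ndiff :: "nat \<Rightarrow> (real \<Rightarrow> real) \<Rightarrow> bool" where
  "ndiff n f \<longleftrightarrow> (\<forall>k\<le>n. \<forall>x. ((deriv ^^ k) f) differentiable (at x))"

lemma ndiff_0_iff: "ndiff 0 f \<longleftrightarrow> (\<forall>x. f differentiable (at x))"
  by (simp add: ndiff_def)

lemma ndiff_Suc_iff: "ndiff (Suc n) f \<longleftrightarrow> (\<forall>x. f differentiable (at x)) \<and> ndiff n (deriv f)"
proof -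
  have "(\<forall>k\<le>Suc n. P k) \<longleftrightarrow> P 0 \<and> (\<forall>k\<le>n. P (Suc k))" for P
    by (metis Suc_le_mono le0 not0_implies_Suc)
  thus ?thesis by (simp add: ndiff_def funpow_Suc_right del: funpow.simps)
qed

lemma ndiff_mono: "ndiff (Suc n) f \<Longrightarrow> ndiff n f"
  by (auto simp: ndiff_def)

lemma ndiff_differentiable: "ndiff n f \<Longrightarrow> f differentiable (at x)"
  unfolding ndiff_def by (drule spec[of _ 0]) simp

lemma ndiff_DERIV: "ndiff n f \<Longrightarrow> (f has_real_derivative deriv f x) (at x)"
  using ndiff_differentiable[of n f x] by (simp add: DERIV_deriv_iff_real_differentiable)

lemma ndiff_SucI:
  assumes "\<And>x. (f has_real_derivative f' x) (at x)" "ndiff n f'"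
  shows "ndiff (Suc n) f"
proof -
  have "deriv f = f'" using assms(1) by (intro ext DERIV_imp_deriv)
  thus ?thesis using assms by (auto simp: ndiff_Suc_iff real_differentiable_def)
qed

lemma ndiff_const: "ndiff n (\<lambda>_. c)"
proof (induction n arbitrary: c)
  case (Suc n)
  show ?case by (rule ndiff_SucI[where f' = "\<lambda>_. 0"]) (auto intro: Suc)
qed (auto simp: ndiff_0_iff)

lemma ndiff_add: "ndiff n f \<Longrightarrow> ndiff n g \<Longrightarrow> ndiff n (\<lambda>x. f x + g x)"
proof (induction n arbitrary: f g)
  case (Suc n)
  show ?case
    by (rule ndiff_SucI[where f' = "\<lambda>x. deriv f x + deriv g x"])
       (use Suc in \<open>auto simp: ndiff_Suc_iff intro!: DERIV_add ndiff_DERIV[of "Suc n"]\<close>)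
qed (auto simp: ndiff_0_iff)

lemma ndiff_mult: "ndiff n f \<Longrightarrow> ndiff n g \<Longrightarrow> ndiff n (\<lambda>x. f x * g x)"
proof (induction n arbitrary: f g)
  case (Suc n)
  show ?case
  proof (rule ndiff_SucI[where f' = "\<lambda>x. deriv f x * g x + deriv g x * f x"])
    show "((\<lambda>x. f x * g x) has_real_derivative deriv f x * g x + deriv g x * f x) (at x)" for x
      by (intro DERIV_mult ndiff_DERIV[OF Suc.prems(1)] ndiff_DERIV[OF Suc.prems(2)])
    show "ndiff n (\<lambda>x. deriv f x * g x + deriv g x * f x)"
      using Suc.prems ndiff_mono[OF Suc.prems(1)] ndiff_mono[OF Suc.prems(2)]
      by (intro ndiff_add Suc.IH) (simp_all add: ndiff_Suc_iff)
  qed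
qed (auto simp: ndiff_0_iff)

lemma ndiff_cmult: "ndiff n f \<Longrightarrow> ndiff n (\<lambda>x. c * f x)"
  by (intro ndiff_mult ndiff_const)

lemma ndiff_affine: "ndiff n f \<Longrightarrow> ndiff n (\<lambda>x. f (p + q * x))"
proof (induction n arbitrary: f)
  case 0
  have "((\<lambda>x. f (p + q * x)) has_real_derivative deriv f (p + q * x) * q) (at x)" for x
    by (rule DERIV_chain'[where g = f]) (auto intro!: derivative_eq_intros ndiff_DERIV[OF 0])
  thus ?case by (auto simp: ndiff_0_iff real_differentiable_def)
next
  case (Suc n)
  show ?case
  proof (rule ndiff_SucI[where f' = "\<lambda>x. q * deriv f (p + q * x)"])
    have "((\<lambda>x. f (p + q * x)) has_real_derivative deriv f (p + q * x) * q) (at x)" for x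
      by (rule DERIV_chain'[where g = f]) (auto intro!: derivative_eq_intros ndiff_DERIV[OF Suc.prems])
    thus "((\<lambda>x. f (p + q * x)) has_real_derivative q * deriv f (p + q * x)) (at x)" for x
      by (subst mult.commute)
    show "ndiff n (\<lambda>x. q * deriv f (p + q * x))"
      using Suc.prems by (intro ndiff_cmult Suc.IH) (auto simp: ndiff_Suc_iff)
  qed
qed

text \<open>The function x^(-k) exp(-1/x), continued by zero. Admitting all powers \<open>k\<close>
  makes the span of the family closed under differentiation, so smoothness follows by induction for
  all \<open>k\<close> at once.\<close>

definition flat_exp :: "nat \<Rightarrow> real \<Rightarrow> real" where
  "flat_exp k x = (if x > 0 then inverse x ^ k / exp (inverse x) else 0)"

lemma flat_exp_DERIV:
  "(flat_exp k has_real_derivative - real k * flat_exp (Suc k) x + flat_exp (Suc (Suc k)) x) (at x)"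
proof -
  consider "x < 0" | "x = 0" | "x > 0" by linarith
  thus ?thesis
  proof cases
    case 1
    have "((\<lambda>_. 0) has_real_derivative 0) (at x)" by simp
    hence "(flat_exp k has_real_derivative 0) (at x)"
      by (rule has_field_derivative_transform_within_open[where S = "{..<0}"]) (use 1 in \<open>auto simp: flat_exp_def\<close>)
    thus ?thesis using 1 by (simp add: flat_exp_def)
  next
    case 2
    have "((\<lambda>y. flat_exp k y / y) \<longlongrightarrow> 0) (at_left 0)"
      by (rule tendsto_eventually) (auto simp: flat_exp_def eventually_at_filter)
    \<comment> \<open>With u = 1/y the difference quotient from the right is u^(k+1) / exp u, and u
      tends to infinity.\<close>
    moreover have "((\<lambda>y. inverse y ^ Suc k / exp (inverse y)) \<longlongrightarrow> 0) (at_right (0::real))"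
      by (rule filterlim_compose[OF tendsto_power_div_exp_0 filterlim_inverse_at_top_right])
    hence "((\<lambda>y. flat_exp k y / y) \<longlongrightarrow> 0) (at_right 0)"
      by (rule Lim_transform_eventually)
         (auto simp: flat_exp_def eventually_at_filter field_simps)
    ultimately have "((\<lambda>y. flat_exp k y / y) \<longlongrightarrow> 0) (at 0)"
      by (simp add: filterlim_at_split)
    thus ?thesis using 2 by (simp add: has_field_derivative_iff flat_exp_def)
  next
    case 3
    have "((\<lambda>x. inverse x ^ k / exp (inverse x)) has_real_derivative
        - real k * flat_exp (Suc k) x + flat_exp (Suc (Suc k)) x) (at x)"
      using 3 by (cases k)
        (auto intro!: derivative_eq_intros simp: flat_exp_def divide_simps, simp_all add: algebra_simps power_eq_if)
    thus ?thesis
      by (rule has_field_derivative_transform_within_open[where S = "{0<..}"]) (use 3 in \<open>auto simp: flat_exp_def\<close>)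
  qed
qed

lemma ndiff_flat_exp: "ndiff n (flat_exp k)"
proof (induction n arbitrary: k)
  case 0
  show ?case using flat_exp_DERIV by (auto simp: ndiff_0_iff real_differentiable_def)
next
  case (Suc n)
  show ?case
    by (rule ndiff_SucI[OF flat_exp_DERIV]) (intro ndiff_add ndiff_cmult Suc)
qed

text \<open>The normalized primitive of the bump \<open>\<rho>\<close>, which is positive exactly on
  (0,1). It is the profile of the cutoffs with which weak derivatives will be tested.\<close>

lemma smooth_step_exists:
  obtains R r :: "real \<Rightarrow> real" where
    "\<And>n. ndiff n R" "\<And>x. (R has_real_derivative r x) (at x)" "continuous_on UNIV r"
    "\<And>x. x \<le> 0 \<Longrightarrow> R x = 0" "\<And>x. x \<ge> 1 \<Longrightarrow> R x = 1" "\<And>x. 0 \<le> R x \<and> R x \<le> 1"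
    "\<And>x. x \<notin> {0..1} \<Longrightarrow> r x = 0"
proof -
  define \<rho> where "\<rho> x = flat_exp 0 x * flat_exp 0 (1 + (-1) * x)" for x
  have nd: "ndiff n \<rho>" for n
    unfolding \<rho>_def[abs_def] by (intro ndiff_mult ndiff_affine ndiff_flat_exp)
  have cont: "continuous_on UNIV \<rho>"
    by (intro continuous_at_imp_continuous_on ballI DERIV_isCont[OF ndiff_DERIV[OF nd[of 0]]])
  have nonneg: "\<rho> x \<ge> 0" for x by (auto simp: \<rho>_def flat_exp_def)
  have zero: "\<rho> x = 0" if "x \<le> 0 \<or> x \<ge> 1" for x using that by (auto simp: \<rho>_def flat_exp_def)
  have pos: "\<rho> x > 0" if "0 < x" "x < 1" for x using that by (auto simp: \<rho>_def flat_exp_def)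
  have "\<exists>F. \<forall>x::real. -\<infinity> < ereal x \<longrightarrow> ereal x < \<infinity> \<longrightarrow> (F has_vector_derivative \<rho> x) (at x)"
    by (rule einterval_antiderivative) (use cont in \<open>auto simp: continuous_on_eq_continuous_at\<close>)
  then obtain F where F: "(F has_real_derivative \<rho> x) (at x)" for x
    by (auto simp: has_real_derivative_iff_has_vector_derivative)
  have F01: "F 0 < F 1"
    by (rule DERIV_pos_imp_increasing_open)
       (use F pos in \<open>auto intro!: continuous_at_imp_continuous_on DERIV_isCont[OF F]\<close>)
  have mono: "F x \<le> F y" if "x \<le> y" for x y
    by (rule DERIV_nonneg_imp_nondecreasing[OF that]) (use F nonneg in auto)
  have neg: "F x = F 0" if "x \<le> 0" for x
  proof (rule order.antisym[OF mono[OF that]], rule DERIV_nonpos_imp_nonincreasing[OF that])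
    fix t :: real assume "x \<le> t" "t \<le> 0"
    thus "\<exists>y. (F has_real_derivative y) (at t) \<and> y \<le> 0" using F[of t] zero[of t] by auto
  qed
  have ge1: "F x = F 1" if "x \<ge> 1" for x
  proof (rule order.antisym[OF _ mono[OF that]], rule DERIV_nonpos_imp_nonincreasing[OF that])
    fix t :: real assume "1 \<le> t" "t \<le> x"
    thus "\<exists>y. (F has_real_derivative y) (at t) \<and> y \<le> 0" using F[of t] zero[of t] by auto
  qed
  define R where "R x = (F x - F 0) / (F 1 - F 0)" for x
  have D: "(R has_real_derivative inverse (F 1 - F 0) * \<rho> x) (at x)" for x
    using DERIV_cdivide[OF DERIV_diff[OF F[of x] DERIV_const[of "F 0"]], of "F 1 - F 0"]
    by (simp add: R_def[abs_def] divide_inverse mult.commute)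
  show ?thesis
  proof (rule that[of R "\<lambda>x. inverse (F 1 - F 0) * \<rho> x"])
    show "ndiff n R" for n
      by (rule ndiff_mono, rule ndiff_SucI[OF D]) (intro ndiff_cmult nd)
    show "continuous_on UNIV (\<lambda>x. inverse (F 1 - F 0) * \<rho> x)" by (intro continuous_intros cont)
    show "0 \<le> R x \<and> R x \<le> 1" for x
      using F01 mono[of 0 x] mono[of x 1] neg[of x] ge1[of x]
      by (cases "x \<le> 0"; cases "x \<ge> 1") (auto simp: R_def)
    show "R x = 0" if "x \<le> 0" for x using neg[OF that] by (simp add: R_def)
    show "R x = 1" if "x \<ge> 1" for x using ge1[OF that] F01 by (simp add: R_def)
    show "inverse (F 1 - F 0) * \<rho> x = 0" if "x \<notin> {0..1}" for x using zero[of x] that by auto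
  qed (rule D)
qed

section \<open>Weak derivatives and absolute continuity\<close>

lemma test_functionD:
  assumes "test_function \<psi>"
  obtains A where "A > 0" "\<And>x. \<bar>x\<bar> \<ge> A \<Longrightarrow> \<psi> x = 0 \<and> deriv \<psi> x = 0"
    "\<And>x. (\<psi> has_real_derivative deriv \<psi> x) (at x)" "continuous_on UNIV (deriv \<psi>)"
proof -
  have nd: "ndiff n \<psi>" for n using assms by (auto simp: test_function_def ndiff_def)
  have D: "(\<psi> has_real_derivative deriv \<psi> x) (at x)" for x using ndiff_DERIV[OF nd] .
  have "ndiff 0 (deriv \<psi>)" using nd[of 1] by (simp add: ndiff_Suc_iff)
  hence cont: "continuous_on UNIV (deriv \<psi>)"
    by (intro continuous_at_imp_continuous_on ballI DERIV_isCont[OF ndiff_DERIV])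
  have "bounded (closure {x. \<psi> x \<noteq> 0})" using assms by (simp add: test_function_def compact_imp_bounded)
  then obtain B where "\<forall>x\<in>closure {x. \<psi> x \<noteq> 0}. norm x \<le> B" unfolding bounded_iff by blast
  note B0 = this
  have B: "\<psi> x = 0" if "\<bar>x\<bar> > B" for x
  proof (rule ccontr)
    assume "\<psi> x \<noteq> 0"
    hence "x \<in> closure {x. \<psi> x \<noteq> 0}" using closure_subset[of "{x. \<psi> x \<noteq> 0}"] by blast
    thus False using B0 that by force
  qed
  have B': "deriv \<psi> x = 0" if "\<bar>x\<bar> > B" for x
  proof -
    have op: "open {x::real. \<bar>x\<bar> > B}" by (intro open_Collect_less continuous_intros)
    have "(\<psi> has_real_derivative 0) (at x)"
    proof (rule has_field_derivative_transform_within_open[OF DERIV_const op])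
      show "x \<in> {x. \<bar>x\<bar> > B}" using that by simp
      show "0 = \<psi> y" if "y \<in> {x. \<bar>x\<bar> > B}" for y using B[of y] that by simp
    qed
    thus ?thesis by (rule DERIV_imp_deriv)
  qed
  show ?thesis
  proof (rule that)
    \<comment> \<open>The added 1 keeps the radius positive and puts it strictly beyond
      \<open>B\<close>, inside the open set on which the function and hence its derivative
      vanish.\<close>
    show "0 < \<bar>B\<bar> + 1" by simp
    show "\<psi> x = 0 \<and> deriv \<psi> x = 0" if "\<bar>B\<bar> + 1 \<le> \<bar>x\<bar>" for x
      using that B[of x] B'[of x] by simp
  qed (rule D cont)+
qed

text \<open>The product rule on an interval at whose endpoints the test function vanishes.\<close>

lemma has_ac_deriv_imp_weak_deriv:
  assumes v: "has_ac_deriv v g"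
  shows "is_weak_deriv v g"
  unfolding is_weak_deriv_def
proof (intro allI impI)
  fix \<psi> assume "test_function \<psi>"
  then obtain A where A: "A > 0" "\<And>x. \<bar>x\<bar> \<ge> A \<Longrightarrow> \<psi> x = 0 \<and> deriv \<psi> x = 0"
    "\<And>x. (\<psi> has_real_derivative deriv \<psi> x) (at x)" "continuous_on UNIV (deriv \<psi>)"
    using test_functionD by metis
  let ?\<psi> = "\<lambda>x. complex_of_real (\<psi> x)" and ?\<psi>' = "\<lambda>x. complex_of_real (deriv \<psi> x)"
  have \<psi>: "has_ac_deriv ?\<psi> ?\<psi>'"
    by (rule has_ac_deriv_smooth)
       (auto intro!: continuous_intros A has_vector_derivative_of_real simp: has_real_derivative_iff_has_vector_derivative[symmetric])
  have le: "-A \<le> A" using A by simp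
  have I: "set_integrable lborel {-A..A} (\<lambda>x. v x * ?\<psi>' x)" "set_integrable lborel {-A..A} (\<lambda>x. ?\<psi> x * g x)"
    by (intro set_integrable_continuous_mult has_ac_deriv_continuous[OF v] has_ac_deriv_continuous[OF \<psi>]
        has_ac_derivD(2)[OF v le] has_ac_derivD(2)[OF \<psi> le])+
  have "(LINT x:{-A..A}|lborel. v x * ?\<psi>' x + ?\<psi> x * g x) = 0"
    using has_ac_derivD(3)[OF has_ac_deriv_mult[OF v \<psi>] le] A(1,2) by simp
  moreover have "(LINT x:{-A..A}|lborel. v x * ?\<psi>' x) = (LINT x|lborel. v x * ?\<psi>' x)"
    unfolding set_lebesgue_integral_def
    by (intro Bochner_Integration.integral_cong) (use A(2) in \<open>auto simp: indicator_def\<close>)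
  moreover have "(LINT x:{-A..A}|lborel. ?\<psi> x * g x) = (LINT x|lborel. g x * ?\<psi> x)"
    unfolding set_lebesgue_integral_def
    by (intro Bochner_Integration.integral_cong) (use A(2) in \<open>auto simp: indicator_def\<close>)
  ultimately show "(LINT x|lborel. v x * ?\<psi>' x) = - (LINT x|lborel. g x * ?\<psi> x)"
    using I by (simp add: set_integral_add add_eq_0_iff2)
qed

text \<open>The test functions are smoothed trapezoids: a ramp that starts at \<open>a\<close> minus
  one that starts at \<open>b\<close>, both of width 1 / c n. Their values tend to the indicator of
  the interval, and their derivatives are differences of approximate identities at \<open>a\<close>
  and \<open>b\<close>, so in the limit the weak identity equates \<open>v a - v b\<close> with
  minus the integral of \<open>g\<close>.\<close>

lemma weak_deriv_imp_has_ac_deriv: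
  assumes v: "continuous_on UNIV v" and [measurable]: "g \<in> borel_measurable borel"
    and gI: "\<And>a b. set_integrable lborel {a..b} g" and w: "is_weak_deriv v g"
  shows "has_ac_deriv v g"
  unfolding has_ac_deriv_def
proof (intro conjI allI impI gI)
  fix a b :: real assume "a \<le> b"
  obtain R r :: "real \<Rightarrow> real" where R: "\<And>n. ndiff n R" and r: "\<And>x. (R has_real_derivative r x) (at x)"
    and cont_r: "continuous_on UNIV r" and R0: "\<And>x. x \<le> 0 \<Longrightarrow> R x = 0" and R1: "\<And>x. x \<ge> 1 \<Longrightarrow> R x = 1"
    and R01: "\<And>x. 0 \<le> R x \<and> R x \<le> 1" and r0: "\<And>x. x \<notin> {0..1} \<Longrightarrow> r x = 0"
    using smooth_step_exists by metis
  have [measurable]: "v \<in> borel_measurable borel" "r \<in> borel_measurable borel" "R \<in> borel_measurable borel"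
    by (intro borel_measurable_continuous_onI v cont_r continuous_at_imp_continuous_on ballI DERIV_isCont[OF r])+
  \<comment> \<open>The successor gives \<open>c n \<ge> 1\<close>, so every ramp has width at most
    1 and all supports lie in \<open>{a..b+1}\<close>.\<close>
  define c where "c n = real (Suc n)" for n
  have c: "c n > 0" "c n \<ge> 1" for n by (auto simp: c_def)
  have clim: "(\<lambda>n. y / c n) \<longlonglongrightarrow> 0" for y
    using LIMSEQ_Suc[OF lim_const_over_n[of y]] by (simp add: c_def)
  define \<psi> where "\<psi> n x = R (- (c n * a) + c n * x) + (-1) * R (- (c n * b) + c n * x)" for n x
  define \<psi>' where "\<psi>' n x = c n * r (c n * (x - a)) - c n * r (c n * (x - b))" for n x
  have D: "(\<psi> n has_real_derivative \<psi>' n x) (at x)" for n x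
    unfolding \<psi>_def[abs_def] \<psi>'_def
    by (rule derivative_eq_intros DERIV_chain'[OF _ r] refl | simp add: algebra_simps)+
  have supp: "\<psi> n x = 0" if "x \<notin> {a..b+1}" for n x
  proof -
    have "x < a \<or> x > b + 1" using that by auto
    thus ?thesis
    proof
      assume "x < a"
      hence "c n * x \<le> c n * a" "c n * x \<le> c n * b" using c[of n] \<open>a \<le> b\<close> by auto
      thus ?thesis by (simp add: \<psi>_def R0)
    next
      assume *: "x > b + 1"
      have "1 * 1 \<le> c n * (x - b)" using * c[of n] by (intro mult_mono) auto
      moreover have "c n * (x - b) \<le> c n * (x - a)" using \<open>a \<le> b\<close> c[of n] by simp
      ultimately show ?thesis by (simp add: \<psi>_def R1 algebra_simps)
    qed
  qed
  have test: "test_function (\<psi> n)" for n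
    unfolding test_function_def
  proof (intro conjI allI)
    have "ndiff m (\<psi> n)" for m
      unfolding \<psi>_def[abs_def] by (intro ndiff_add ndiff_cmult ndiff_affine R)
    thus "(deriv ^^ m) (\<psi> n) differentiable (at x)" for m x by (auto simp: ndiff_def)
    have "closure {x. \<psi> n x \<noteq> 0} \<subseteq> {a..b+1}"
      by (rule closure_minimal[OF _ closed_atLeastAtMost]) (use supp in blast)
    thus "compact (closure {x. \<psi> n x \<noteq> 0})"
      by (metis closed_closure compact_Icc compact_Int_closed inf.absorb_iff2 inf_commute)
  qed
  have eqn: "(LINT x|lborel. v x * complex_of_real (\<psi>' n x)) = - (LINT x|lborel. g x * complex_of_real (\<psi> n x))" for n
  proof -
    have "deriv (\<psi> n) = \<psi>' n" by (intro ext DERIV_imp_deriv D)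
    thus ?thesis using w test[of n] unfolding is_weak_deriv_def by metis
  qed
  have rI: "integrable lborel (\<lambda>y. f y * complex_of_real (r y))" if "continuous_on UNIV f" for f
  proof -
    have "set_integrable lborel {0..1} (\<lambda>y. f y * complex_of_real (r y))"
      by (intro borel_integrable_atLeastAtMost' continuous_intros
           continuous_on_subset[OF cont_r] continuous_on_subset[OF that]) auto
    thus ?thesis unfolding set_integrable_def
      by (rule back_subst[of "integrable lborel"]) (use r0 in \<open>auto simp: indicator_def\<close>)
  qed
  have rint: "(LINT y|lborel. complex_of_real (r y)) = 1"
  proof -
    have "(LINT y|lborel. complex_of_real (r y)) = (LINT y:{0..1}|lborel. complex_of_real (r y))"
      unfolding set_lebesgue_integral_def
      by (intro Bochner_Integration.integral_cong) (use r0 in \<open>auto simp: indicator_def\<close>)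
    also have "\<dots> = complex_of_real (R 1) - complex_of_real (R 0)"
      by (rule has_ac_derivD(3)[OF has_ac_deriv_smooth])
         (auto intro!: continuous_intros cont_r has_vector_derivative_of_real
            simp: r has_real_derivative_iff_has_vector_derivative[symmetric])
    finally show ?thesis by (simp add: R0 R1)
  qed
  \<comment> \<open>The substitution x = p + y / c n turns the concentrating kernel into the fixed
    \<open>r\<close>; only the argument of \<open>v\<close> still depends on
    \<open>n\<close>.\<close>
  have shift: "(LINT x|lborel. v x * complex_of_real (c n * r (c n * (x - p)))) = (LINT y|lborel. v (p + 1 / c n * y) * complex_of_real (r y))"
    and shiftI: "integrable lborel (\<lambda>x. v x * complex_of_real (c n * r (c n * (x - p))))" for n p
  proof -
    have nz: "1 / c n \<noteq> 0" using c[of n] by simp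
    have eq: "v (p + 1 / c n * y) * complex_of_real (c n * r (c n * (p + 1 / c n * y - p)))
            = complex_of_real (c n) * (v (p + 1 / c n * y) * complex_of_real (r y))" for y
      using c[of n] by simp
    show "(LINT x|lborel. v x * complex_of_real (c n * r (c n * (x - p)))) = (LINT y|lborel. v (p + 1 / c n * y) * complex_of_real (r y))"
      by (subst lborel_integral_real_affine[OF nz, of _ p], subst eq)
         (use c[of n] in \<open>simp add: scaleR_conv_of_real\<close>)
    have "integrable lborel (\<lambda>y. complex_of_real (c n) * (v (p + 1 / c n * y) * complex_of_real (r y)))"
      by (intro integrable_mult_right rI continuous_on_compose2[OF v]) (auto intro!: continuous_intros)
    thus "integrable lborel (\<lambda>x. v x * complex_of_real (c n * r (c n * (x - p))))"
      by (subst lborel_integrable_real_affine_iff[OF nz, of _ p, symmetric], subst eq)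
  qed
  have lim_v: "(\<lambda>n. LINT y|lborel. v (p + 1 / c n * y) * complex_of_real (r y)) \<longlonglongrightarrow> v p" for p
  proof -
    have "bounded (v ` {p..p+1})"
      by (intro compact_imp_bounded compact_continuous_image continuous_on_subset[OF v]) auto
    then obtain C where C: "\<And>x. x \<in> {p..p+1} \<Longrightarrow> norm (v x) \<le> C"
      unfolding bounded_iff by fast
    have "(\<lambda>n. LINT y|lborel. v (p + 1 / c n * y) * complex_of_real (r y)) \<longlonglongrightarrow> (LINT y|lborel. v p * complex_of_real (r y))"
    proof (rule integral_dominated_convergence)
      show "integrable lborel (\<lambda>y. norm (complex_of_real C * complex_of_real (r y)))"
        by (intro integrable_norm rI continuous_intros)
      show "AE y in lborel. (\<lambda>n. v (p + 1 / c n * y) * complex_of_real (r y)) \<longlonglongrightarrow> v p * complex_of_real (r y)"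
      proof (intro AE_I2 tendsto_intros)
        fix y
        have "(\<lambda>n. p + 1 / c n * y) \<longlonglongrightarrow> p + 0"
          using clim[of y] by (intro tendsto_add tendsto_const) simp
        thus "(\<lambda>n. v (p + 1 / c n * y)) \<longlonglongrightarrow> v p"
          using v by (intro isCont_tendsto_compose[of _ v]) (auto simp: continuous_on_eq_continuous_at)
      qed
      show "AE y in lborel. norm (v (p + 1 / c n * y) * complex_of_real (r y)) \<le> norm (complex_of_real C * complex_of_real (r y))" for n
      proof (intro AE_I2)
        fix y
        show "norm (v (p + 1 / c n * y) * complex_of_real (r y)) \<le> norm (complex_of_real C * complex_of_real (r y))"
        proof (cases "y \<in> {0..1}")
          case True
          hence "0 \<le> y / c n" "y / c n \<le> 1" using c[of n] by (auto simp: divide_le_eq)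
          hence "norm (v (p + 1 / c n * y)) \<le> \<bar>C\<bar>" using C[of "p + 1 / c n * y"] by fastforce
          thus ?thesis by (simp add: norm_mult mult_right_mono)
        qed (simp add: r0)
      qed
    qed measurable
    thus ?thesis using rint by simp
  qed
  have "(\<lambda>n. LINT x|lborel. v x * complex_of_real (\<psi>' n x)) \<longlonglongrightarrow> v a - v b"
  proof -
    have "(LINT x|lborel. v x * complex_of_real (\<psi>' n x)) =
        (LINT y|lborel. v (a + 1 / c n * y) * complex_of_real (r y)) - (LINT y|lborel. v (b + 1 / c n * y) * complex_of_real (r y))" for n
      unfolding shift[symmetric]
      using Bochner_Integration.integral_diff[OF shiftI[of n a] shiftI[of n b]]
      by (simp only: \<psi>'_def of_real_diff right_diff_distrib[of "v _"])
    thus ?thesis by (simp only:) (intro tendsto_diff lim_v)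
  qed
  \<comment> \<open>The limit set is half-open because each ramp vanishes at its own starting point.
    It differs from the closed interval by one point.\<close>
  moreover have "(\<lambda>n. LINT x|lborel. g x * complex_of_real (\<psi> n x)) \<longlonglongrightarrow> (LINT x|lborel. indicator {a<..b} x *\<^sub>R g x)"
  proof (rule integral_dominated_convergence)
    show "integrable lborel (\<lambda>x. norm (indicator {a..b+1} x *\<^sub>R g x))"
      using gI[of a "b+1"] by (intro integrable_norm) (simp add: set_integrable_def)
    have R_lim: "(\<lambda>n. R (- (c n * p) + c n * x)) \<longlonglongrightarrow> (if x > p then 1 else 0)" for p x
    proof (cases "x > p")
      case True
      obtain N :: nat where N: "1 / (x - p) \<le> real N" using real_arch_simple by blast
      have "R (- (c n * p) + c n * x) = 1" if "n \<ge> N" for n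
      proof (rule R1)
        have "1 / (x - p) \<le> c n" using N that by (simp add: c_def)
        thus "1 \<le> - (c n * p) + c n * x" using True by (simp add: divide_le_eq algebra_simps)
      qed
      thus ?thesis using True by (intro tendsto_eventually) (auto simp: eventually_sequentially)
    next
      case False
      hence "c n * x \<le> c n * p" for n using c[of n] by simp
      thus ?thesis using False by (simp add: R0)
    qed
    show "AE x in lborel. (\<lambda>n. g x * complex_of_real (\<psi> n x)) \<longlonglongrightarrow> indicator {a<..b} x *\<^sub>R g x"
    proof (rule AE_I2)
      fix x
      have "(\<lambda>n. g x * complex_of_real (\<psi> n x)) \<longlonglongrightarrow> g x * complex_of_real ((if x > a then 1 else 0) + (-1) * (if x > b then 1 else 0))"
        unfolding \<psi>_def by (intro tendsto_intros R_lim)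
      also have "g x * complex_of_real ((if x > a then 1 else 0) + (-1) * (if x > b then 1 else 0)) = indicator {a<..b} x *\<^sub>R g x"
        using \<open>a \<le> b\<close> by (auto simp: indicator_def)
      finally show "(\<lambda>n. g x * complex_of_real (\<psi> n x)) \<longlonglongrightarrow> indicator {a<..b} x *\<^sub>R g x" .
    qed
    show "AE x in lborel. norm (g x * complex_of_real (\<psi> n x)) \<le> norm (indicator {a..b+1} x *\<^sub>R g x)" for n
    proof (rule AE_I2)
      fix x
      have "\<bar>\<psi> n x\<bar> \<le> 1" using R01[of "- (c n * a) + c n * x"] R01[of "- (c n * b) + c n * x"]
        by (simp add: \<psi>_def abs_le_iff)
      thus "norm (g x * complex_of_real (\<psi> n x)) \<le> norm (indicator {a..b+1} x *\<^sub>R g x)"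
        using supp[of x n] by (cases "x \<in> {a..b+1}") (auto simp: norm_mult mult_left_le)
    qed
  qed (unfold \<psi>_def, measurable)
  hence "(\<lambda>n. LINT x|lborel. v x * complex_of_real (\<psi>' n x)) \<longlonglongrightarrow> - (LINT x|lborel. indicator {a<..b} x *\<^sub>R g x)"
    unfolding eqn by (rule tendsto_minus)
  ultimately have "v a - v b = - (LINT x|lborel. indicator {a<..b} x *\<^sub>R g x)"
    by (rule LIMSEQ_unique)
  moreover have "(LINT x|lborel. indicator {a<..b} x *\<^sub>R g x) = (LINT x|lborel. indicator {a..b} x *\<^sub>R g x)"
    by (rule integral_cong_AE) (use AE_lborel_singleton[of a] in \<open>auto elim!: eventually_mono simp: indicator_def\<close>)
  ultimately show "(LINT x:{a..b}|lborel. g x) = v b - v a"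
    by (simp add: set_lebesgue_integral_def algebra_simps minus_equation_iff)
qed fact

section \<open>Square integrable functions and the Sobolev space\<close>

text \<open>The squared L2 norm. For limits, the estimate \<open>sqn_add_le\<close> with its factors
  2 replaces the triangle inequality.\<close>

definition sqn :: "(real \<Rightarrow> complex) \<Rightarrow> real" where
  "sqn g = (LINT x|lborel. (cmod (g x))\<^sup>2)"

lemma sqn_nonneg [simp]: "sqn g \<ge> 0"
  by (simp add: sqn_def)

lemma L2_D:
  assumes "g \<in> L2"
  shows "g \<in> borel_measurable borel" "integrable lborel (\<lambda>x. (cmod (g x))\<^sup>2)"
  using assms by (auto simp: L2_def)

lemma L2_set_integrable:
  assumes "g \<in> L2" shows "set_integrable lborel {a..b} g"
proof -
  note [measurable] = L2_D(1)[OF assms]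
  show ?thesis unfolding set_integrable_def
  proof (rule Bochner_Integration.integrable_bound)
    show "integrable lborel (\<lambda>x. indicat_real {a..b} x + (cmod (g x))\<^sup>2)"
      by (intro Bochner_Integration.integrable_add L2_D[OF assms]) (auto simp: integrable_indicator_iff emeasure_lborel_Icc_eq)
    \<comment> \<open>An elementary bound that serves in place of the Cauchy-Schwarz inequality on a
      bounded interval.\<close>
    have "t \<le> 1 + t\<^sup>2" for t :: real using zero_le_power2[of "t - 1"] zero_le_power2[of t]
      by (simp add: power2_eq_square algebra_simps) (smt (verit) zero_le_square mult_nonneg_nonneg)
    thus "AE x in lborel. cmod (indicat_real {a..b} x *\<^sub>R g x) \<le> norm (indicat_real {a..b} x + (cmod (g x))\<^sup>2)"
      by (intro AE_I2) (auto simp: indicator_def)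
  qed measurable
qed

lemma L2_bound:
  assumes "f \<in> L2" "g \<in> borel_measurable borel" "\<And>x. cmod (g x) \<le> C * cmod (f x)"
  shows "g \<in> L2"
  unfolding L2_def
proof (intro CollectI conjI)
  note [measurable] = assms(2)
  show "integrable lborel (\<lambda>x. (cmod (g x))\<^sup>2)"
  proof (rule Bochner_Integration.integrable_bound)
    show "integrable lborel (\<lambda>x. C\<^sup>2 * (cmod (f x))\<^sup>2)" using L2_D[OF assms(1)] by simp
    show "AE x in lborel. norm ((cmod (g x))\<^sup>2) \<le> norm (C\<^sup>2 * (cmod (f x))\<^sup>2)"
      using power_mono[OF assms(3), of _ 2] by (simp add: power_mult_distrib)
  qed measurable
qed (use assms in simp)

lemma cmod_add_square_le: "(cmod (a + b))\<^sup>2 \<le> 2 * (cmod a)\<^sup>2 + 2 * (cmod b)\<^sup>2"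
proof -
  have "(cmod (a + b))\<^sup>2 \<le> (cmod a + cmod b)\<^sup>2" by (intro power_mono norm_triangle_ineq) simp
  also have "\<dots> \<le> 2 * (cmod a)\<^sup>2 + 2 * (cmod b)\<^sup>2"
    using zero_le_power2[of "cmod a - cmod b"] by (simp add: power2_eq_square algebra_simps)
  finally show ?thesis .
qed

lemma L2_cmult: "f \<in> L2 \<Longrightarrow> (\<lambda>x. c * f x) \<in> L2"
  by (rule L2_bound[of f _ "cmod c"]) (auto simp: norm_mult L2_def)

lemma L2_add:
  assumes "f \<in> L2" "g \<in> L2" shows "(\<lambda>x. f x + g x) \<in> L2"
  unfolding L2_def
proof (intro CollectI conjI)
  note [measurable] = L2_D(1)[OF assms(1)] L2_D(1)[OF assms(2)]
  show "integrable lborel (\<lambda>x. (cmod (f x + g x))\<^sup>2)"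
  proof (rule Bochner_Integration.integrable_bound)
    show "integrable lborel (\<lambda>x. 2 * (cmod (f x))\<^sup>2 + 2 * (cmod (g x))\<^sup>2)"
      using L2_D[OF assms(1)] L2_D[OF assms(2)] by simp
    show "AE x in lborel. norm ((cmod (f x + g x))\<^sup>2) \<le> norm (2 * (cmod (f x))\<^sup>2 + 2 * (cmod (g x))\<^sup>2)"
      by (intro AE_I2) (simp add: cmod_add_square_le)
  qed measurable
  show "(\<lambda>x. f x + g x) \<in> borel_measurable lborel" by measurable
qed

lemma L2_diff: "f \<in> L2 \<Longrightarrow> g \<in> L2 \<Longrightarrow> (\<lambda>x. f x - g x) \<in> L2"
  using L2_add[of f "\<lambda>x. (-1) * g x"] L2_cmult[of g "-1"] by simp

lemma sqn_add_le:
  assumes "f \<in> L2" "g \<in> L2"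
  shows "sqn (\<lambda>x. f x + g x) \<le> 2 * sqn f + 2 * sqn g"
proof -
  note I = L2_D(2)[OF assms(1)] L2_D(2)[OF assms(2)] L2_D(2)[OF L2_add[OF assms]]
  have "sqn (\<lambda>x. f x + g x) \<le> (LINT x|lborel. 2 * (cmod (f x))\<^sup>2 + 2 * (cmod (g x))\<^sup>2)"
    unfolding sqn_def using I by (intro integral_mono) (auto simp: cmod_add_square_le)
  thus ?thesis using I by (simp add: sqn_def)
qed

lemma sqn_cmult: "sqn (\<lambda>x. c * f x) = (cmod c)\<^sup>2 * sqn f"
  by (simp add: sqn_def norm_mult power_mult_distrib)

lemma L2_affine:
  assumes "f \<in> L2" "c \<noteq> 0"
  shows "(\<lambda>x. f (t + c * x)) \<in> L2" "sqn (\<lambda>x. f (t + c * x)) = sqn f / \<bar>c\<bar>"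
proof -
  note [measurable] = L2_D(1)[OF assms(1)]
  have "(\<lambda>x. f (t + c * x)) \<in> borel_measurable lborel" by measurable
  thus "(\<lambda>x. f (t + c * x)) \<in> L2"
    using lborel_integrable_real_affine[OF L2_D(2)[OF assms(1)] assms(2), of t] by (simp add: L2_def)
  show "sqn (\<lambda>x. f (t + c * x)) = sqn f / \<bar>c\<bar>"
    unfolding sqn_def using assms(2)
    by (subst (2) lborel_integral_real_affine[OF assms(2), of _ t]) simp
qed

lemma sqn_cong_AE:
  assumes "f \<in> borel_measurable borel" "g \<in> borel_measurable borel" "AE x in lborel. f x = g x"
  shows "sqn f = sqn g"
  unfolding sqn_def by (rule integral_cong_AE) (use assms in \<open>auto elim!: eventually_mono\<close>)

lemma L2_cong_AE:
  assumes "f \<in> L2" "g \<in> borel_measurable borel" "AE x in lborel. f x = g x"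
  shows "g \<in> L2"
proof -
  note [measurable] = assms(2) L2_D(1)[OF assms(1)]
  have "integrable lborel (\<lambda>x. (cmod (f x))\<^sup>2) \<longleftrightarrow> integrable lborel (\<lambda>x. (cmod (g x))\<^sup>2)"
    by (rule integrable_cong_AE) (use assms(3) in \<open>auto elim!: eventually_mono\<close>)
  thus ?thesis using assms by (simp add: L2_def)
qed

text \<open>Together with the next lemma this removes test functions from the rest of the
  proof.\<close>

lemma H1_iff: "v \<in> H1 \<longleftrightarrow> v \<in> L2 \<and> (\<exists>g\<in>L2. has_ac_deriv v g)"
  unfolding H1_def
  using has_ac_deriv_imp_weak_deriv has_ac_deriv_continuous weak_deriv_imp_has_ac_deriv
    L2_set_integrable L2_D(1) by blast

lemma weak_deriv_H1:
  assumes "v \<in> H1"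
  shows "weak_deriv v \<in> L2" "has_ac_deriv v (weak_deriv v)"
proof -
  have "\<exists>g. g \<in> L2 \<and> is_weak_deriv v g" using assms by (auto simp: H1_def)
  hence *: "weak_deriv v \<in> L2 \<and> is_weak_deriv v (weak_deriv v)"
    unfolding weak_deriv_def by (rule someI_ex)
  thus "weak_deriv v \<in> L2" by simp
  show "has_ac_deriv v (weak_deriv v)"
    by (rule weak_deriv_imp_has_ac_deriv)
       (use assms * L2_set_integrable L2_D(1) in \<open>auto simp: H1_def\<close>)
qed

lemma weak_deriv_AE:
  assumes "v \<in> H1" "has_ac_deriv v g"
  shows "AE x in lborel. weak_deriv v x = g x"
  using has_ac_deriv_unique weak_deriv_H1(2)[OF assms(1)] assms(2) by blast

text \<open>Two absolutely continuous derivatives of \<open>v\<close> agree almost everywhere, so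
  the arbitrary choice behind \<open>weak_deriv\<close> does not influence the norm.\<close>

lemma H1_norm_eq:
  assumes "v \<in> H1" "has_ac_deriv v g"
  shows "H1_norm v = sqrt (sqn v + sqn g)"
proof -
  have "sqn (weak_deriv v) = sqn g"
    by (rule sqn_cong_AE[OF _ _ weak_deriv_AE[OF assms]])
       (use assms weak_deriv_H1 has_ac_derivD(1) in auto)
  thus ?thesis by (simp add: H1_norm_def sqn_def)
qed

subsection \<open>Strong continuity of dilations\<close>

definition dil :: "real \<Rightarrow> (real \<Rightarrow> complex) \<Rightarrow> real \<Rightarrow> complex" where
  "dil t h y = complex_of_real (exp t) * h (exp (2 * t) * y)"

lemma dil_L2:
  assumes "h \<in> L2"
  shows "dil t h \<in> L2" "sqn (dil t h) = sqn h"
proof -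
  have eq: "dil t h = (\<lambda>y. complex_of_real (exp t) * h (0 + exp (2 * t) * y))"
    by (simp add: dil_def fun_eq_iff)
  show "dil t h \<in> L2" unfolding eq by (intro L2_cmult L2_affine assms) simp
  have "sqn (dil t h) = (exp t)\<^sup>2 * (sqn h / exp (2 * t))"
    unfolding eq using L2_affine(2)[OF assms, of "exp (2 * t)" 0] by (simp add: sqn_cmult)
  thus "sqn (dil t h) = sqn h" by (simp add: exp_double)
qed

text \<open>Phrased as a property of \<open>h\<close> so that its extent can be enlarged step by
  step: it defines a linear subspace, closed in L2, that contains the indicators of open sets of
  finite measure, hence all of L2.\<close>

definition dil_cont :: "(real \<Rightarrow> complex) \<Rightarrow> bool" where
  "dil_cont h \<longleftrightarrow> h \<in> L2 \<and> ((\<lambda>t. sqn (\<lambda>y. dil t h y - h y)) \<longlongrightarrow> 0) (at 0)"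

lemma dil_cont_add:
  assumes "dil_cont f" "dil_cont g"
  shows "dil_cont (\<lambda>y. f y + g y)"
proof -
  have L: "f \<in> L2" "g \<in> L2" using assms by (auto simp: dil_cont_def)
  have "((\<lambda>t. sqn (\<lambda>y. dil t (\<lambda>y. f y + g y) y - (f y + g y))) \<longlongrightarrow> 0) (at 0)"
  proof (rule tendsto_sandwich[OF _ _ tendsto_const])
    show "((\<lambda>t. 2 * sqn (\<lambda>y. dil t f y - f y) + 2 * sqn (\<lambda>y. dil t g y - g y)) \<longlongrightarrow> 0) (at 0)"
      using assms by (auto simp: dil_cont_def intro!: tendsto_eq_intros)
    have "sqn (\<lambda>y. dil t (\<lambda>y. f y + g y) y - (f y + g y)) \<le> 2 * sqn (\<lambda>y. dil t f y - f y) + 2 * sqn (\<lambda>y. dil t g y - g y)" for t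
      using sqn_add_le[of "\<lambda>y. dil t f y - f y" "\<lambda>y. dil t g y - g y"] L
      by (simp add: L2_diff dil_L2) (simp add: dil_def algebra_simps)
    thus "\<forall>\<^sub>F t in at 0. sqn (\<lambda>y. dil t (\<lambda>y. f y + g y) y - (f y + g y)) \<le> 2 * sqn (\<lambda>y. dil t f y - f y) + 2 * sqn (\<lambda>y. dil t g y - g y)"
      by simp
  qed auto
  thus ?thesis using L2_add[OF L] by (simp add: dil_cont_def)
qed

lemma dil_cont_cmult:
  assumes "dil_cont f"
  shows "dil_cont (\<lambda>y. c * f y)"
proof -
  have "(\<lambda>y. dil t (\<lambda>y. c * f y) y - c * f y) = (\<lambda>y. c * (dil t f y - f y))" for t
    by (simp add: dil_def fun_eq_iff algebra_simps)
  thus ?thesis using assms by (auto simp: dil_cont_def sqn_cmult L2_cmult intro!: tendsto_eq_intros)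
qed

text \<open>Closedness in L2. Dilations are isometries, so the errors \<open>dil t (h - k)\<close>
  and \<open>h - k\<close> have the same size for every \<open>t\<close>.\<close>

lemma dil_cont_approx:
  assumes h: "h \<in> L2" and ap: "\<And>e. e > 0 \<Longrightarrow> \<exists>k. dil_cont k \<and> sqn (\<lambda>y. h y - k y) \<le> e"
  shows "dil_cont h"
proof -
  have "((\<lambda>t. sqn (\<lambda>y. dil t h y - h y)) \<longlongrightarrow> 0) (at 0)"
  proof (rule tendstoI)
    fix e :: real assume e: "e > 0"
    \<comment> \<open>The split into three terms below costs 2 and 4 times this error, together e/2;
      the other half is 4 times the e/8 of the middle term.\<close>
    obtain k where k: "dil_cont k" "sqn (\<lambda>y. h y - k y) \<le> e / 12" using ap[of "e / 12"] e by auto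
    have kL: "k \<in> L2" using k by (simp add: dil_cont_def)
    have le: "sqn (\<lambda>y. dil t h y - h y) \<le> e / 2 + 4 * sqn (\<lambda>y. dil t k y - k y)" for t
    proof -
      let ?a = "dil t (\<lambda>y. h y - k y)" and ?b = "\<lambda>y. dil t k y - k y" and ?c = "\<lambda>y. (-1) * (h y - k y)"
      have L: "?a \<in> L2" "?b \<in> L2" "?c \<in> L2"
        by (intro dil_L2 L2_diff L2_cmult h kL)+
      have "(\<lambda>y. dil t h y - h y) = (\<lambda>y. ?a y + (?b y + ?c y))"
        by (simp add: dil_def fun_eq_iff algebra_simps)
      hence "sqn (\<lambda>y. dil t h y - h y) \<le> 2 * sqn ?a + 2 * (2 * sqn ?b + 2 * sqn ?c)"
        using sqn_add_le[OF L(1) L2_add[OF L(2,3)]] sqn_add_le[OF L(2,3)] by simp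
      also have "sqn ?a = sqn (\<lambda>y. h y - k y)" by (rule dil_L2[OF L2_diff[OF h kL]])
      also have "sqn ?c = sqn (\<lambda>y. h y - k y)" unfolding sqn_cmult by simp
      finally show ?thesis using k(2) by simp
    qed
    have "\<forall>\<^sub>F t in at 0. dist (sqn (\<lambda>y. dil t k y - k y)) 0 < e / 8"
      using k(1) e unfolding dil_cont_def by (intro tendstoD) auto
    thus "\<forall>\<^sub>F t in at 0. dist (sqn (\<lambda>y. dil t h y - h y)) 0 < e"
    proof eventually_elim
      case (elim t)
      thus ?case using le[of t] by (simp add: dist_real_def)
    qed
  qed
  thus ?thesis using h by (simp add: dil_cont_def)
qed

lemma indicator_L2:
  assumes "A \<in> sets borel" "emeasure lborel A < \<infinity>"
  shows "(\<lambda>y. complex_of_real (indicator A y)) \<in> L2" "sqn (\<lambda>y. complex_of_real (indicator A y)) = measure lborel A"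
proof -
  have eq: "(cmod (complex_of_real (indicator A y)))\<^sup>2 = indicator A y" for y
    by (simp add: indicator_def)
  show "(\<lambda>y. complex_of_real (indicator A y)) \<in> L2"
  proof -
    have "integrable lborel (\<lambda>y. (cmod (complex_of_real (indicator A y)))\<^sup>2)"
      unfolding eq using assms by (simp add: integrable_indicator_iff)
    moreover have "(\<lambda>y. complex_of_real (indicator A y)) \<in> borel_measurable lborel"
      using assms(1) by measurable
    ultimately show ?thesis unfolding L2_def by blast
  qed
  show "sqn (\<lambda>y. complex_of_real (indicator A y)) = measure lborel A"
    using assms unfolding sqn_def eq by simp
qed

text \<open>Expanding the square leaves the overlap \<open>J t\<close> of \<open>U\<close> with its
  dilate. A point of the open set \<open>U\<close> stays in \<open>U\<close> under dilations close
  to the identity, so \<open>J t\<close> tends to the measure of \<open>U\<close> by dominated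
  convergence; points outside \<open>U\<close> do not contribute.\<close>

lemma dil_cont_indicator_open:
  assumes U: "open U" "emeasure lborel U < \<infinity>"
  shows "dil_cont (\<lambda>y. complex_of_real (indicator U y))"
  unfolding dil_cont_def
proof
  have [measurable]: "U \<in> sets borel" using U by simp
  let ?h = "\<lambda>y. complex_of_real (indicator U y)"
  show hL: "?h \<in> L2" by (rule indicator_L2) (use U in auto)
  define m where "m = measure lborel U"
  define J where "J t = (LINT y|lborel. indicator U (exp (2 * t) * y) * indicat_real U y)" for t
  have UI: "integrable lborel (indicat_real U)" using U by (simp add: integrable_indicator_iff)
  have UI2: "integrable lborel (\<lambda>y. indicator U (exp (2 * t) * y) * indicat_real U y)" for t
    by (rule Bochner_Integration.integrable_bound[OF UI]) (auto simp: indicator_def)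
  have sq: "sqn (\<lambda>y. dil t ?h y - ?h y) = 2 * m - 2 * exp t * J t" for t
  proof -
    have I3: "integrable lborel (\<lambda>y. indicat_real U (0 + exp (2 * t) * y))"
      by (rule lborel_integrable_real_affine[OF UI]) simp
    have m3: "(LINT y|lborel. indicat_real U (0 + exp (2 * t) * y)) = m / exp (2 * t)"
      using lborel_integral_real_affine[of "exp (2 * t)" "indicat_real U" 0] by (simp add: m_def)
    have "(cmod (dil t ?h y - ?h y))\<^sup>2 = exp (2 * t) * indicator U (0 + exp (2 * t) * y) + indicator U y
       - 2 * exp t * (indicator U (exp (2 * t) * y) * indicat_real U y)" for y
    proof -
      have "dil t ?h y - ?h y = complex_of_real (exp t * indicator U (exp (2 * t) * y) - indicator U y)"
        by (simp add: dil_def)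
      hence "(cmod (dil t ?h y - ?h y))\<^sup>2 = (exp t * indicator U (exp (2 * t) * y) - indicator U y)\<^sup>2"
        by (metis norm_of_real power2_abs)
      thus ?thesis
        by (auto simp: indicator_def power2_eq_square algebra_simps exp_double mult_exp_exp)
    qed
    hence "sqn (\<lambda>y. dil t ?h y - ?h y) = exp (2 * t) * (m / exp (2 * t)) + m - 2 * exp t * J t"
      unfolding sqn_def J_def using I3 UI UI2[of t] m3 by (simp add: m_def)
    thus ?thesis by simp
  qed
  have "(J \<longlongrightarrow> m) (at 0)"
    unfolding tendsto_at_iff_sequentially
  proof (intro allI impI)
    fix X :: "nat \<Rightarrow> real" assume X: "X \<longlonglongrightarrow> 0"
    have "(\<lambda>n. LINT y|lborel. indicator U (exp (2 * X n) * y) * indicat_real U y) \<longlonglongrightarrow> (LINT y|lborel. indicat_real U y)"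
    proof (rule integral_dominated_convergence[OF _ _ UI])
      show "AE y in lborel. (\<lambda>n. indicator U (exp (2 * X n) * y) * indicat_real U y) \<longlonglongrightarrow> indicat_real U y"
      proof (rule AE_I2)
        fix y
        show "(\<lambda>n. indicator U (exp (2 * X n) * y) * indicat_real U y) \<longlonglongrightarrow> indicat_real U y"
        proof (cases "y \<in> U")
          case True
          have "(\<lambda>n. exp (2 * X n) * y) \<longlonglongrightarrow> exp (2 * 0) * y" by (intro tendsto_intros X)
          hence "\<forall>\<^sub>F n in sequentially. exp (2 * X n) * y \<in> U"
            using U(1) True by (intro topological_tendstoD) auto
          hence "\<forall>\<^sub>F n in sequentially. indicator U (exp (2 * X n) * y) * indicat_real U y = indicat_real U y"
            by eventually_elim simp
          thus ?thesis by (rule tendsto_eventually)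
        qed simp
      qed
      show "AE y in lborel. norm (indicator U (exp (2 * X n) * y) * indicat_real U y) \<le> indicat_real U y" for n
        by (intro AE_I2) (auto simp: indicator_def)
    qed measurable
    thus "(J \<circ> X) \<longlonglongrightarrow> m" by (simp add: J_def o_def m_def)
  qed
  hence "((\<lambda>t. 2 * m - 2 * exp t * J t) \<longlongrightarrow> 2 * m - 2 * exp 0 * m) (at 0)"
    by (intro tendsto_intros)
  thus "((\<lambda>t. sqn (\<lambda>y. dil t ?h y - ?h y)) \<longlongrightarrow> 0) (at 0)" unfolding sq by simp
qed

text \<open>Outer regularity approximates \<open>A\<close> in L2 by an open set that contains
  it.\<close>

lemma dil_cont_indicator:
  assumes A: "A \<in> sets borel" "emeasure lborel A < \<infinity>"
  shows "dil_cont (\<lambda>y. complex_of_real (indicator A y))"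
proof (rule dil_cont_approx)
  show "(\<lambda>y. complex_of_real (indicator A y)) \<in> L2" by (rule indicator_L2[OF A])
  fix e :: real assume e: "e > 0"
  obtain U where U: "open U" "A \<subseteq> U" "emeasure lborel (U - A) < e"
    using outer_regular_lborel[OF A(1) e] by metis
  have fin: "emeasure lborel (U - A) < \<infinity>" using U(3) by (rule order.strict_trans) simp
  have "emeasure lborel U = emeasure lborel A + emeasure lborel (U - A)"
    using U A by (subst plus_emeasure) (auto simp: Un_absorb1)
  hence "emeasure lborel U < \<infinity>" using A(2) fin by simp
  moreover have "sqn (\<lambda>y. complex_of_real (indicator A y) - complex_of_real (indicator U y)) \<le> e"
  proof -
    have "(\<lambda>y. complex_of_real (indicator A y) - complex_of_real (indicator U y)) = (\<lambda>y. (-1) * complex_of_real (indicator (U - A) y))"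
      using U(2) by (auto simp: indicator_def fun_eq_iff)
    hence "sqn (\<lambda>y. complex_of_real (indicator A y) - complex_of_real (indicator U y)) = measure lborel (U - A)"
      unfolding sqn_cmult using indicator_L2(2)[of "U - A"] U(1) A(1) fin by (simp only: sqn_cmult) simp
    also have "\<dots> \<le> e" using U(3) e by (simp add: measure_def enn2real_leI less_imp_le)
    finally show ?thesis .
  qed
  ultimately show "\<exists>k. dil_cont k \<and> sqn (\<lambda>y. complex_of_real (indicator A y) - k y) \<le> e"
    using dil_cont_indicator_open[OF U(1)] by blast
qed

text \<open>Simple functions are dense, and those in L2 are combinations of indicators of sets of
  finite measure.\<close>

lemma dil_cont_L2:
  assumes h: "h \<in> L2"
  shows "dil_cont h"
proof (rule dil_cont_approx[OF h])
  note [measurable] = L2_D(1)[OF h]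
  obtain F where F: "\<And>i. simple_function lborel (F i)" "\<And>x. (\<lambda>i. F i x) \<longlonglongrightarrow> h x"
    "\<And>i x. dist (F i x) 0 \<le> 2 * dist (h x) 0"
    using borel_measurable_implies_sequence_metric[of h lborel 0] by auto
  have Fm[measurable]: "F i \<in> borel_measurable borel" for i
    using borel_measurable_simple_function[OF F(1)[of i]] by simp
  have FL: "F i \<in> L2" for i
    by (rule L2_bound[OF h, of _ 2]) (use F(3) Fm in auto)
  have cont: "dil_cont (F i)" for i
  proof -
    have "simple_function lborel (\<lambda>x. ennreal ((cmod (F i x))\<^sup>2))"
      by (rule simple_function_compose1[OF F(1)])
    \<comment> \<open>A simple function whose square is integrable has support of finite measure, as
      the induction rule demands.\<close>
    hence "emeasure lborel {x \<in> space lborel. ennreal ((cmod (F i x))\<^sup>2) \<noteq> 0} \<noteq> \<infinity>"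
      using L2_D(2)[OF FL[of i]] by (intro simple_function_finite_support) (auto simp: integrable_iff_bounded)
    hence fin: "emeasure lborel {x \<in> space lborel. F i x \<noteq> 0} \<noteq> \<infinity>"
      by (simp add: ennreal_eq_0_iff)
    show ?thesis
      using F(1)[of i] fin
    proof (induction rule: integrable_simple_function_induct)
      case (cong f g)
      hence "f = g" by auto
      thus ?case using cong by simp
    next
      case (indicator A y)
      thus ?case using dil_cont_cmult[OF dil_cont_indicator[of A], of y] by (simp add: scaleR_conv_of_real mult.commute)
    next
      case (add f g)
      thus ?case by (intro dil_cont_add)
    qed
  qed
  have "(\<lambda>i. sqn (\<lambda>y. h y - F i y)) \<longlonglongrightarrow> (LINT y::real|lborel. 0)"
    unfolding sqn_def
  proof (rule integral_dominated_convergence)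
    \<comment> \<open>\<open>F i\<close> is bounded by twice \<open>h\<close>, so the error is at
      most 3 times \<open>h\<close>, and its square at most 9 times.\<close>
    show "integrable lborel (\<lambda>y. 9 * (cmod (h y))\<^sup>2)" using L2_D(2)[OF h] by simp
    show "AE y in lborel. (\<lambda>i. (cmod (h y - F i y))\<^sup>2) \<longlonglongrightarrow> 0"
    proof (rule AE_I2)
      fix y
      have "(\<lambda>i. (cmod (h y - F i y))\<^sup>2) \<longlonglongrightarrow> (cmod (h y - h y))\<^sup>2"
        by (intro tendsto_intros F(2))
      thus "(\<lambda>i. (cmod (h y - F i y))\<^sup>2) \<longlonglongrightarrow> 0" by simp
    qed
    show "AE y in lborel. norm ((cmod (h y - F i y))\<^sup>2) \<le> 9 * (cmod (h y))\<^sup>2" for i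
    proof (intro AE_I2)
      fix y
      have "cmod (h y - F i y) \<le> 3 * cmod (h y)"
        using norm_triangle_ineq4[of "h y" "F i y"] F(3)[of i y] by simp
      hence "(cmod (h y - F i y))\<^sup>2 \<le> (3 * cmod (h y))\<^sup>2" by (intro power_mono) auto
      thus "norm ((cmod (h y - F i y))\<^sup>2) \<le> 9 * (cmod (h y))\<^sup>2" by (simp add: power_mult_distrib)
    qed
  qed measurable
  hence "(\<lambda>i. sqn (\<lambda>y. h y - F i y)) \<longlonglongrightarrow> 0" by simp
  fix e :: real assume "e > 0"
  with \<open>(\<lambda>i. sqn (\<lambda>y. h y - F i y)) \<longlonglongrightarrow> 0\<close> have "\<forall>\<^sub>F i in sequentially. dist (sqn (\<lambda>y. h y - F i y)) 0 < e"
    by (rule tendstoD)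
  then obtain i where "sqn (\<lambda>y. h y - F i y) < e"
    by (auto simp: eventually_sequentially dist_real_def)
  thus "\<exists>k. dil_cont k \<and> sqn (\<lambda>y. h y - k y) \<le> e" using cont[of i] by (intro exI[of _ "F i"]) simp
qed

lemma dil_tendsto:
  assumes "h \<in> L2"
  shows "((\<lambda>t. sqn (\<lambda>y. dil t h y - h y)) \<longlongrightarrow> 0) (at 0)"
  using dil_cont_L2[OF assms] by (simp add: dil_cont_def)

section \<open>Difference quotients of dilations\<close>

lemma nn_integral_sqn:
  assumes "f \<in> L2"
  shows "(\<integral>\<^sup>+y. ennreal ((cmod (f y))\<^sup>2) \<partial>lborel) = ennreal (sqn f)"
  unfolding sqn_def by (rule nn_integral_eq_integral) (use L2_D(2)[OF assms] in auto)

text \<open>Minkowski's inequality for an average: by Cauchy-Schwarz in \<open>\<sigma>\<close> the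
  square of the average is at most the average of the squares, and Tonelli exchanges the two
  integrals. Nonnegative integrals make joint integrability of the squares a non-issue.\<close>

lemma dil_difference_quotient_le:
  assumes h: "h \<in> L2" and k: "k \<in> L2"
    and I: "AE y in lborel. set_integrable lborel {0..1} (\<lambda>\<sigma>. dil (t * \<sigma>) k y - k y) \<and>
         (dil t h y - h y) / complex_of_real t - k y = (LINT \<sigma>:{0..1}|lborel. dil (t * \<sigma>) k y - k y)"
    and e: "\<And>\<tau>. \<bar>\<tau>\<bar> \<le> \<bar>t\<bar> \<Longrightarrow> sqn (\<lambda>y. dil \<tau> k y - k y) \<le> e"
  shows "sqn (\<lambda>y. (dil t h y - h y) / complex_of_real t - k y) \<le> e"
proof -
  note [measurable] = L2_D(1)[OF h] L2_D(1)[OF k]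
  have dm[measurable]: "(\<lambda>(y, \<sigma>). dil (t * \<sigma>) k y) \<in> borel_measurable (borel \<Otimes>\<^sub>M borel)"
    unfolding dil_def by measurable
  let ?q = "\<lambda>y. (dil t h y - h y) / complex_of_real t - k y"
  have qL: "?q \<in> L2"
    using L2_diff[OF L2_cmult[OF L2_diff[OF dil_L2(1)[OF h, of t] h], of "inverse (complex_of_real t)"] k]
    by (simp add: divide_inverse mult.commute)
  \<comment> \<open>The bound \<open>e\<close> is nonnegative because \<open>\<tau> = 0\<close> is
    admissible.\<close>
  have "sqn (\<lambda>y. dil 0 k y - k y) \<le> e" by (rule e) simp
  hence e0: "e \<ge> 0" using sqn_nonneg order_trans by blast
  let ?d = "\<lambda>y \<sigma>. dil (t * \<sigma>) k y - k y"
  have "ennreal (sqn ?q) = (\<integral>\<^sup>+y. ennreal ((cmod (?q y))\<^sup>2) \<partial>lborel)"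
    by (simp add: nn_integral_sqn[OF qL])
  also have "\<dots> \<le> (\<integral>\<^sup>+y. (\<integral>\<^sup>+\<sigma>. ennreal ((cmod (?d y \<sigma>))\<^sup>2) * indicator {0..1} \<sigma> \<partial>lborel) \<partial>lborel)"
  proof (rule nn_integral_mono_AE)
    show "AE y in lborel. ennreal ((cmod (?q y))\<^sup>2) \<le> (\<integral>\<^sup>+\<sigma>. ennreal ((cmod (?d y \<sigma>))\<^sup>2) * indicator {0..1} \<sigma> \<partial>lborel)"
      using I
    proof eventually_elim
      case (elim y)
      have "ennreal (cmod (?q y)) \<le> (\<integral>\<^sup>+\<sigma>. ennreal (cmod (indicat_real {0..1} \<sigma> *\<^sub>R ?d y \<sigma>)) \<partial>lborel)"
        using integral_norm_bound_ennreal[of lborel "\<lambda>\<sigma>. indicat_real {0..1} \<sigma> *\<^sub>R ?d y \<sigma>"] elim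
        by (simp add: set_integrable_def set_lebesgue_integral_def)
      also have "\<dots> = (\<integral>\<^sup>+\<sigma>. (ennreal (cmod (?d y \<sigma>)) * indicator {0..1} \<sigma>) * indicator {0..1} \<sigma> \<partial>lborel)"
        by (intro nn_integral_cong) (auto simp: indicator_def)
      finally have "(ennreal (cmod (?q y)))\<^sup>2 \<le> (\<integral>\<^sup>+\<sigma>. (ennreal (cmod (?d y \<sigma>)) * indicator {0..1} \<sigma>) * indicator {0..1} \<sigma> \<partial>lborel)\<^sup>2"
        by (intro power_mono) auto
      also have "\<dots> \<le> (\<integral>\<^sup>+\<sigma>. (ennreal (cmod (?d y \<sigma>)) * indicator {0..1} \<sigma>)\<^sup>2 \<partial>lborel) * (\<integral>\<^sup>+\<sigma>. (indicator {0..1} \<sigma>)\<^sup>2 \<partial>(lborel :: real measure))"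
        by (rule Cauchy_Schwarz_nn_integral) measurable
      also have "(\<integral>\<^sup>+\<sigma>. (indicator {0..1} \<sigma>)\<^sup>2 \<partial>(lborel :: real measure)) = 1"
        by (subst nn_integral_cong[of _ _ "indicator {0..1}"]) (auto simp: indicator_def)
      also have "(\<integral>\<^sup>+\<sigma>. (ennreal (cmod (?d y \<sigma>)) * indicator {0..1} \<sigma>)\<^sup>2 \<partial>lborel)
           = (\<integral>\<^sup>+\<sigma>. ennreal ((cmod (?d y \<sigma>))\<^sup>2) * indicator {0..1} \<sigma> \<partial>lborel)"
        by (intro nn_integral_cong) (auto simp: indicator_def ennreal_power)
      finally show ?case by (simp add: ennreal_power)
    qed
  qed
  also have "\<dots> = (\<integral>\<^sup>+\<sigma>. (\<integral>\<^sup>+y. ennreal ((cmod (?d y \<sigma>))\<^sup>2) * indicator {0..1} \<sigma> \<partial>lborel) \<partial>lborel)"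
    by (rule lborel_pair.Fubini'[symmetric]) measurable
  also have "\<dots> \<le> (\<integral>\<^sup>+\<sigma>. ennreal e * indicator {0..1} \<sigma> \<partial>(lborel :: real measure))"
  proof (rule nn_integral_mono)
    fix \<sigma> :: real
    show "(\<integral>\<^sup>+y. ennreal ((cmod (?d y \<sigma>))\<^sup>2) * indicator {0..1} \<sigma> \<partial>lborel) \<le> ennreal e * indicator {0..1} \<sigma>"
    proof (cases "\<sigma> \<in> {0..1}")
      case True
      hence "\<bar>t * \<sigma>\<bar> \<le> \<bar>t\<bar>" by (simp add: abs_mult mult_left_le)
      moreover have "(\<lambda>y. ?d y \<sigma>) \<in> L2" by (intro L2_diff dil_L2 k)
      ultimately show ?thesis using True e[of "t * \<sigma>"] by (simp add: nn_integral_sqn ennreal_leI)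
    qed simp
  qed
  also have "\<dots> = ennreal e" by (simp add: nn_integral_cmult_indicator)
  finally show ?thesis using e0 by simp
qed

subsection \<open>Half-line reduction\<close>

lemma has_ac_deriv_comp:
  assumes v: "has_ac_deriv v g"
    and [measurable]: "\<phi> \<in> borel_measurable borel" "\<phi>' \<in> borel_measurable borel"
    and der: "\<And>x. (\<phi> has_real_derivative \<phi>' x) (at x)" and pos: "\<And>x. \<phi>' x > 0"
  shows "has_ac_deriv (\<lambda>x. v (\<phi> x)) (\<lambda>x. complex_of_real (\<phi>' x) * g (\<phi> x))"
proof -
  note [measurable] = has_ac_derivD(1)[OF v]
  show ?thesis
    unfolding has_ac_deriv_def
    by (intro conjI allI impI has_ac_deriv_substitution[OF v] der pos assms) measurable
qed

lemma has_ac_deriv_exp: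
  "has_ac_deriv (\<lambda>x. complex_of_real (exp (c * x))) (\<lambda>x. complex_of_real (c * exp (c * x)))"
proof (rule has_ac_deriv_smooth)
  fix x
  have "((\<lambda>x. exp (c * x)) has_real_derivative c * exp (c * x)) (at x)"
    by (auto intro!: derivative_eq_intros)
  thus "((\<lambda>x. complex_of_real (exp (c * x))) has_vector_derivative complex_of_real (c * exp (c * x))) (at x)"
    by (rule has_vector_derivative_of_real)
qed (intro continuous_intros)

section \<open>Energy identity and change of variables on the half line\<close>

text \<open>Only the sum \<open>g + v\<close> is assumed square integrable. On
  \<open>{-n..n}\<close> the energy is the integral of |g + v|^2 minus |v(n)|^2, hence bounded
  uniformly in n, and monotone convergence puts \<open>v\<close> and \<open>g\<close> into L2. Then
  |v|^2 has a limit at infinity, which is 0 because \<open>v\<close> is square integrable, and the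
  bound becomes an equality.\<close>

lemma half_line_energy:
  assumes v: "has_ac_deriv v g" and z: "\<And>x. x \<le> 0 \<Longrightarrow> v x = 0" "\<And>x. x \<le> 0 \<Longrightarrow> g x = 0"
    and p: "(\<lambda>x. g x + v x) \<in> L2"
  shows "v \<in> L2" "g \<in> L2" "sqn v + sqn g = sqn (\<lambda>x. g x + v x)"
proof -
  note [measurable] = has_ac_derivD(1)[OF v] has_ac_deriv_measurable[OF v]
  \<comment> \<open>The derivative of |v|^2, as the product rule for \<open>v * cnj v\<close>
    delivers it.\<close>
  define c where "c x = Re (v x * cnj (g x) + cnj (v x) * g x)" for x
  define q where "q x = (cmod (g x))\<^sup>2 + (cmod (v x))\<^sup>2" for x
  define P where "P x = (cmod (g x + v x))\<^sup>2" for x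
  have Pq: "P x - q x = c x" for x
    unfolding P_def q_def c_def cmod_power2 by (simp add: power2_eq_square algebra_simps)
  have q0: "q x \<ge> 0" for x by (simp add: q_def)
  have cnjm: "cnj \<in> borel_measurable borel" by (intro borel_measurable_continuous_onI continuous_intros)
  have [measurable]: "(\<lambda>x. cnj (v x)) \<in> borel_measurable borel" "(\<lambda>x. cnj (g x)) \<in> borel_measurable borel"
    by (rule measurable_compose[OF _ cnjm]; measurable)+
  have [measurable]: "c \<in> borel_measurable borel" "q \<in> borel_measurable borel" "P \<in> borel_measurable borel"
    unfolding c_def[abs_def] q_def[abs_def] P_def[abs_def] by measurable
  have PI: "integrable lborel P" using L2_D(2)[OF p] by (simp add: P_def[abs_def])
  have P0: "P x \<ge> 0" for x by (simp add: P_def)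
  have PS: "set_integrable lborel A P" if "A \<in> sets borel" for A
    unfolding set_integrable_def using that PI by (intro integrable_mult_indicator) auto
  have vv: "has_ac_deriv (\<lambda>x. v x * cnj (v x)) (\<lambda>x. v x * cnj (g x) + cnj (v x) * g x)"
    by (rule has_ac_deriv_mult[OF v has_ac_deriv_cnj[OF v]])
  have cS: "set_integrable lborel {a..b} c" "(LINT x:{a..b}|lborel. c x) = (cmod (v b))\<^sup>2 - (cmod (v a))\<^sup>2" if "a \<le> b" for a b
  proof -
    have eq: "indicat_real {a..b} x *\<^sub>R c x = Re (indicat_real {a..b} x *\<^sub>R (v x * cnj (g x) + cnj (v x) * g x))" for x
      by (simp add: c_def)
    have I: "integrable lborel (\<lambda>x. indicat_real {a..b} x *\<^sub>R (v x * cnj (g x) + cnj (v x) * g x))"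
      using has_ac_derivD(2)[OF vv that] by (simp add: set_integrable_def)
    show "set_integrable lborel {a..b} c"
      unfolding set_integrable_def eq by (rule integrable_Re[OF I])
    have "(LINT x:{a..b}|lborel. c x) = Re (v b * cnj (v b) - v a * cnj (v a))"
      unfolding set_lebesgue_integral_def eq integral_Re[OF I]
      using has_ac_derivD(3)[OF vv that] by (simp add: set_lebesgue_integral_def)
    thus "(LINT x:{a..b}|lborel. c x) = (cmod (v b))\<^sup>2 - (cmod (v a))\<^sup>2"
      by (simp add: complex_mult_cnj cmod_power2)
  qed
  have qS: "set_integrable lborel {-real n..real n} q"
    and qle: "(LINT x:{-real n..real n}|lborel. q x) \<le> sqn (\<lambda>x. g x + v x)" for n
  proof -
    have le: "-real n \<le> real n" by simp
    have eq: "q = (\<lambda>x. P x - c x)" using Pq by (auto simp: fun_eq_iff algebra_simps)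
    show "set_integrable lborel {-real n..real n} q"
      unfolding eq by (intro set_integral_diff PS cS) auto
    have "(LINT x:{-real n..real n}|lborel. q x) = (LINT x:{-real n..real n}|lborel. P x) - (LINT x:{-real n..real n}|lborel. c x)"
      unfolding eq by (intro set_integral_diff PS cS) auto
    also have "(LINT x:{-real n..real n}|lborel. c x) = (cmod (v (real n)))\<^sup>2"
      using cS(2)[OF le] z(1)[of "-real n"] by simp
    also have "(LINT x:{-real n..real n}|lborel. P x) \<le> (LINT x|lborel. P x)"
      unfolding set_lebesgue_integral_def
      by (rule integral_mono) (use PS[of "{-real n..real n}"] PI P0 in \<open>auto simp: set_integrable_def indicator_def\<close>)
    finally show "(LINT x:{-real n..real n}|lborel. q x) \<le> sqn (\<lambda>x. g x + v x)"
      using zero_le_power2[of "cmod (v (real n))"] unfolding sqn_def P_def by linarith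
  qed
  have qI: "integrable lborel q"
  proof (rule integrableI_bounded)
    have lim: "(\<lambda>n. \<integral>\<^sup>+x. ennreal (indicat_real {-real n..real n} x *\<^sub>R q x) \<partial>lborel) \<longlonglongrightarrow> (\<integral>\<^sup>+x. ennreal (q x) \<partial>lborel)"
    proof (rule nn_integral_LIMSEQ)
      show "incseq (\<lambda>n x. ennreal (indicat_real {-real n..real n} x *\<^sub>R q x))"
        by (intro incseq_SucI le_funI ennreal_leI) (auto simp: indicator_def q0)
      fix x :: real
      obtain N :: nat where "\<bar>x\<bar> \<le> N" using real_arch_simple by blast
      hence "ennreal (indicat_real {-real n..real n} x *\<^sub>R q x) = ennreal (q x)" if "n \<ge> N" for n
        using that by (auto simp: indicator_def abs_le_iff)
      thus "(\<lambda>n. ennreal (indicat_real {-real n..real n} x *\<^sub>R q x)) \<longlonglongrightarrow> ennreal (q x)"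
        by (intro tendsto_eventually) (auto simp: eventually_sequentially)
    qed measurable
    have "(\<integral>\<^sup>+x. ennreal (q x) \<partial>lborel) \<le> ennreal (sqn (\<lambda>x. g x + v x))"
    proof (rule LIMSEQ_le_const2[OF lim], intro exI allI impI)
      fix n
      have "(\<integral>\<^sup>+x. ennreal (indicat_real {-real n..real n} x *\<^sub>R q x) \<partial>lborel) = ennreal (LINT x:{-real n..real n}|lborel. q x)"
        unfolding set_lebesgue_integral_def
        by (rule nn_integral_eq_integral) (use qS[of n] q0 in \<open>auto simp: set_integrable_def\<close>)
      thus "(\<integral>\<^sup>+x. ennreal (indicat_real {-real n..real n} x *\<^sub>R q x) \<partial>lborel) \<le> ennreal (sqn (\<lambda>x. g x + v x))"
        using qle[of n] by (simp add: ennreal_leI)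
    qed
    thus "(\<integral>\<^sup>+x. ennreal (norm (q x)) \<partial>lborel) < \<infinity>"
      using q0 by (simp add: le_less_trans)
  qed measurable
  have gI: "integrable lborel (\<lambda>x. (cmod (g x))\<^sup>2)" and vI: "integrable lborel (\<lambda>x. (cmod (v x))\<^sup>2)"
    by (rule Bochner_Integration.integrable_bound[OF qI]; simp add: q_def)+
  show "v \<in> L2" "g \<in> L2" using gI vI by (simp_all add: L2_def)
  have cI: "integrable lborel c"
    using Bochner_Integration.integrable_diff[OF PI qI] by (simp add: Pq)
  \<comment> \<open>\<open>l\<close> will turn out to be the limit of |v|^2 at infinity.\<close>
  define l where "l = (LINT x|lborel. c x)"
  have "((\<lambda>y. LINT x|lborel. indicator {..y} x *\<^sub>R c x) \<longlongrightarrow> l) at_top"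
    unfolding l_def by (rule tendsto_integral_at_top[OF _ cI]) simp
  moreover have "(LINT x|lborel. indicator {..y} x *\<^sub>R c x) = (cmod (v y))\<^sup>2" if "y \<ge> 0" for y
  proof -
    have "(LINT x|lborel. indicator {..y} x *\<^sub>R c x) = (LINT x:{0..y}|lborel. c x)"
      unfolding set_lebesgue_integral_def
      by (intro Bochner_Integration.integral_cong) (use z in \<open>auto simp: indicator_def c_def\<close>)
    thus ?thesis using cS(2)[OF that] z(1)[of 0] by simp
  qed
  hence "\<forall>\<^sub>F y in at_top. (LINT x|lborel. indicator {..y} x *\<^sub>R c x) = (cmod (v y))\<^sup>2"
    unfolding eventually_at_top_linorder by blast
  ultimately have vlim: "((\<lambda>y. (cmod (v y))\<^sup>2) \<longlongrightarrow> l) at_top"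
    by (rule Lim_transform_eventually)
  have l0: "l \<ge> 0" by (rule tendsto_lowerbound[OF vlim]) auto
  have "l = 0"
  proof (rule ccontr)
    assume "l \<noteq> 0"
    hence l: "l > 0" using l0 by simp
    have "\<forall>\<^sub>F y in at_top. (cmod (v y))\<^sup>2 > l / 2"
      by (rule order_tendstoD[OF vlim]) (use l in simp)
    then obtain N where N: "\<And>y. y \<ge> N \<Longrightarrow> (cmod (v y))\<^sup>2 > l / 2" by (auto simp: eventually_at_top_linorder)
    \<comment> \<open>Beyond \<open>N\<close> an interval of length \<open>k\<close> contributes at
      least k * l / 2 to the integral of |v|^2, which is finite.\<close>
    have "real k * (l / 2) \<le> sqn v" for k :: nat
    proof -
      have "real k * (l / 2) = (LINT y|lborel. indicat_real {N..N + real k} y *\<^sub>R (l / 2))" by simp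
      also have "\<dots> \<le> (LINT y|lborel. (cmod (v y))\<^sup>2)"
      proof (rule integral_mono[OF _ vI])
        show "integrable lborel (\<lambda>y. indicat_real {N..N + real k} y *\<^sub>R (l / 2))"
          by (intro integrable_scaleR_left) (simp add: integrable_indicator_iff emeasure_lborel_Icc_eq)
        show "indicat_real {N..N + real k} y *\<^sub>R (l / 2) \<le> (cmod (v y))\<^sup>2" for y
          using N[of y] by (cases "y \<in> {N..N + real k}") auto
      qed
      finally show ?thesis by (simp add: sqn_def)
    qed
    moreover obtain k :: nat where "sqn v / (l / 2) < real k" using reals_Archimedean2 by blast
    hence "sqn v < real k * (l / 2)" using l by (subst (asm) pos_divide_less_eq) simp_all
    ultimately show False using not_le by blast
  qed
  hence "(LINT x|lborel. P x - q x) = 0" by (simp add: l_def Pq)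
  hence "(LINT x|lborel. P x) = (LINT x|lborel. q x)" using PI qI by simp
  thus "sqn v + sqn g = sqn (\<lambda>x. g x + v x)"
    using gI vI by (simp add: sqn_def P_def q_def)
qed

text \<open>Here \<open>p\<close> stands for v + v' and \<open>h\<close> for w': differentiating
  w(e^(2x) - 1) = e^x v(x) gives the relation \<open>eq\<close>. The factor 2 remains because |p|^2
  = 4 e^(2x) |h|^2 while the Jacobian is 2 e^(2x).\<close>

lemma half_line_change_of_variables:
  assumes [measurable]: "h \<in> borel_measurable borel" "p \<in> borel_measurable borel"
    and z: "\<And>x. x \<le> 0 \<Longrightarrow> h x = 0" "\<And>x. x \<le> 0 \<Longrightarrow> p x = 0"
    and eq: "\<And>x. x > 0 \<Longrightarrow> p x = complex_of_real (2 * exp x) * h (exp (2 * x) - 1)"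
  shows "p \<in> L2 \<longleftrightarrow> h \<in> L2" "p \<in> L2 \<Longrightarrow> sqn p = 2 * sqn h"
proof -
  let ?S = "{0<..} :: real set"
  let ?\<phi> = "\<lambda>x::real. exp (2 * x) - 1"
  have img: "?\<phi> ` ?S = ?S"
  proof (intro equalityI subsetI)
    fix y assume "y \<in> ?S"
    hence "y = ?\<phi> (ln (1 + y) / 2)" "ln (1 + y) / 2 \<in> ?S" by auto
    thus "y \<in> ?\<phi> ` ?S" by blast
  qed auto
  have inj: "inj_on ?\<phi> ?S" by (auto simp: inj_on_def)
  \<comment> \<open>Passage from Lebesgue integrals over the half line to Borel integrals over the
    line, for functions that vanish on the left.\<close>
  have conv: "(f absolutely_integrable_on ?S \<longleftrightarrow> integrable lborel f) \<and> (integrable lborel f \<longrightarrow> integral ?S f = (LINT x|lborel. f x))"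
    if [measurable]: "f \<in> borel_measurable borel" and f0: "\<And>x. x \<le> 0 \<Longrightarrow> f x = 0" for f :: "real \<Rightarrow> real"
  proof -
    have ind: "(\<lambda>x. indicat_real ?S x *\<^sub>R f x) = f" using f0 by (auto simp: indicator_def fun_eq_iff)
    have "f absolutely_integrable_on ?S \<longleftrightarrow> integrable lborel f"
      unfolding set_integrable_def ind by (rule integrable_completion) simp
    moreover have "integral ?S f = (LINT x|lborel. f x)" if "integrable lborel f"
      using set_borel_integral_eq_integral(2)[of ?S f] that
      by (simp add: set_integrable_def set_lebesgue_integral_def ind[simplified])
    ultimately show ?thesis by blast
  qed
  define f where "f y = 2 * (cmod (h y))\<^sup>2" for y
  define F where "F x = (cmod (p x))\<^sup>2" for x
  have [measurable]: "f \<in> borel_measurable borel" "F \<in> borel_measurable borel"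
    unfolding f_def[abs_def] F_def[abs_def] by measurable
  have Feq: "\<bar>2 * exp (2 * x)\<bar> *\<^sub>R f (?\<phi> x) = F x" if "x \<in> ?S" for x
    using eq[of x] that by (simp add: f_def F_def norm_mult power_mult_distrib exp_double)
  have "(\<lambda>x. \<bar>2 * exp (2 * x)\<bar> *\<^sub>R f (?\<phi> x)) absolutely_integrable_on ?S \<and> integral ?S (\<lambda>x. \<bar>2 * exp (2 * x)\<bar> *\<^sub>R f (?\<phi> x)) = b
      \<longleftrightarrow> f absolutely_integrable_on ?\<phi> ` ?S \<and> integral (?\<phi> ` ?S) f = b" for b
    by (rule has_absolute_integral_change_of_variables_real[OF _ _ inj])
       (auto intro!: derivative_eq_intros)
  note cov = this
  have "F absolutely_integrable_on ?S \<and> integral ?S F = b \<longleftrightarrow> f absolutely_integrable_on ?S \<and> integral ?S f = b" for b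
  proof -
    have "(\<lambda>x. \<bar>2 * exp (2 * x)\<bar> *\<^sub>R f (?\<phi> x)) absolutely_integrable_on ?S \<longleftrightarrow> F absolutely_integrable_on ?S"
      by (rule set_integrable_cong[OF refl refl Feq])
    moreover have "integral ?S (\<lambda>x. \<bar>2 * exp (2 * x)\<bar> *\<^sub>R f (?\<phi> x)) = integral ?S F"
      by (rule Henstock_Kurzweil_Integration.integral_cong[OF Feq])
    ultimately show ?thesis using cov[of b] unfolding img by simp
  qed
  moreover have Fc: "(F absolutely_integrable_on ?S \<longleftrightarrow> integrable lborel F) \<and> (integrable lborel F \<longrightarrow> integral ?S F = (LINT x|lborel. F x))"
    by (rule conv) (use z in \<open>auto simp: F_def\<close>)
  moreover have fc: "(f absolutely_integrable_on ?S \<longleftrightarrow> integrable lborel f) \<and> (integrable lborel f \<longrightarrow> integral ?S f = (LINT x|lborel. f x))"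
    by (rule conv) (use z in \<open>auto simp: f_def\<close>)
  ultimately have iff: "integrable lborel F \<longleftrightarrow> integrable lborel f" and val: "integrable lborel F \<Longrightarrow> (LINT x|lborel. F x) = (LINT x|lborel. f x)"
    by metis+
  have hI: "integrable lborel f \<longleftrightarrow> integrable lborel (\<lambda>y. (cmod (h y))\<^sup>2)"
    unfolding f_def[abs_def] by (subst integrable_mult_left_iff) simp_all
  show "p \<in> L2 \<longleftrightarrow> h \<in> L2" using iff hI by (simp add: L2_def F_def[abs_def])
  show "p \<in> L2 \<Longrightarrow> sqn p = 2 * sqn h"
    using val by (simp add: L2_def F_def[abs_def] f_def sqn_def)
qed

section \<open>The transformed half line\<close>

text \<open>The homogeneous Sobolev space of the half line with zero boundary value (hence the dot):
  only the derivative lies in L2, while \<open>w\<close> itself may grow. Extension by zero allows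
  all integrals to run over the whole line.\<close>

definition half_dot :: "(real \<Rightarrow> complex) \<Rightarrow> (real \<Rightarrow> complex) \<Rightarrow> bool" where
  "half_dot w h \<longleftrightarrow> has_ac_deriv w h \<and> (\<forall>x\<le>0. w x = 0 \<and> h x = 0) \<and> h \<in> L2"

text \<open>The coordinates \<open>y = exp (2 * x) - 1\<close> and \<open>w y = exp x * v x\<close>, with extension by \<open>0\<close>.\<close>

definition to_dot :: "(real \<Rightarrow> complex) \<Rightarrow> real \<Rightarrow> complex" where
  "to_dot v y = (if y > 0 then complex_of_real (sqrt (1 + y)) * v (ln (1 + y) / 2) else 0)"

definition of_dot :: "(real \<Rightarrow> complex) \<Rightarrow> real \<Rightarrow> complex" where
  "of_dot w x = (if x > 0 then complex_of_real (exp (- x)) * w (exp (2 * x) - 1) else 0)"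

lemma exp_half_ln: "y > 0 \<Longrightarrow> exp (ln y / 2) = sqrt y"
  by (rule real_sqrt_unique[symmetric]) (simp_all flip: exp_double)

lemma of_dot_to_dot: "x > 0 \<Longrightarrow> of_dot (to_dot v) x = v x"
proof -
  assume x: "x > 0"
  have "sqrt (exp (2 * x)) = exp x" by (simp add: exp_double real_sqrt_abs)
  thus ?thesis using x by (simp add: of_dot_def to_dot_def exp_minus flip: of_real_mult mult.assoc)
qed

lemma to_dot_of_dot:
  assumes "\<And>y. y \<le> 0 \<Longrightarrow> w y = 0"
  shows "to_dot (of_dot w) = w"
proof
  fix y
  show "to_dot (of_dot w) y = w y"
  proof (cases "y > 0")
    case True
    have "exp (- (ln (1 + y) / 2)) = inverse (sqrt (1 + y))" using True by (simp add: exp_minus exp_half_ln)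
    thus ?thesis using True by (simp add: of_dot_def to_dot_def flip: of_real_mult mult.assoc)
  qed (use assms in \<open>simp add: to_dot_def\<close>)
qed

text \<open>Chain rule with x = ln (1 + y) / 2: the derivative of e^x v(x) in y is (v + v') / (2
  e^x), and e^x = sqrt (1 + y).\<close>

lemma half_dot_to_dot:
  assumes v: "has_ac_deriv v g" "v 0 = 0" and L: "v \<in> L2" "g \<in> L2"
  defines "h \<equiv> \<lambda>y. if y > 0 then (v (ln (1 + y) / 2) + g (ln (1 + y) / 2)) / complex_of_real (2 * sqrt (1 + y)) else 0"
  shows "half_dot (to_dot v) h"
proof -
  note [measurable] = has_ac_derivD(1)[OF v(1)] has_ac_deriv_measurable[OF v(1)]
  define E where "E x = complex_of_real (exp (1 * x))" for x
  have E: "has_ac_deriv (\<lambda>x. E x * v x) (\<lambda>x. E x * g x + v x * E x)"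
    using has_ac_deriv_mult[OF has_ac_deriv_exp[of 1] v(1)] by (simp add: E_def)
  have ac: "has_ac_deriv (\<lambda>y. if y > 0 then E (ln (1 + y) / 2) * v (ln (1 + y) / 2) else 0)
     (\<lambda>y. if y > 0 then complex_of_real (1 / (2 * (1 + y))) * (E (ln (1 + y) / 2) * g (ln (1 + y) / 2) + v (ln (1 + y) / 2) * E (ln (1 + y) / 2)) else 0)"
    by (rule has_ac_deriv_half_comp[OF E]) (use v(2) in \<open>auto intro!: derivative_eq_intros simp: field_simps\<close>)
  have w: "(\<lambda>y. if y > 0 then E (ln (1 + y) / 2) * v (ln (1 + y) / 2) else 0) = to_dot v"
    by (auto simp: fun_eq_iff to_dot_def E_def exp_half_ln)
  have h: "(\<lambda>y. if y > 0 then complex_of_real (1 / (2 * (1 + y))) * (E (ln (1 + y) / 2) * g (ln (1 + y) / 2) + v (ln (1 + y) / 2) * E (ln (1 + y) / 2)) else 0) = h"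
  proof
    fix y :: real
    show "(if y > 0 then complex_of_real (1 / (2 * (1 + y))) * (E (ln (1 + y) / 2) * g (ln (1 + y) / 2) + v (ln (1 + y) / 2) * E (ln (1 + y) / 2)) else 0) = h y"
    proof (cases "y > 0")
      case True
      define s where "s = sqrt (1 + y)"
      have s: "s > 0" "1 + y = s * s" using True by (auto simp: s_def)
      have "E (ln (1 + y) / 2) = complex_of_real s" using True by (simp add: E_def exp_half_ln s_def)
      thus ?thesis using True s by (simp add: h_def flip: s_def) (simp add: field_simps)
    qed (simp add: h_def)
  qed
  have ac': "has_ac_deriv (to_dot v) h" using ac unfolding w h .
  define p where "p x = (if x > 0 then g x + v x else 0)" for x
  have [measurable]: "p \<in> borel_measurable borel" unfolding p_def[abs_def] by measurable
  have "p \<in> L2"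
    by (rule L2_bound[OF L2_add[OF L(2,1)], of _ 1]) (simp_all add: p_def)
  moreover have "p x = complex_of_real (2 * exp x) * h (exp (2 * x) - 1)" if "x > 0" for x
  proof -
    have "sqrt (exp (2 * x)) = exp x" by (simp add: exp_double real_sqrt_abs)
    thus ?thesis using that by (simp add: p_def h_def add.commute)
  qed
  ultimately have "h \<in> L2"
    by (subst (asm) half_line_change_of_variables(1)[of h p])
       (use has_ac_derivD(1)[OF ac'] in \<open>auto simp: p_def h_def\<close>)
  thus ?thesis using ac' by (auto simp: half_dot_def to_dot_def h_def)
qed

text \<open>Only the derivative \<open>h\<close> is known to lie in L2, so square integrability of
  \<open>of_dot w\<close> and of its derivative has to come from \<open>half_line_energy\<close>,
  applied to their sum.\<close>

lemma of_dot_half_dot: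
  assumes w: "half_dot w h"
  obtains g where "has_ac_deriv (of_dot w) g" "\<And>x. x \<le> 0 \<Longrightarrow> g x = 0"
    "of_dot w \<in> L2" "g \<in> L2" "sqn (of_dot w) + sqn g = 2 * sqn h"
proof -
  have ac: "has_ac_deriv w h" and z: "\<And>x. x \<le> 0 \<Longrightarrow> w x = 0" "\<And>x. x \<le> 0 \<Longrightarrow> h x = 0" and hL: "h \<in> L2"
    using w by (auto simp: half_dot_def)
  note [measurable] = has_ac_derivD(1)[OF ac] has_ac_deriv_measurable[OF ac]
  let ?W = "\<lambda>x. if x > 0 then w (exp (2 * x) - 1) else 0"
  let ?H = "\<lambda>x. if x > 0 then complex_of_real (2 * exp (2 * x)) * h (exp (2 * x) - 1) else 0"
  have 1: "has_ac_deriv ?W ?H"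
    by (rule has_ac_deriv_half_comp[OF ac]) (auto simp: z intro!: derivative_eq_intros)
  define g where "g x = complex_of_real (exp ((-1) * x)) * ?H x + ?W x * complex_of_real ((-1) * exp ((-1) * x))" for x
  have "has_ac_deriv (\<lambda>x. complex_of_real (exp ((-1) * x)) * ?W x) g"
    unfolding g_def[abs_def] by (rule has_ac_deriv_mult[OF has_ac_deriv_exp 1])
  also have "(\<lambda>x. complex_of_real (exp ((-1) * x)) * ?W x) = of_dot w"
    by (auto simp: fun_eq_iff of_dot_def)
  finally have ac': "has_ac_deriv (of_dot w) g" .
  have g0: "g x = 0" if "x \<le> 0" for x using that by (simp add: g_def)
  have p: "g x + of_dot w x = complex_of_real (2 * exp x) * h (exp (2 * x) - 1)" if "x > 0" for x
  proof -
    have e: "exp ((-1) * x) = 1 / exp x" "exp (- x) = 1 / exp x" "2 * exp (2 * x) = 2 * exp x * exp x"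
      by (simp_all add: exp_minus exp_double power2_eq_square inverse_eq_divide)
    show ?thesis using that unfolding g_def of_dot_def e by (simp add: field_simps)
  qed
  note [measurable] = has_ac_derivD(1)[OF ac'] has_ac_deriv_measurable[OF ac']
  have cv: "(\<lambda>x. g x + of_dot w x) \<in> L2 \<longleftrightarrow> h \<in> L2" "(\<lambda>x. g x + of_dot w x) \<in> L2 \<Longrightarrow> sqn (\<lambda>x. g x + of_dot w x) = 2 * sqn h"
    by (rule half_line_change_of_variables; use z g0 p in \<open>simp add: of_dot_def\<close>)+
  have pL: "(\<lambda>x. g x + of_dot w x) \<in> L2" using cv(1) hL by simp
  have en: "of_dot w \<in> L2" "g \<in> L2" "sqn (of_dot w) + sqn g = sqn (\<lambda>x. g x + of_dot w x)"
    by (rule half_line_energy[OF ac' _ g0 pL]; simp add: of_dot_def)+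
  show ?thesis
    by (rule that[OF ac' g0 en(1,2)]) (simp_all add: en(3) cv(2)[OF pL])
qed

lemma half_dot_diff:
  assumes "half_dot w h" "half_dot z k"
  shows "half_dot (\<lambda>y. w y - z y) (\<lambda>y. h y - k y)"
  using assms by (auto simp: half_dot_def intro: has_ac_deriv_diff L2_diff)

lemma half_dot_cmult:
  assumes "half_dot w h"
  shows "half_dot (\<lambda>y. c * w y) (\<lambda>y. c * h y)"
  using assms by (auto simp: half_dot_def intro: has_ac_deriv_cmult L2_cmult)

definition scale :: "real \<Rightarrow> (real \<Rightarrow> complex) \<Rightarrow> real \<Rightarrow> complex" where
  "scale t w y = complex_of_real (exp (- t)) * w (exp (2 * t) * y)"

lemma scale_scale: "scale s (scale t w) = scale (s + t) w"
proof
  fix y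
  have "exp (- (s + t)) = exp (- s) * exp (- t)" "exp (2 * (s + t)) = exp (2 * t) * exp (2 * s)"
    by (simp_all add: mult_exp_exp algebra_simps)
  thus "scale s (scale t w) y = scale (s + t) w y"
    by (simp only: scale_def of_real_mult mult.assoc)
qed

lemma scale_0 [simp]: "scale 0 w = w"
  by (simp add: scale_def fun_eq_iff)

lemma half_dot_scale:
  assumes "half_dot w h"
  shows "half_dot (scale t w) (dil t h)"
proof -
  have ac: "has_ac_deriv w h" using assms by (simp add: half_dot_def)
  have "has_ac_deriv (\<lambda>y. complex_of_real (exp (- t)) * w (0 + exp (2 * t) * y))
     (\<lambda>y. complex_of_real (exp (- t)) * (complex_of_real (exp (2 * t)) * h (0 + exp (2 * t) * y)))"
    by (intro has_ac_deriv_cmult has_ac_deriv_affine ac) simp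
  moreover have "complex_of_real (exp (- t)) * complex_of_real (exp (2 * t)) = complex_of_real (exp t)"
    by (simp add: mult_exp_exp flip: of_real_mult)
  ultimately have "has_ac_deriv (scale t w) (dil t h)"
    by (simp add: scale_def[abs_def] dil_def[abs_def] flip: mult.assoc)
  thus ?thesis
    using assms dil_L2 by (auto simp: half_dot_def scale_def dil_def mult_le_0_iff)
qed

text \<open>In s, with y = e^(2s), \<open>dil t\<close> translates \<open>H\<close> by
  \<open>t\<close>. By hypothesis \<open>H s\<close> is e^(-s) (z + w)(e^(2s)) / 2, an absolutely
  continuous function; in its derivative the terms with \<open>h\<close> cancel and e^s k(e^(2s))
  remains. The increments of \<open>H\<close> thus express the difference quotient as an average of
  dilates of \<open>k\<close>.\<close>

lemma half_dot_quotient_tendsto: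
  assumes w: "half_dot w h" and z: "half_dot z k"
    and h: "\<And>y. y > 0 \<Longrightarrow> h y = (z y + w y) / complex_of_real (2 * y)"
  shows "((\<lambda>t. sqn (\<lambda>y. (dil t h y - h y) / complex_of_real t - k y)) \<longlongrightarrow> 0) (at 0)"
proof -
  have ac: "has_ac_deriv w h" "has_ac_deriv z k" and L: "h \<in> L2" "k \<in> L2"
    and z0: "\<And>y. y \<le> 0 \<Longrightarrow> h y = 0" "\<And>y. y \<le> 0 \<Longrightarrow> k y = 0"
    using w z by (auto simp: half_dot_def)
  define H where "H s = complex_of_real (exp s) * h (exp (2 * s))" for s
  have H: "has_ac_deriv H (\<lambda>s. complex_of_real (exp s) * k (exp (2 * s)))"
  proof -
    have "has_ac_deriv (\<lambda>s. z (exp (2 * s)) + w (exp (2 * s))) (\<lambda>s. complex_of_real (2 * exp (2 * s)) * (k (exp (2 * s)) + h (exp (2 * s))))"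
      by (rule has_ac_deriv_comp[OF has_ac_deriv_add[OF ac(2,1)]]) (auto intro!: derivative_eq_intros)
    from has_ac_deriv_cmult[OF has_ac_deriv_mult[OF has_ac_deriv_exp[of "-1"] this], of "1/2"]
    have "has_ac_deriv (\<lambda>s. 1 / 2 * (complex_of_real (exp (- 1 * s)) * (z (exp (2 * s)) + w (exp (2 * s)))))
      (\<lambda>s. 1 / 2 * (complex_of_real (exp (- 1 * s)) * (complex_of_real (2 * exp (2 * s)) * (k (exp (2 * s)) + h (exp (2 * s)))) +
         (z (exp (2 * s)) + w (exp (2 * s))) * complex_of_real (- 1 * exp (- 1 * s))))" .
    also have "(\<lambda>s. 1 / 2 * (complex_of_real (exp (- 1 * s)) * (z (exp (2 * s)) + w (exp (2 * s))))) = H"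
    proof
      fix s :: real
      have e: "exp (- 1 * s) = 1 / exp s" "exp (2 * s) = exp s * exp s"
        by (simp_all add: exp_minus exp_double power2_eq_square inverse_eq_divide)
      show "1 / 2 * (complex_of_real (exp (- 1 * s)) * (z (exp (2 * s)) + w (exp (2 * s)))) = H s"
        unfolding H_def e using h[of "exp s * exp s"] by (simp add: field_simps)
    qed
    also have "(\<lambda>s. 1 / 2 * (complex_of_real (exp (- 1 * s)) * (complex_of_real (2 * exp (2 * s)) * (k (exp (2 * s)) + h (exp (2 * s)))) +
         (z (exp (2 * s)) + w (exp (2 * s))) * complex_of_real (- 1 * exp (- 1 * s)))) = (\<lambda>s. complex_of_real (exp s) * k (exp (2 * s)))"
    proof
      fix s :: real
      have e: "exp (- 1 * s) = 1 / exp s" "exp (2 * s) = exp s * exp s"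
        by (simp_all add: exp_minus exp_double power2_eq_square inverse_eq_divide)
      show "1 / 2 * (complex_of_real (exp (- 1 * s)) * (complex_of_real (2 * exp (2 * s)) * (k (exp (2 * s)) + h (exp (2 * s)))) +
         (z (exp (2 * s)) + w (exp (2 * s))) * complex_of_real (- 1 * exp (- 1 * s))) = complex_of_real (exp s) * k (exp (2 * s))"
        unfolding e using h[of "exp s * exp s"] by (simp add: field_simps)
    qed
    finally show ?thesis .
  qed
  have rep: "set_integrable lborel {0..1} (\<lambda>\<sigma>. dil (t * \<sigma>) k y - k y) \<and>
         (dil t h y - h y) / complex_of_real t - k y = (LINT \<sigma>:{0..1}|lborel. dil (t * \<sigma>) k y - k y)" if t: "t \<noteq> 0" for t y
  proof (cases "y > 0")
    case True
    define s where "s = ln y / 2"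
    have y: "exp (2 * s) = y" using True by (simp add: s_def)
    have yy: "exp (2 * (s + r)) = exp (2 * r) * y" for r
      unfolding distrib_left exp_add y by (rule mult.commute)
    \<comment> \<open>The path is parametrized over \<open>{0..1}\<close> with time
      \<open>t * \<sigma>\<close>, so that division by \<open>t\<close>, of either sign, turns the
      increment into an average.\<close>
    have ac: "has_ac_deriv (\<lambda>\<sigma>. H (s + t * \<sigma>)) (\<lambda>\<sigma>. complex_of_real t * (complex_of_real (exp (s + t * \<sigma>)) * k (exp (2 * (s + t * \<sigma>)))))"
      by (rule has_ac_deriv_affine[OF H t])
    have eq: "complex_of_real t * (complex_of_real (exp (s + t * \<sigma>)) * k (exp (2 * (s + t * \<sigma>)))) = complex_of_real (t * exp s) * dil (t * \<sigma>) k y" for \<sigma>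
      unfolding yy by (simp add: dil_def exp_add)
    have nz: "complex_of_real (t * exp s) \<noteq> 0" using t by simp
    have I: "set_integrable lborel {0..1} (\<lambda>\<sigma>. dil (t * \<sigma>) k y)"
    proof -
      have "set_integrable lborel {0..1} (\<lambda>\<sigma>. complex_of_real (t * exp s) * dil (t * \<sigma>) k y)"
        using has_ac_derivD(2)[OF ac, of 0 1] unfolding eq by simp
      hence "set_integrable lborel {0..1} (\<lambda>\<sigma>. inverse (complex_of_real (t * exp s)) * (complex_of_real (t * exp s) * dil (t * \<sigma>) k y))"
        by (rule set_integrable_mult_right)
      thus ?thesis by (simp only: mult.assoc[symmetric] left_inverse[OF nz] mult_1_left)
    qed
    have J: "complex_of_real (t * exp s) * (LINT \<sigma>:{0..1}|lborel. dil (t * \<sigma>) k y) = H (s + t) - H s"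
      using has_ac_derivD(3)[OF ac, of 0 1] unfolding eq by simp
    also have "H (s + t) - H s = complex_of_real (exp s) * (dil t h y - h y)"
      unfolding H_def yy y by (simp add: dil_def exp_add algebra_simps)
    finally have "complex_of_real (exp s) * (complex_of_real t * (LINT \<sigma>:{0..1}|lborel. dil (t * \<sigma>) k y))
        = complex_of_real (exp s) * (dil t h y - h y)" by (simp add: mult_ac)
    hence "complex_of_real t * (LINT \<sigma>:{0..1}|lborel. dil (t * \<sigma>) k y) = dil t h y - h y"
      by (subst (asm) mult_left_cancel) simp_all
    hence "(dil t h y - h y) / complex_of_real t = (LINT \<sigma>:{0..1}|lborel. dil (t * \<sigma>) k y)"
      using t by (metis nonzero_mult_div_cancel_left of_real_eq_0_iff)
    moreover have c: "set_integrable lborel {0..1::real} (\<lambda>\<sigma>. k y)"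
      by (rule borel_integrable_atLeastAtMost') simp
    moreover have "(LINT \<sigma>:{0..1::real}|lborel. k y) = k y"
      by (simp add: set_lebesgue_integral_def)
    ultimately show ?thesis using I set_integral_diff[OF I c] by simp
  next
    case False
    hence "exp a * y \<le> 0" for a by (simp add: mult_le_0_iff)
    thus ?thesis using False by (simp add: dil_def z0 set_integrable_def set_lebesgue_integral_def)
  qed
  show ?thesis
  proof (rule tendstoI)
    fix e :: real assume e: "e > 0"
    have "\<forall>\<^sub>F t in at 0. dist (sqn (\<lambda>y. dil t k y - k y)) 0 < e / 2"
      by (rule tendstoD[OF dil_tendsto[OF L(2)]]) (use e in simp)
    then obtain d where d: "d > 0" "\<And>t. t \<noteq> 0 \<Longrightarrow> dist t 0 < d \<Longrightarrow> sqn (\<lambda>y. dil t k y - k y) < e / 2"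
      unfolding eventually_at by (auto simp: dist_real_def)
    \<comment> \<open>The limit at 0 says nothing about the value at 0, but the average includes
      \<open>\<sigma> = 0\<close>; there the difference vanishes.\<close>
    have d': "sqn (\<lambda>y. dil t k y - k y) \<le> e / 2" if "\<bar>t\<bar> < d" for t
    proof (cases "t = 0")
      case True
      thus ?thesis using e by (simp add: dil_def sqn_def)
    qed (use d(2)[of t] that in \<open>auto simp: dist_real_def\<close>)
    show "\<forall>\<^sub>F t in at 0. dist (sqn (\<lambda>y. (dil t h y - h y) / complex_of_real t - k y)) 0 < e"
      unfolding eventually_at
    proof (intro exI[of _ d] conjI ballI impI d(1))
      fix t :: real assume "t \<noteq> 0 \<and> dist t 0 < d"
      hence t: "t \<noteq> 0" "\<bar>t\<bar> < d" by (auto simp: dist_real_def)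
      have "sqn (\<lambda>y. (dil t h y - h y) / complex_of_real t - k y) \<le> e / 2"
        by (rule dil_difference_quotient_le[OF L AE_I2[OF rep[OF t(1)]] d']) (use t in linarith)
      thus "dist (sqn (\<lambda>y. (dil t h y - h y) / complex_of_real t - k y)) 0 < e"
        using e sqn_nonneg[of "\<lambda>y. (dil t h y - h y) / complex_of_real t - k y"] by (simp add: dist_real_def)
    qed
  qed
qed

subsection \<open>Characterization of the domain\<close>

lemma H1_tildeI:
  assumes "has_ac_deriv v g" "v \<in> L2" "g \<in> L2" "v 0 = 0"
  shows "v \<in> H1_tilde"
  using assms by (auto simp: H1_tilde_def H1_iff)

lemma H1_tildeE:
  assumes "v \<in> H1_tilde"
  obtains g where "has_ac_deriv v g" "v \<in> L2" "g \<in> L2" "v 0 = 0"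
  using assms by (auto simp: H1_tilde_def H1_iff)

lemma H1_tilde_continuous: "v \<in> H1_tilde \<Longrightarrow> continuous_on UNIV v"
  by (simp add: H1_tilde_def H1_def)

lemma H1_tilde_add: "u \<in> H1_tilde \<Longrightarrow> v \<in> H1_tilde \<Longrightarrow> (\<lambda>x. u x + v x) \<in> H1_tilde"
  by (elim H1_tildeE, rule H1_tildeI[OF has_ac_deriv_add]) (auto intro: L2_add)

lemma H1_tilde_cmult: "v \<in> H1_tilde \<Longrightarrow> (\<lambda>x. c * v x) \<in> H1_tilde"
  by (elim H1_tildeE, rule H1_tildeI[OF has_ac_deriv_cmult]) (auto intro: L2_cmult)

lemma H1_tilde_diff: "u \<in> H1_tilde \<Longrightarrow> v \<in> H1_tilde \<Longrightarrow> (\<lambda>x. u x - v x) \<in> H1_tilde"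
  using H1_tilde_add[of u "\<lambda>x. (-1) * v x"] H1_tilde_cmult[of v "-1"] by simp

lemma has_ac_deriv_mirror:
  assumes "has_ac_deriv v g" shows "has_ac_deriv (\<lambda>x. v (- x)) (\<lambda>x. - g (- x))"
  using has_ac_deriv_affine[OF assms, of "-1" 0] by simp

lemma L2_mirror: "f \<in> L2 \<Longrightarrow> (\<lambda>x. f (- x)) \<in> L2" "f \<in> L2 \<Longrightarrow> sqn (\<lambda>x. f (- x)) = sqn f"
  using L2_affine[of f "-1" 0] by simp_all

lemma L2_minus: "f \<in> L2 \<Longrightarrow> (\<lambda>x. - f x) \<in> L2"
  using L2_cmult[of f "-1"] by simp

lemma sqn_minus: "sqn (\<lambda>x. - f x) = sqn f"
  by (simp add: sqn_def)

lemma H1_tilde_mirror: "v \<in> H1_tilde \<Longrightarrow> (\<lambda>x. v (- x)) \<in> H1_tilde"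
  by (elim H1_tildeE, rule H1_tildeI[OF has_ac_deriv_mirror]) (auto intro: L2_mirror L2_minus)

lemma sqn_disjoint:
  assumes "f \<in> L2" "g \<in> L2" "\<And>x. f x = 0 \<or> g x = 0"
  shows "sqn (\<lambda>x. f x + g x) = sqn f + sqn g"
proof -
  have "(cmod (f x + g x))\<^sup>2 = (cmod (f x))\<^sup>2 + (cmod (g x))\<^sup>2" for x
    using assms(3)[of x] by auto
  thus ?thesis using L2_D(2)[OF assms(1)] L2_D(2)[OF assms(2)] by (simp add: sqn_def)
qed

text \<open>\<open>w1\<close> describes \<open>v\<close> on the right half line and \<open>w2\<close> its reflection from the left one.\<close>

definition two_sided where
  "two_sided v w1 h1 w2 h2 \<longleftrightarrow> half_dot w1 h1 \<and> half_dot w2 h2 \<and> v = (\<lambda>x. of_dot w1 x + of_dot w2 (- x))"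

lemma two_sided_exists:
  assumes "v \<in> H1_tilde"
  obtains h1 h2 where "two_sided v (to_dot v) h1 (to_dot (\<lambda>x. v (- x))) h2"
proof -
  obtain g where g: "has_ac_deriv v g" "v \<in> L2" "g \<in> L2" "v 0 = 0" using assms by (rule H1_tildeE)
  obtain h1 where h1: "half_dot (to_dot v) h1" using half_dot_to_dot[OF g(1,4,2,3)] by blast
  have "v (- 0) = 0" using g by simp
  then obtain h2 where h2: "half_dot (to_dot (\<lambda>x. v (- x))) h2"
    using half_dot_to_dot[OF has_ac_deriv_mirror[OF g(1)] _ L2_mirror(1)[OF g(2)] L2_minus[OF L2_mirror(1)[OF g(3)]]] by blast
  have "v x = of_dot (to_dot v) x + of_dot (to_dot (\<lambda>x. v (- x))) (- x)" for x
    using of_dot_to_dot[of x v] of_dot_to_dot[of "-x" "\<lambda>x. v (- x)"] g(4)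
    by (cases x "0::real" rule: linorder_cases) (auto simp: of_dot_def)
  hence "v = (\<lambda>x. of_dot (to_dot v) x + of_dot (to_dot (\<lambda>x. v (- x))) (- x))" by (rule ext)
  thus ?thesis using h1 h2 that unfolding two_sided_def by blast
qed

text \<open>The two pieces live on opposite half lines, so their squared norms add. Since the pieces
  are recovered from \<open>v\<close>, later computations may start from any decomposition.\<close>

lemma two_sided_H1_tilde:
  assumes "two_sided v w1 h1 w2 h2"
  shows "v \<in> H1_tilde" "H1_norm v = sqrt (2 * sqn h1 + 2 * sqn h2)"
    "to_dot v = w1" "to_dot (\<lambda>x. v (- x)) = w2"
proof -
  have w: "half_dot w1 h1" "half_dot w2 h2" and v: "v = (\<lambda>x. of_dot w1 x + of_dot w2 (- x))"
    using assms by (auto simp: two_sided_def)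
  have w0: "\<And>y. y \<le> 0 \<Longrightarrow> w1 y = 0" "\<And>y. y \<le> 0 \<Longrightarrow> w2 y = 0" using w by (auto simp: half_dot_def)
  obtain g1 where g1: "has_ac_deriv (of_dot w1) g1" "\<And>x. x \<le> 0 \<Longrightarrow> g1 x = 0"
    "of_dot w1 \<in> L2" "g1 \<in> L2" "sqn (of_dot w1) + sqn g1 = 2 * sqn h1"
    using of_dot_half_dot[OF w(1)] by metis
  obtain g2 where g2: "has_ac_deriv (of_dot w2) g2" "\<And>x. x \<le> 0 \<Longrightarrow> g2 x = 0"
    "of_dot w2 \<in> L2" "g2 \<in> L2" "sqn (of_dot w2) + sqn g2 = 2 * sqn h2"
    using of_dot_half_dot[OF w(2)] by metis
  have ac: "has_ac_deriv v (\<lambda>x. g1 x + - g2 (- x))"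
    unfolding v by (intro has_ac_deriv_add g1 has_ac_deriv_mirror g2)
  have vL: "v \<in> L2" unfolding v by (intro L2_add g1 L2_mirror g2)
  show H: "v \<in> H1_tilde"
    by (rule H1_tildeI[OF ac vL]) (auto simp: v of_dot_def intro!: L2_diff L2_mirror g1 g2)
  have "sqn v = sqn (of_dot w1) + sqn (of_dot w2)"
  proof -
    have "of_dot w1 x = 0 \<or> of_dot w2 (- x) = 0" for x by (simp add: of_dot_def)
    thus ?thesis unfolding v using sqn_disjoint[OF g1(3) L2_mirror(1)[OF g2(3)]] L2_mirror(2)[OF g2(3)] by simp
  qed
  moreover have "sqn (\<lambda>x. g1 x + - g2 (- x)) = sqn g1 + sqn g2"
  proof (subst sqn_disjoint)
    show "g1 x = 0 \<or> - g2 (- x) = 0" for x using g1(2)[of x] g2(2)[of "-x"] by (cases "x \<le> 0") auto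
  qed (auto simp: L2_mirror g1 g2 L2_minus sqn_minus)
  ultimately have "sqn v + sqn (\<lambda>x. g1 x + - g2 (- x)) = 2 * sqn h1 + 2 * sqn h2"
    using g1(5) g2(5) by simp
  thus "H1_norm v = sqrt (2 * sqn h1 + 2 * sqn h2)"
    using H1_norm_eq[OF _ ac] H by (simp add: H1_tilde_def)
  have "to_dot v = to_dot (of_dot w1)" by (auto simp: to_dot_def v of_dot_def fun_eq_iff)
  thus "to_dot v = w1" using to_dot_of_dot[OF w0(1)] by simp
  have "to_dot (\<lambda>x. v (- x)) = to_dot (of_dot w2)" by (auto simp: to_dot_def v of_dot_def fun_eq_iff)
  thus "to_dot (\<lambda>x. v (- x)) = w2" using to_dot_of_dot[OF w0(2)] by simp
qed

lemma two_sided_diff: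
  assumes "two_sided u w1 h1 w2 h2" "two_sided v z1 k1 z2 k2"
  shows "two_sided (\<lambda>x. u x - v x) (\<lambda>y. w1 y - z1 y) (\<lambda>y. h1 y - k1 y) (\<lambda>y. w2 y - z2 y) (\<lambda>y. h2 y - k2 y)"
  using assms unfolding two_sided_def
  by (elim conjE, intro conjI half_dot_diff ext) (simp_all add: of_dot_def algebra_simps)

lemma two_sided_cmult:
  assumes "two_sided v w1 h1 w2 h2"
  shows "two_sided (\<lambda>x. c * v x) (\<lambda>y. c * w1 y) (\<lambda>y. c * h1 y) (\<lambda>y. c * w2 y) (\<lambda>y. c * h2 y)"
  using assms unfolding two_sided_def
  by (elim conjE, intro conjI half_dot_cmult ext) (simp_all add: of_dot_def algebra_simps)

section \<open>The multiplication term and the classical form of the equation\<close>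

text \<open>On the right half line the factor is \<open>- (phi x * phi' x)\<close>. Cutting at the
  origin is harmless because \<open>v 0 = 0\<close>.\<close>

lemma exp_mult_H1_tilde:
  assumes "v \<in> H1_tilde"
  shows "(\<lambda>x. if x > 0 then complex_of_real (exp (- 2 * x)) * v x else 0) \<in> H1_tilde"
proof -
  obtain g where g: "has_ac_deriv v g" "v \<in> L2" "g \<in> L2" "v 0 = 0" using assms by (rule H1_tildeE)
  let ?E = "\<lambda>x::real. complex_of_real (exp (- 2 * x))"
  let ?P = "\<lambda>x. if x > 0 then v x else 0" and ?G = "\<lambda>x. if x > 0 then g x else 0"
  have ac: "has_ac_deriv (\<lambda>x. ?E x * ?P x) (\<lambda>x. ?E x * ?G x + ?P x * complex_of_real (- 2 * exp (- 2 * x)))"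
    by (rule has_ac_deriv_mult[OF has_ac_deriv_exp has_ac_deriv_half[OF g(1,4)]])
  note [measurable] = has_ac_derivD(1)[OF g(1)] has_ac_deriv_measurable[OF g(1)]
  have 1: "(\<lambda>x. ?E x * ?P x) \<in> L2"
    by (rule L2_bound[OF g(2), of _ 1], measurable) (auto simp: norm_mult mult_left_le_one_le)
  have 2: "(\<lambda>x. ?E x * ?G x) \<in> L2"
    by (rule L2_bound[OF g(3), of _ 1], measurable) (auto simp: norm_mult mult_left_le_one_le)
  have 3: "(\<lambda>x. ?E x * ?G x + ?P x * complex_of_real (- 2 * exp (- 2 * x))) \<in> L2"
    using L2_add[OF 2 L2_cmult[OF 1, of "-2"]] by (rule back_subst[of "\<lambda>f. f \<in> L2"]) (auto simp: fun_eq_iff)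
  have "(\<lambda>x. ?E x * ?P x) = (\<lambda>x. if x > 0 then ?E x * v x else 0)" by auto
  thus ?thesis using H1_tildeI[OF ac 1 3] by simp
qed

text \<open>The odd factor - sgn x * exp (- 2 |x|) is assembled from the cut multiplication
  conjugated by reflection, minus the cut multiplication itself.\<close>

lemma phi_phi'_mult_H1_tilde:
  assumes "v \<in> H1_tilde"
  shows "(\<lambda>x. complex_of_real (phi x * phi' x) * v x) \<in> H1_tilde"
proof -
  have v0: "v 0 = 0" using assms by (simp add: H1_tilde_def)
  let ?F = "\<lambda>u x. if x > 0 then complex_of_real (exp (- 2 * x)) * u x else (0::complex)"
  have "(\<lambda>x. ?F (\<lambda>x. v (- x)) (- x) - ?F v x) \<in> H1_tilde"
    using H1_tilde_diff[OF H1_tilde_mirror[OF exp_mult_H1_tilde[OF H1_tilde_mirror[OF assms]]] exp_mult_H1_tilde[OF assms]] .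
  also have "(\<lambda>x. ?F (\<lambda>x. v (- x)) (- x) - ?F v x) = (\<lambda>x. complex_of_real (phi x * phi' x) * v x)"
    by (auto simp: fun_eq_iff phi_def phi'_def v0 sgn_if mult_exp_exp simp flip: of_real_mult)
  finally show ?thesis .
qed

lemma continuous_AE_eq:
  fixes f g :: "real \<Rightarrow> complex"
  assumes "continuous_on UNIV f" "continuous_on UNIV g" "AE x in lborel. f x = g x"
  shows "f = g"
proof (rule ccontr)
  assume "f \<noteq> g"
  then obtain x where x: "f x \<noteq> g x" by auto
  have "open {x. f x \<noteq> g x}" by (intro open_Collect_neq assms)
  then obtain e where e: "e > 0" "ball x e \<subseteq> {x. f x \<noteq> g x}" using x openE by blast
  obtain N where N: "{x \<in> space lborel. \<not> f x = g x} \<subseteq> N" "emeasure lborel N = 0" "N \<in> sets lborel"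
    using assms(3) by (rule AE_E)
  have "{x - e<..<x + e} \<subseteq> N" using e(2) N(1) by (auto simp: ball_eq_greaterThanLessThan)
  hence "emeasure lborel {x - e<..<x + e} \<le> emeasure lborel N" using N(3) by (rule emeasure_mono)
  thus False using N(2) e(1) by simp
qed

text \<open>Elements of \<open>H1_tilde\<close> are continuous, so their values almost everywhere
  determine them and the definite description has at most one solution.\<close>

lemma op_L_eqI:
  assumes "z \<in> H1_tilde"
    and "AE x in lborel. z x = complex_of_real (1 - (phi x)\<^sup>2) * weak_deriv v x + complex_of_real (phi x * phi' x) * v x"
  shows "op_L v = z"
  unfolding op_L_def
proof (rule the_equality)
  fix w assume w: "w \<in> H1_tilde \<and> (AE x in lborel. w x = complex_of_real (1 - (phi x)\<^sup>2) * weak_deriv v x + complex_of_real (phi x * phi' x) * v x)"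
  have "AE x in lborel. w x = z x" using conjunct2[OF w] assms(2) by eventually_elim simp
  thus "w = z" using w assms by (intro continuous_AE_eq H1_tilde_continuous) auto
qed (use assms in auto)

lemma phi_less_1: "x \<noteq> 0 \<Longrightarrow> 1 - (phi x)\<^sup>2 > 0"
  by (simp add: phi_def abs_square_less_1)

lemma continuous_on_classical_deriv:
  assumes "continuous_on UNIV z" "continuous_on UNIV v"
  shows "continuous_on (- {0})
    (\<lambda>x. (z x - complex_of_real (phi x * phi' x) * v x) / complex_of_real (1 - (phi x)\<^sup>2))"
proof -
  have "continuous_on (- {0}) phi"
    unfolding phi_def[abs_def] by (intro continuous_intros)
  moreover have "continuous_on (- {0}) (sgn :: real \<Rightarrow> real)"
    by (intro continuous_on_sgn continuous_on_id) simp
  hence "continuous_on (- {0}) phi'"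
    unfolding phi'_def[abs_def] by (intro continuous_intros) simp
  moreover have "\<forall>x\<in>- {0}. complex_of_real (1 - (phi x)\<^sup>2) \<noteq> 0"
  proof
    fix x :: real assume "x \<in> - {0}"
    hence "1 - (phi x)\<^sup>2 \<noteq> 0" using phi_less_1[of x] by simp
    thus "complex_of_real (1 - (phi x)\<^sup>2) \<noteq> 0" by (metis of_real_eq_0_iff)
  qed
  ultimately show ?thesis
    by (intro continuous_intros continuous_on_subset[OF assms(1)] continuous_on_subset[OF assms(2)]) auto
qed

text \<open>Off the origin 1 - phi^2 is positive, so the equation can be solved for the weak
  derivative; the result is continuous there, hence a classical derivative. The behaviour at the
  origin is carried by the memberships in \<open>H1_tilde\<close>. The function (1 - phi^2) v' of
  \<open>Dom_L\<close> differs from z by the term treated in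
  \<open>phi_phi'_mult_H1_tilde\<close>.\<close>

lemma Dom_L_iff_classical:
  "v \<in> Dom_L \<and> op_L v = z \<longleftrightarrow> v \<in> H1_tilde \<and> z \<in> H1_tilde \<and>
    (\<forall>x. x \<noteq> 0 \<longrightarrow> (v has_vector_derivative
        (z x - complex_of_real (phi x * phi' x) * v x) / complex_of_real (1 - (phi x)\<^sup>2)) (at x))"
  (is "?L \<longleftrightarrow> ?R")
proof
  assume L: ?L
  hence vH: "v \<in> H1_tilde" by (simp add: Dom_L_def)
  obtain w where w: "w \<in> H1_tilde" "AE x in lborel. w x = complex_of_real (1 - (phi x)\<^sup>2) * weak_deriv v x"
    using L by (auto simp: Dom_L_def)
  define z0 where "z0 x = w x + complex_of_real (phi x * phi' x) * v x" for x
  have z0: "z0 \<in> H1_tilde"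
    unfolding z0_def[abs_def] by (intro H1_tilde_add w phi_phi'_mult_H1_tilde vH)
  have "op_L v = z0"
    by (rule op_L_eqI[OF z0]) (use w(2) in eventually_elim, simp add: z0_def)
  hence z: "z = z0" using L by simp
  have ac: "has_ac_deriv v (weak_deriv v)" using vH weak_deriv_H1 by (auto simp: H1_tilde_def)
  let ?k = "\<lambda>x. (z x - complex_of_real (phi x * phi' x) * v x) / complex_of_real (1 - (phi x)\<^sup>2)"
  have "AE x in lborel. x \<in> - {0} \<longrightarrow> weak_deriv v x = ?k x"
    using w(2)
  proof eventually_elim
    case (elim x)
    have "x \<noteq> 0 \<Longrightarrow> complex_of_real (1 - (phi x)\<^sup>2) \<noteq> 0"
      using phi_less_1[of x] by (metis less_irrefl of_real_eq_0_iff)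
    thus ?case using elim by (simp add: z z0_def)
  qed
  moreover have "continuous_on (- {0}) ?k"
    unfolding z by (intro continuous_on_classical_deriv H1_tilde_continuous z0 vH)
  ultimately show ?R
    using vH z z0 has_ac_deriv_imp_classical[OF ac, of "- {0}" _ ?k] by blast
next
  assume R: ?R
  hence vH: "v \<in> H1_tilde" and zH: "z \<in> H1_tilde" by auto
  let ?k = "\<lambda>x. (z x - complex_of_real (phi x * phi' x) * v x) / complex_of_real (1 - (phi x)\<^sup>2)"
  have nz: "complex_of_real (1 - (phi x)\<^sup>2) \<noteq> 0" if "x \<noteq> 0" for x
    using phi_less_1[OF that] by (metis less_irrefl of_real_eq_0_iff)
  have ac: "has_ac_deriv v (weak_deriv v)" using vH weak_deriv_H1 by (auto simp: H1_tilde_def)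
  have cont: "continuous_on (- {0}) ?k"
    by (intro continuous_on_classical_deriv H1_tilde_continuous zH vH)
  have "AE x in lborel. x \<in> - {0} \<longrightarrow> weak_deriv v x = ?k x"
    by (rule has_ac_deriv_AE_classical[OF ac _ _ cont]) (use R in auto)
  hence eq: "AE x in lborel. z x - complex_of_real (phi x * phi' x) * v x = complex_of_real (1 - (phi x)\<^sup>2) * weak_deriv v x"
    using AE_lborel_singleton[of "0::real"] by eventually_elim (use nz in simp)
  have "op_L v = z"
    by (rule op_L_eqI[OF zH]) (use eq in eventually_elim, simp add: algebra_simps)
  moreover have "v \<in> Dom_L"
    unfolding Dom_L_def
    by (intro CollectI conjI vH bexI[where x = "\<lambda>x. z x - complex_of_real (phi x * phi' x) * v x"]
        H1_tilde_diff[OF zH phi_phi'_mult_H1_tilde[OF vH]] eq)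
  ultimately show ?L by simp
qed

subsection \<open>The evolution group\<close>

text \<open>The equation \<open>z = L v\<close> in the coordinates of \<open>to_dot\<close>, where it reads \<open>u = 2 y w' - w\<close>.\<close>

definition dot_gen :: "(real \<Rightarrow> complex) \<Rightarrow> (real \<Rightarrow> complex) \<Rightarrow> bool" where
  "dot_gen w u \<longleftrightarrow> (\<forall>y>0. (w has_vector_derivative (u y + w y) / complex_of_real (2 * y)) (at y))"

text \<open>Since 1 - e^(-2x) = y e^(-2x), the right side says y v' = e^(2x) z + v. Inserted into w'
  = (v + v') / (2 e^x) this gives w' = e^x (z + v) / (2 y). The two directions differentiate the
  change of variables and its inverse.\<close>

lemma dot_gen_to_dot_iff:
  "dot_gen (to_dot v) (to_dot z) \<longleftrightarrow>
    (\<forall>x>0. (v has_vector_derivative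
       (z x + complex_of_real (exp (- 2 * x)) * v x) / complex_of_real (1 - exp (- 2 * x))) (at x))"
  (is "?L \<longleftrightarrow> (\<forall>x>0. (v has_vector_derivative ?V x) (at x))")
proof (intro iffI allI impI)
  assume R: "\<forall>x>0. (v has_vector_derivative ?V x) (at x)"
  show ?L
    unfolding dot_gen_def
  proof (intro allI impI)
    fix y :: real assume y: "y > 0"
    define x where "x = ln (1 + y) / 2"
    define s where "s = sqrt (1 + y)"
    have x: "x > 0" using y by (simp add: x_def)
    have s: "s > 0" "s * s = 1 + y" "exp (- 2 * x) = 1 / (s * s)"
      using y by (simp_all add: s_def x_def exp_minus inverse_eq_divide)
    have "((\<lambda>y. ln (1 + y) / 2) has_real_derivative 1 / (2 * (1 + y))) (at y)"
      using y by (auto intro!: derivative_eq_intros simp: field_simps)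
    hence 1: "((\<lambda>y. ln (1 + y) / 2) has_vector_derivative 1 / (2 * (1 + y))) (at y)"
      by (simp add: has_real_derivative_iff_has_vector_derivative)
    have lnx: "ln (1 + y) / 2 = x" by (simp add: x_def)
    have "(v has_vector_derivative ?V x) (at (ln (1 + y) / 2))" unfolding lnx using R x by blast
    from vector_diff_chain_at[OF 1 this]
    have 2: "((\<lambda>y. v (ln (1 + y) / 2)) has_vector_derivative (1 / (2 * (1 + y))) *\<^sub>R ?V x) (at y)"
      by (simp add: o_def)
    have "((\<lambda>y. sqrt (1 + y)) has_real_derivative 1 / (2 * s)) (at y)"
      using y by (auto intro!: derivative_eq_intros simp: s_def field_simps)
    hence 3: "((\<lambda>y. complex_of_real (sqrt (1 + y))) has_vector_derivative complex_of_real (1 / (2 * s))) (at y)"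
      by (rule has_vector_derivative_of_real)
    have V: "?V x = (complex_of_real (s * s) * z x + v x) / complex_of_real y"
    proof -
      have eq: "1 - 1 / (s * s) = y / (s * s)" unfolding s(2) using y by (simp add: field_simps)
      show ?thesis unfolding s(3) eq using s(1) y by (simp add: divide_simps)
    qed
    have "((\<lambda>y. complex_of_real (sqrt (1 + y)) * v (ln (1 + y) / 2)) has_vector_derivative
       complex_of_real s * ((1 / (2 * (1 + y))) *\<^sub>R ?V x) + complex_of_real (1 / (2 * s)) * v x) (at y)"
      using has_vector_derivative_mult[OF 3 2] by (simp add: s_def x_def)
    also have "complex_of_real s * ((1 / (2 * (1 + y))) *\<^sub>R ?V x) + complex_of_real (1 / (2 * s)) * v x
       = (to_dot z y + to_dot v y) / complex_of_real (2 * y)"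
    proof -
      have S: "complex_of_real s \<noteq> 0" "complex_of_real y \<noteq> 0" using s(1) y by simp_all
      have yy: "complex_of_real y = complex_of_real s * complex_of_real s - 1" using s(2) by (simp flip: of_real_mult)
      have z: "to_dot z y = complex_of_real s * z x" "to_dot v y = complex_of_real s * v x"
        using y by (simp_all add: to_dot_def s_def x_def)
      show ?thesis
        unfolding V z s(2)[symmetric] scaleR_conv_of_real using S
        by (simp add: divide_simps) (simp add: yy algebra_simps)
    qed
    finally have "((\<lambda>y. complex_of_real (sqrt (1 + y)) * v (ln (1 + y) / 2)) has_vector_derivative
        (to_dot z y + to_dot v y) / complex_of_real (2 * y)) (at y)" .
    thus "(to_dot v has_vector_derivative (to_dot z y + to_dot v y) / complex_of_real (2 * y)) (at y)"
      by (rule has_vector_derivative_transform_within_open[of _ _ _ "{0<..}"]) (use y in \<open>auto simp: to_dot_def\<close>)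
  qed
next
  fix x :: real
  assume L: ?L and x: "x > 0"
  define e where "e = exp x"
  define y where "y = exp (2 * x) - 1"
  have e: "e > 0" "exp (2 * x) = e * e" "exp (- x) = 1 / e" "exp (- 2 * x) = 1 / (e * e)"
    by (simp_all add: e_def exp_minus exp_double power2_eq_square inverse_eq_divide)
  have y: "y > 0" using x by (simp add: y_def)
  have y2: "e * e = 1 + y" using e(2) by (simp add: y_def)
  have "((\<lambda>x. exp (2 * x) - 1) has_real_derivative 2 * exp (2 * x)) (at x)"
    by (auto intro!: derivative_eq_intros)
  hence 1: "((\<lambda>x. exp (2 * x) - 1) has_vector_derivative 2 * exp (2 * x)) (at x)"
    by (simp add: has_real_derivative_iff_has_vector_derivative)
  have "(to_dot v has_vector_derivative (to_dot z y + to_dot v y) / complex_of_real (2 * y)) (at (exp (2 * x) - 1))"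
    unfolding y_def[symmetric] using L y unfolding dot_gen_def by blast
  from vector_diff_chain_at[OF 1 this]
  have 2: "((\<lambda>x. to_dot v (exp (2 * x) - 1)) has_vector_derivative
     (2 * exp (2 * x)) *\<^sub>R ((to_dot z y + to_dot v y) / complex_of_real (2 * y))) (at x)"
    by (simp add: o_def)
  have "((\<lambda>x. exp (- x)) has_real_derivative - exp (- x)) (at x)"
    by (auto intro!: derivative_eq_intros)
  hence 3: "((\<lambda>x. complex_of_real (exp (- x))) has_vector_derivative complex_of_real (- exp (- x))) (at x)"
    by (rule has_vector_derivative_of_real)
  have "((\<lambda>x. complex_of_real (exp (- x)) * to_dot v (exp (2 * x) - 1)) has_vector_derivative
     complex_of_real (exp (- x)) * ((2 * exp (2 * x)) *\<^sub>R ((to_dot z y + to_dot v y) / complex_of_real (2 * y)))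
      + complex_of_real (- exp (- x)) * to_dot v y) (at x)"
    using has_vector_derivative_mult[OF 3 2] by (simp add: y_def)
  also have "complex_of_real (exp (- x)) * ((2 * exp (2 * x)) *\<^sub>R ((to_dot z y + to_dot v y) / complex_of_real (2 * y)))
      + complex_of_real (- exp (- x)) * to_dot v y = ?V x"
  proof -
    have "sqrt (e * e) = e" using e(1) by simp
    moreover have "ln (e * e) = 2 * x" by (simp flip: e(2))
    ultimately have td: "to_dot z y = complex_of_real e * z x" "to_dot v y = complex_of_real e * v x"
      using y by (simp_all add: to_dot_def flip: y2)
    have S: "complex_of_real e \<noteq> 0" "complex_of_real y \<noteq> 0" using e(1) y by simp_all
    have eq: "1 - 1 / (e * e) = y / (e * e)" unfolding y2 using y by (simp add: field_simps)
    have V: "?V x = (complex_of_real (e * e) * z x + v x) / complex_of_real y"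
      unfolding e(4) eq using e(1) y by (simp add: divide_simps)
    have yy: "complex_of_real y = complex_of_real e * complex_of_real e - 1" using y2 by (simp flip: of_real_mult)
    show ?thesis
      unfolding V td e(2,3) scaleR_conv_of_real using S
      by (simp add: divide_simps) (simp add: yy algebra_simps)
  qed
  finally have "((\<lambda>x. complex_of_real (exp (- x)) * to_dot v (exp (2 * x) - 1)) has_vector_derivative ?V x) (at x)" .
  thus "(v has_vector_derivative ?V x) (at x)"
  proof (rule has_vector_derivative_transform_within_open[of _ _ _ "{0<..}"])
    fix t :: real assume "t \<in> {0<..}"
    thus "complex_of_real (exp (- t)) * to_dot v (exp (2 * t) - 1) = v t"
      using of_dot_to_dot[of t v] by (simp add: of_dot_def)
  qed (use x in auto)
qed

lemma has_vector_derivative_mirror: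
  assumes "(v has_vector_derivative D) (at (- x))"
  shows "((\<lambda>x. v (- x)) has_vector_derivative - D) (at (x::real))"
proof -
  have "(uminus has_vector_derivative (-1)) (at x)"
    by (auto intro!: derivative_eq_intros simp flip: has_real_derivative_iff_has_vector_derivative)
  from vector_diff_chain_at[OF this assms] show ?thesis by (simp add: o_def)
qed

text \<open>Reflection changes the sign of the derivative and of the odd factor
  \<open>phi * phi'\<close>, so it conjugates L into -L; hence the minus sign at the reflected
  \<open>z\<close>.\<close>

lemma Dom_L_iff_dot:
  "v \<in> Dom_L \<and> op_L v = z \<longleftrightarrow> v \<in> H1_tilde \<and> z \<in> H1_tilde \<and> dot_gen (to_dot v) (to_dot z) \<and>
     dot_gen (to_dot (\<lambda>x. v (- x))) (to_dot (\<lambda>x. - z (- x)))"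
proof -
  let ?D = "\<lambda>x. (z x - complex_of_real (phi x * phi' x) * v x) / complex_of_real (1 - (phi x)\<^sup>2)"
  have p: "(phi x)\<^sup>2 = exp (- 2 * \<bar>x\<bar>)" "phi x * phi' x = - sgn x * exp (- 2 * \<bar>x\<bar>)" for x
    by (simp_all add: phi_def phi'_def power2_eq_square mult_exp_exp)
  have 1: "?D x = (z x + complex_of_real (exp (- 2 * x)) * v x) / complex_of_real (1 - exp (- 2 * x))" if "x > 0" for x
    unfolding p using that by simp
  have 2: "?D (- x) = - ((- z (- x) + complex_of_real (exp (- 2 * x)) * v (- x)) / complex_of_real (1 - exp (- 2 * x)))" if "x > 0" for x
    unfolding p using that by (simp add: minus_divide_left)
  have "(\<forall>x. x \<noteq> 0 \<longrightarrow> (v has_vector_derivative ?D x) (at x)) \<longleftrightarrow>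
    (\<forall>x>0. (v has_vector_derivative (z x + complex_of_real (exp (- 2 * x)) * v x) / complex_of_real (1 - exp (- 2 * x))) (at x)) \<and>
    (\<forall>x>0. ((\<lambda>x. v (- x)) has_vector_derivative (- z (- x) + complex_of_real (exp (- 2 * x)) * v (- x)) / complex_of_real (1 - exp (- 2 * x))) (at x))"
    (is "?A \<longleftrightarrow> ?B \<and> ?C")
  proof (intro iffI conjI allI impI)
    fix x :: real assume A: ?A and x: "x > 0"
    show "(v has_vector_derivative (z x + complex_of_real (exp (- 2 * x)) * v x) / complex_of_real (1 - exp (- 2 * x))) (at x)"
      using A x unfolding 1[OF x, symmetric] by simp
    have "(v has_vector_derivative ?D (- x)) (at (- x))" using A x by simp
    from has_vector_derivative_mirror[OF this[unfolded 2[OF x]]]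
    show "((\<lambda>x. v (- x)) has_vector_derivative (- z (- x) + complex_of_real (exp (- 2 * x)) * v (- x)) / complex_of_real (1 - exp (- 2 * x))) (at x)"
      by simp
  next
    fix x :: real assume BC: "?B \<and> ?C" and x: "x \<noteq> 0"
    show "(v has_vector_derivative ?D x) (at x)"
    proof (cases "x > 0")
      case True
      thus ?thesis unfolding 1[OF True] using BC by blast
    next
      case False
      hence x': "- x > 0" using x by simp
      have "((\<lambda>x. v (- x)) has_vector_derivative (- z (- (- x)) + complex_of_real (exp (- 2 * (- x))) * v (- (- x))) / complex_of_real (1 - exp (- 2 * (- x)))) (at (- x))"
        using BC x' by blast
      from has_vector_derivative_mirror[OF this] 2[OF x']
      show ?thesis by simp
    qed
  qed
  thus ?thesis unfolding Dom_L_iff_classical dot_gen_to_dot_iff by blast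
qed

text \<open>The operator 2 y d/dy is invariant under dilations of y.\<close>

lemma dot_gen_scale:
  assumes "dot_gen w u"
  shows "dot_gen (scale t w) (scale t u)"
  unfolding dot_gen_def
proof (intro allI impI)
  fix y :: real assume y: "y > 0"
  have "((\<lambda>y. exp (2 * t) * y) has_real_derivative exp (2 * t)) (at y)"
    by (auto intro!: derivative_eq_intros)
  hence 1: "((\<lambda>y. exp (2 * t) * y) has_vector_derivative exp (2 * t)) (at y)"
    by (simp add: has_real_derivative_iff_has_vector_derivative)
  have 2: "(w has_vector_derivative (u (exp (2 * t) * y) + w (exp (2 * t) * y)) / complex_of_real (2 * (exp (2 * t) * y))) (at (exp (2 * t) * y))"
    using assms[unfolded dot_gen_def, rule_format, of "exp (2 * t) * y"] y by simp
  have "((\<lambda>y. complex_of_real (exp (- t)) * (w \<circ> (\<lambda>y. exp (2 * t) * y)) y) has_vector_derivative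
    complex_of_real (exp (- t)) * (exp (2 * t) *\<^sub>R ((u (exp (2 * t) * y) + w (exp (2 * t) * y)) / complex_of_real (2 * (exp (2 * t) * y))))) (at y)"
    by (rule has_vector_derivative_mult_right[OF vector_diff_chain_at[OF 1 2]])
  also have "complex_of_real (exp (- t)) * (exp (2 * t) *\<^sub>R ((u (exp (2 * t) * y) + w (exp (2 * t) * y)) / complex_of_real (2 * (exp (2 * t) * y))))
     = (scale t u y + scale t w y) / complex_of_real (2 * y)"
    unfolding scale_def scaleR_conv_of_real of_real_mult using y by (simp add: divide_simps) (simp add: algebra_simps)
  finally show "(scale t w has_vector_derivative (scale t u y + scale t w y) / complex_of_real (2 * y)) (at y)"
    by (simp add: o_def scale_def[abs_def])
qed

text \<open>Exchanges the derivative, known only up to null sets, for the pointwise formula that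
  \<open>half_dot_quotient_tendsto\<close> takes as hypothesis.\<close>

lemma half_dot_classical:
  assumes w: "half_dot w h" and u: "half_dot u k" and g: "dot_gen w u"
  shows "half_dot w (\<lambda>y. if y > 0 then (u y + w y) / complex_of_real (2 * y) else 0)" (is "half_dot w ?h")
proof -
  have ac: "has_ac_deriv w h" "has_ac_deriv u k" and L: "h \<in> L2" and z: "\<And>y. y \<le> 0 \<Longrightarrow> w y = 0 \<and> h y = 0"
    using w u by (auto simp: half_dot_def)
  note [measurable] = has_ac_deriv_measurable[OF ac(1)] has_ac_deriv_measurable[OF ac(2)]
  have m: "?h \<in> borel_measurable borel" by measurable
  have "continuous_on {0<..} (\<lambda>y. (u y + w y) / complex_of_real (2 * y))"
    by (intro continuous_intros continuous_on_subset[OF has_ac_deriv_continuous[OF ac(1)]]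
        continuous_on_subset[OF has_ac_deriv_continuous[OF ac(2)]]) auto
  hence "AE y in lborel. y \<in> {0<..} \<longrightarrow> h y = (u y + w y) / complex_of_real (2 * y)"
    using g by (intro has_ac_deriv_AE_classical[OF ac(1)]) (auto simp: dot_gen_def)
  hence AE: "AE y in lborel. h y = ?h y"
    by eventually_elim (use z in auto)
  show ?thesis
    unfolding half_dot_def
    using has_ac_deriv_cong_AE[OF ac(1) m AE] L2_cong_AE[OF L m AE] z by simp
qed

section \<open>The group and its generator\<close>

text \<open>Written through \<open>to_dot\<close> for arbitrary \<open>v\<close>, so that linearity
  holds without membership hypotheses.\<close>

definition evol :: "real \<Rightarrow> (real \<Rightarrow> complex) \<Rightarrow> real \<Rightarrow> complex" where
  "evol t v x = of_dot (scale t (to_dot v)) x + of_dot (scale (- t) (to_dot (\<lambda>x. v (- x)))) (- x)"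

lemma two_sided_evol:
  assumes "two_sided v w1 h1 w2 h2"
  shows "two_sided (evol t v) (scale t w1) (dil t h1) (scale (- t) w2) (dil (- t) h2)"
proof -
  have "evol t v = (\<lambda>x. of_dot (scale t w1) x + of_dot (scale (- t) w2) (- x))"
    by (simp add: evol_def[abs_def] two_sided_H1_tilde(3,4)[OF assms])
  thus ?thesis using assms half_dot_scale unfolding two_sided_def by blast
qed

lemma evol_H1_tilde:
  assumes "v \<in> H1_tilde"
  shows "evol t v \<in> H1_tilde" "H1_norm (evol t v) = H1_norm v"
    "to_dot (evol t v) = scale t (to_dot v)"
    "to_dot (\<lambda>x. evol t v (- x)) = scale (- t) (to_dot (\<lambda>x. v (- x)))"
proof -
  obtain h1 h2 where h: "two_sided v (to_dot v) h1 (to_dot (\<lambda>x. v (- x))) h2"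
    using two_sided_exists[OF assms] .
  note e = two_sided_H1_tilde[OF two_sided_evol[OF h, of t]]
  show "evol t v \<in> H1_tilde" "to_dot (evol t v) = scale t (to_dot v)"
    "to_dot (\<lambda>x. evol t v (- x)) = scale (- t) (to_dot (\<lambda>x. v (- x)))" by (rule e)+
  have "h1 \<in> L2" "h2 \<in> L2" using h by (auto simp: two_sided_def half_dot_def)
  thus "H1_norm (evol t v) = H1_norm v"
    unfolding e(2) two_sided_H1_tilde(2)[OF h] by (simp add: dil_L2)
qed

lemma evol_0:
  assumes "v \<in> H1_tilde" shows "evol 0 v = v"
proof -
  obtain h1 h2 where h: "two_sided v (to_dot v) h1 (to_dot (\<lambda>x. v (- x))) h2"
    using two_sided_exists[OF assms] .
  hence "v = (\<lambda>x. of_dot (to_dot v) x + of_dot (to_dot (\<lambda>x. v (- x))) (- x))"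
    unfolding two_sided_def by blast
  thus ?thesis by (simp add: evol_def[abs_def])
qed

lemma evol_evol:
  assumes "v \<in> H1_tilde" shows "evol s (evol t v) = evol (s + t) v"
  by (simp add: evol_def[of s] evol_def[of "s + t"] evol_H1_tilde[OF assms] scale_scale fun_eq_iff)

lemma evol_diff: "evol t (\<lambda>x. u x - v x) = (\<lambda>x. evol t u x - evol t v x)"
  by (simp add: evol_def of_dot_def scale_def to_dot_def fun_eq_iff algebra_simps)

lemma evol_cmult: "evol t (\<lambda>x. c * v x) = (\<lambda>x. c * evol t v x)"
  by (simp add: evol_def of_dot_def scale_def to_dot_def fun_eq_iff algebra_simps)

lemma to_dot_minus: "to_dot (\<lambda>x. - v x) = (\<lambda>y. - to_dot v y)"
  by (auto simp: to_dot_def)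

lemma scale_minus: "scale t (\<lambda>y. - w y) = (\<lambda>y. - scale t w y)"
  by (simp add: scale_def fun_eq_iff)

text \<open>\<open>Dom_L_iff_dot\<close> captures membership and the value of \<open>op_L\<close> at
  once, so invariance of the two relations under scaling yields both claims.\<close>

lemma evol_Dom_L:
  assumes "v \<in> Dom_L"
  shows "evol t v \<in> Dom_L" "op_L (evol t v) = evol t (op_L v)"
proof -
  have v: "v \<in> H1_tilde" "op_L v \<in> H1_tilde" "dot_gen (to_dot v) (to_dot (op_L v))"
    "dot_gen (to_dot (\<lambda>x. v (- x))) (to_dot (\<lambda>x. - op_L v (- x)))"
    using assms Dom_L_iff_dot[of v "op_L v"] by auto
  have "evol t v \<in> Dom_L \<and> op_L (evol t v) = evol t (op_L v)"
    unfolding Dom_L_iff_dot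
    using evol_H1_tilde[OF v(1), of t] evol_H1_tilde[OF v(2), of t] dot_gen_scale[OF v(3), of t] dot_gen_scale[OF v(4), of "- t"]
    by (simp add: to_dot_minus scale_minus)
  thus "evol t v \<in> Dom_L" "op_L (evol t v) = evol t (op_L v)" by auto
qed

text \<open>\<open>op_L\<close> is a definite description over a chosen \<open>weak_deriv\<close>;
  in the classical form its linearity is that of derivatives.\<close>

lemma op_L_diff:
  assumes "u \<in> Dom_L" "v \<in> Dom_L"
  shows "op_L (\<lambda>x. u x - v x) = (\<lambda>x. op_L u x - op_L v x)"
proof -
  have u: "u \<in> H1_tilde \<and> op_L u \<in> H1_tilde \<and> (\<forall>x. x \<noteq> 0 \<longrightarrow> (u has_vector_derivative
        (op_L u x - complex_of_real (phi x * phi' x) * u x) / complex_of_real (1 - (phi x)\<^sup>2)) (at x))"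
    using assms(1) Dom_L_iff_classical[of u "op_L u"] by blast
  have v: "v \<in> H1_tilde \<and> op_L v \<in> H1_tilde \<and> (\<forall>x. x \<noteq> 0 \<longrightarrow> (v has_vector_derivative
        (op_L v x - complex_of_real (phi x * phi' x) * v x) / complex_of_real (1 - (phi x)\<^sup>2)) (at x))"
    using assms(2) Dom_L_iff_classical[of v "op_L v"] by blast
  have "((\<lambda>x. u x - v x) has_vector_derivative
      (op_L u x - op_L v x - complex_of_real (phi x * phi' x) * (u x - v x)) / complex_of_real (1 - (phi x)\<^sup>2)) (at x)" if "x \<noteq> 0" for x
  proof -
    have "(op_L u x - op_L v x - complex_of_real (phi x * phi' x) * (u x - v x)) / complex_of_real (1 - (phi x)\<^sup>2)
      = (op_L u x - complex_of_real (phi x * phi' x) * u x) / complex_of_real (1 - (phi x)\<^sup>2)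
       - (op_L v x - complex_of_real (phi x * phi' x) * v x) / complex_of_real (1 - (phi x)\<^sup>2)"
      unfolding diff_divide_distrib[symmetric] by (simp add: algebra_simps)
    thus ?thesis
      using has_vector_derivative_diff[OF u[THEN conjunct2, THEN conjunct2, rule_format, OF that]
          v[THEN conjunct2, THEN conjunct2, rule_format, OF that]] by (simp only:)
  qed
  hence "(\<lambda>x. u x - v x) \<in> Dom_L \<and> op_L (\<lambda>x. u x - v x) = (\<lambda>x. op_L u x - op_L v x)"
    unfolding Dom_L_iff_classical using u v H1_tilde_diff by blast
  thus ?thesis by blast
qed

lemma evol_tendsto_0:
  assumes "v \<in> H1_tilde"
  shows "((\<lambda>t. H1_norm (\<lambda>x. evol t v x - v x)) \<longlongrightarrow> 0) (at 0)"
proof -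
  obtain h1 h2 where h: "two_sided v (to_dot v) h1 (to_dot (\<lambda>x. v (- x))) h2"
    using two_sided_exists[OF assms] .
  have L: "h1 \<in> L2" "h2 \<in> L2" using h by (auto simp: two_sided_def half_dot_def)
  have eq: "H1_norm (\<lambda>x. evol t v x - v x) = sqrt (2 * sqn (\<lambda>y. dil t h1 y - h1 y) + 2 * sqn (\<lambda>y. dil (- t) h2 y - h2 y))" for t
    by (rule two_sided_H1_tilde(2)[OF two_sided_diff[OF two_sided_evol[OF h] h]])
  \<comment> \<open>The left half runs with time \<open>- t\<close>.\<close>
  have neg: "filterlim uminus (at 0) (at (0::real))"
    by (auto simp: filterlim_at eventually_at_filter intro!: tendsto_eq_intros)
  have "((\<lambda>t. sqrt (2 * sqn (\<lambda>y. dil t h1 y - h1 y) + 2 * sqn (\<lambda>y. dil (- t) h2 y - h2 y))) \<longlongrightarrow> sqrt (2 * 0 + 2 * 0)) (at 0)"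
    by (intro tendsto_intros dil_tendsto L filterlim_compose[OF dil_tendsto[OF L(2)] neg])
  thus ?thesis unfolding eq by simp
qed

lemma evol_quotient_tendsto_0:
  assumes v: "v \<in> Dom_L"
  shows "((\<lambda>t. H1_norm (\<lambda>x. (evol t v x - v x) / complex_of_real t - op_L v x)) \<longlongrightarrow> 0) (at 0)"
proof -
  let ?z = "op_L v" and ?w1 = "to_dot v" and ?w2 = "to_dot (\<lambda>x. v (- x))"
    and ?z1 = "to_dot (op_L v)" and ?z2 = "to_dot (\<lambda>x. op_L v (- x))"
  have D: "v \<in> H1_tilde" "?z \<in> H1_tilde" "dot_gen ?w1 ?z1" "dot_gen ?w2 (\<lambda>y. - ?z2 y)"
    using v Dom_L_iff_dot[of v ?z] by (auto simp: to_dot_minus)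
  obtain h1 h2 where h: "two_sided v ?w1 h1 ?w2 h2" using two_sided_exists[OF D(1)] .
  obtain k1 k2 where k: "two_sided ?z ?z1 k1 ?z2 k2" using two_sided_exists[OF D(2)] .
  have kd: "half_dot ?z1 k1" "half_dot (\<lambda>y. - ?z2 y) (\<lambda>y. - k2 y)"
    using k half_dot_cmult[of ?z2 k2 "-1"] by (auto simp: two_sided_def)
  \<comment> \<open>Pointwise derivatives that replace \<open>h1\<close> and \<open>h2\<close>; in
    \<open>H2\<close> the reflected generator value enters with its minus sign.\<close>
  define H1 where "H1 y = (if y > 0 then (?z1 y + ?w1 y) / complex_of_real (2 * y) else 0)" for y
  define H2 where "H2 y = (if y > 0 then (- ?z2 y + ?w2 y) / complex_of_real (2 * y) else 0)" for y
  have Hd: "half_dot ?w1 H1" "half_dot ?w2 H2"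
    unfolding H1_def[abs_def] H2_def[abs_def]
    using h half_dot_classical[OF _ kd(1) D(3)] half_dot_classical[OF _ kd(2) D(4)] by (auto simp: two_sided_def)
  have H: "two_sided v ?w1 H1 ?w2 H2" using h Hd by (simp add: two_sided_def)
  \<comment> \<open>On the left the time is \<open>- t\<close> and the generator value has
    derivative \<open>- k2\<close>. Flipping both signs leaves the norm unchanged and gives the
    second term the shape of a forward quotient composed with negation.\<close>
  have eq: "H1_norm (\<lambda>x. (evol t v x - v x) / complex_of_real t - ?z x)
     = sqrt (2 * sqn (\<lambda>y. (dil t H1 y - H1 y) / complex_of_real t - k1 y)
             + 2 * sqn (\<lambda>y. (dil (- t) H2 y - H2 y) / complex_of_real (- t) - - k2 y))" for t
  proof -
    have "H1_norm (\<lambda>x. inverse (complex_of_real t) * (evol t v x - v x) - ?z x)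
     = sqrt (2 * sqn (\<lambda>y. inverse (complex_of_real t) * (dil t H1 y - H1 y) - k1 y)
             + 2 * sqn (\<lambda>y. inverse (complex_of_real t) * (dil (- t) H2 y - H2 y) - k2 y))"
      by (rule two_sided_H1_tilde(2)[OF two_sided_diff[OF two_sided_cmult[OF two_sided_diff[OF two_sided_evol[OF H] H]] k]])
    moreover have "sqn (\<lambda>y. (dil (- t) H2 y - H2 y) / complex_of_real (- t) - - k2 y)
        = sqn (\<lambda>y. inverse (complex_of_real t) * (dil (- t) H2 y - H2 y) - k2 y)"
      by (subst sqn_minus[symmetric]) (simp add: divide_inverse mult.commute)
    ultimately show ?thesis by (simp add: divide_inverse mult.commute)
  qed
  have neg: "filterlim uminus (at 0) (at (0::real))"
    by (auto simp: filterlim_at eventually_at_filter intro!: tendsto_eq_intros)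
  have q1: "((\<lambda>t. sqn (\<lambda>y. (dil t H1 y - H1 y) / complex_of_real t - k1 y)) \<longlongrightarrow> 0) (at 0)"
    by (rule half_dot_quotient_tendsto[OF Hd(1) kd(1)]) (simp add: H1_def)
  have q2: "((\<lambda>t. sqn (\<lambda>y. (dil t H2 y - H2 y) / complex_of_real t - - k2 y)) \<longlongrightarrow> 0) (at 0)"
    by (rule half_dot_quotient_tendsto[OF Hd(2) kd(2)]) (simp add: H2_def)
  have "((\<lambda>t. sqrt (2 * sqn (\<lambda>y. (dil t H1 y - H1 y) / complex_of_real t - k1 y)
             + 2 * sqn (\<lambda>y. (dil (- t) H2 y - H2 y) / complex_of_real (- t) - - k2 y))) \<longlongrightarrow> sqrt (2 * 0 + 2 * 0)) (at 0)"
    by (intro tendsto_intros q1 filterlim_compose[OF q2 neg])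
  thus ?thesis unfolding eq by simp
qed

subsection \<open>Existence and uniqueness\<close>

text \<open>Young's inequality for the cross term; the defect is the square (r |a| - |b|)^2 /
  r.\<close>

lemma cmod_add_square_weighted:
  assumes "r > 0"
  shows "(cmod (a + b))\<^sup>2 \<le> (1 + r) * (cmod a)\<^sup>2 + (1 + 1 / r) * (cmod b)\<^sup>2"
proof -
  have "(cmod (a + b))\<^sup>2 \<le> (cmod a + cmod b)\<^sup>2" by (intro power_mono norm_triangle_ineq) simp
  also have "\<dots> = (1 + r) * (cmod a)\<^sup>2 + (1 + 1 / r) * (cmod b)\<^sup>2 - (r * cmod a - cmod b)\<^sup>2 / r"
    using assms by (simp add: power2_eq_square field_simps)
  also have "\<dots> \<le> (1 + r) * (cmod a)\<^sup>2 + (1 + 1 / r) * (cmod b)\<^sup>2"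
    using assms by simp
  finally show ?thesis .
qed

lemma sqn_add_weighted:
  assumes "f \<in> L2" "g \<in> L2" "r > 0"
  shows "sqn (\<lambda>x. f x + g x) \<le> (1 + r) * sqn f + (1 + 1 / r) * sqn g"
proof -
  note I = L2_D(2)[OF assms(1)] L2_D(2)[OF assms(2)] L2_D(2)[OF L2_add[OF assms(1,2)]]
  have "sqn (\<lambda>x. f x + g x) \<le> (LINT x|lborel. (1 + r) * (cmod (f x))\<^sup>2 + (1 + 1 / r) * (cmod (g x))\<^sup>2)"
    unfolding sqn_def using I cmod_add_square_weighted[OF assms(3)] by (intro integral_mono) auto
  thus ?thesis using I by (simp add: sqn_def)
qed

lemma H1_norm_nonneg: "H1_norm v \<ge> 0"
  by (simp add: H1_norm_def)

lemma H1_norm_square: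
  assumes "has_ac_deriv v g" "v \<in> L2" "g \<in> L2"
  shows "(H1_norm v)\<^sup>2 = sqn v + sqn g"
proof -
  have "v \<in> H1" using assms by (auto simp: H1_iff)
  thus ?thesis using H1_norm_eq[OF _ assms(1)] by simp
qed

text \<open>Optimizing the weight in \<open>sqn_add_weighted\<close>, ideally r = B / A, gives the
  sharp constant without an inner product. The reverse triangle inequality below rests on that
  constant.\<close>

lemma H1_norm_triangle:
  assumes u: "u \<in> H1_tilde" and v: "v \<in> H1_tilde"
  shows "H1_norm (\<lambda>x. u x + v x) \<le> H1_norm u + H1_norm v"
proof -
  obtain g where g: "has_ac_deriv u g" "u \<in> L2" "g \<in> L2" using u by (rule H1_tildeE)
  obtain k where k: "has_ac_deriv v k" "v \<in> L2" "k \<in> L2" using v by (rule H1_tildeE)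
  define A B where "A = H1_norm u" and "B = H1_norm v"
  have AB: "A \<ge> 0" "B \<ge> 0" by (simp_all add: A_def B_def H1_norm_nonneg)
  define Q where "Q = (H1_norm (\<lambda>x. u x + v x))\<^sup>2"
  have le: "Q \<le> (1 + r) * A\<^sup>2 + (1 + 1 / r) * B\<^sup>2" if "r > 0" for r
  proof -
    have "Q = sqn (\<lambda>x. u x + v x) + sqn (\<lambda>x. g x + k x)"
      unfolding Q_def by (rule H1_norm_square) (intro has_ac_deriv_add L2_add g k)+
    also have "\<dots> \<le> ((1 + r) * sqn u + (1 + 1 / r) * sqn v) + ((1 + r) * sqn g + (1 + 1 / r) * sqn k)"
      by (intro add_mono sqn_add_weighted g k that)
    also have "\<dots> = (1 + r) * A\<^sup>2 + (1 + 1 / r) * B\<^sup>2"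
      unfolding A_def B_def H1_norm_square[OF g] H1_norm_square[OF k] by (simp add: algebra_simps)
    finally show ?thesis .
  qed
  \<comment> \<open>\<open>A\<close> and \<open>B\<close> may vanish, so the weight is r = (B + e) /
    (A + e), and \<open>e\<close> is sent to 0 afterwards.\<close>
  have e: "Q \<le> (A + B)\<^sup>2 + e * (A + B)" if e: "e > 0" for e
  proof -
    have p: "A + e > 0" "B + e > 0" using AB e by simp_all
    have "A\<^sup>2 * ((B + e) / (A + e)) \<le> A * (B + e)"
      using mult_left_mono[of "A / (A + e)" 1 "A * (B + e)"] AB p e by (simp add: power2_eq_square mult_ac)
    moreover have "B\<^sup>2 * ((A + e) / (B + e)) \<le> B * (A + e)"
      using mult_left_mono[of "B / (B + e)" 1 "B * (A + e)"] AB p e by (simp add: power2_eq_square mult_ac)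
    moreover have "Q \<le> A\<^sup>2 + A\<^sup>2 * ((B + e) / (A + e)) + (B\<^sup>2 + B\<^sup>2 * ((A + e) / (B + e)))"
      using le[of "(B + e) / (A + e)"] p by (simp add: algebra_simps)
    ultimately show ?thesis by (simp add: power2_eq_square algebra_simps)
  qed
  have "Q \<le> (A + B)\<^sup>2"
  proof (rule field_le_epsilon)
    fix d :: real assume d: "d > 0"
    have "Q \<le> (A + B)\<^sup>2 + d / (A + B + 1) * (A + B)" using d AB by (intro e) simp
    also have "d / (A + B + 1) * (A + B) \<le> d"
      using d AB by (simp add: divide_le_eq mult_left_mono)
    finally show "Q \<le> (A + B)\<^sup>2 + d" by simp
  qed
  thus ?thesis unfolding Q_def A_def B_def
    by (rule power2_le_imp_le) (intro add_nonneg_nonneg H1_norm_nonneg)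
qed

lemma H1_norm_cmult:
  assumes "v \<in> H1_tilde"
  shows "H1_norm (\<lambda>x. c * v x) = cmod c * H1_norm v"
proof -
  obtain g where g: "has_ac_deriv v g" "v \<in> L2" "g \<in> L2" using assms by (rule H1_tildeE)
  have "(H1_norm (\<lambda>x. c * v x))\<^sup>2 = (cmod c * H1_norm v)\<^sup>2"
    unfolding H1_norm_square[OF has_ac_deriv_cmult[OF g(1)] L2_cmult[OF g(2)] L2_cmult[OF g(3)]]
      power_mult_distrib H1_norm_square[OF g] sqn_cmult by (simp add: algebra_simps)
  thus ?thesis by (simp add: power2_eq_iff_nonneg H1_norm_nonneg)
qed

lemma H1_norm_diff_le:
  assumes "u \<in> H1_tilde" "v \<in> H1_tilde"
  shows "H1_norm (\<lambda>x. u x - v x) \<le> H1_norm u + H1_norm v"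
  using H1_norm_triangle[OF assms(1) H1_tilde_cmult[OF assms(2), of "-1"]] H1_norm_cmult[OF assms(2), of "-1"] by simp

lemma H1_norm_reverse_triangle:
  assumes "u \<in> H1_tilde" "v \<in> H1_tilde"
  shows "\<bar>H1_norm u - H1_norm v\<bar> \<le> H1_norm (\<lambda>x. u x - v x)"
proof -
  have "H1_norm (\<lambda>x. (u x - v x) + v x) \<le> H1_norm (\<lambda>x. u x - v x) + H1_norm v"
    by (intro H1_norm_triangle H1_tilde_diff assms)
  moreover have "H1_norm (\<lambda>x. u x - (u x - v x)) \<le> H1_norm u + H1_norm (\<lambda>x. u x - v x)"
    by (intro H1_norm_diff_le H1_tilde_diff assms)
  ultimately show ?thesis by simp
qed

lemma H1_norm_eq_0D:
  assumes "v \<in> H1_tilde" "H1_norm v = 0"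
  shows "v = (\<lambda>_. 0)"
proof -
  obtain g where g: "has_ac_deriv v g" "v \<in> L2" "g \<in> L2" using assms(1) by (rule H1_tildeE)
  have "sqn v + sqn g = 0" using H1_norm_square[OF g] assms(2) by simp
  hence "sqn v = 0" using sqn_nonneg[of v] sqn_nonneg[of g] by linarith
  hence "AE x in lborel. (cmod (v x))\<^sup>2 = 0"
    unfolding sqn_def using L2_D(2)[OF g(2)] by (subst (asm) integral_nonneg_eq_0_iff_AE) auto
  hence "AE x in lborel. v x = 0" by eventually_elim simp
  thus ?thesis by (rule continuous_AE_eq[OF H1_tilde_continuous[OF assms(1)] continuous_on_const])
qed

section \<open>The orbit as a solution, and its uniqueness\<close>

lemma filterlim_diff_at_0: "filterlim (\<lambda>s. s - t) (at 0) (at t within S)" for t :: real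
  by (auto simp: filterlim_at eventually_at_filter intro!: tendsto_eq_intros)

lemma Dom_L_imp_H1_tilde: "v \<in> Dom_L \<Longrightarrow> v \<in> H1_tilde" "v \<in> Dom_L \<Longrightarrow> op_L v \<in> H1_tilde"
  using Dom_L_iff_dot[of v "op_L v"] by auto

text \<open>The group law and the isometry reduce every time \<open>t\<close> to time 0, where
  \<open>evol_tendsto_0\<close> applies.\<close>

lemma H1_norm_evol_diff:
  assumes "v \<in> H1_tilde"
  shows "H1_norm (\<lambda>x. evol s v x - evol t v x) = H1_norm (\<lambda>x. evol (s - t) v x - v x)"
proof -
  have "(\<lambda>x. evol s v x - evol t v x) = evol t (\<lambda>x. evol (s - t) v x - v x)"
    by (simp add: evol_diff evol_evol[OF assms])
  thus ?thesis using evol_H1_tilde(2)[OF H1_tilde_diff[OF evol_H1_tilde(1)[OF assms] assms]] by simp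
qed

lemma evol_continuous_wrt:
  assumes "v \<in> H1_tilde"
  shows "((\<lambda>s. H1_norm (\<lambda>x. evol s v x - evol t v x)) \<longlongrightarrow> 0) (at t within S)"
  unfolding H1_norm_evol_diff[OF assms]
  by (rule filterlim_compose[OF evol_tendsto_0[OF assms] filterlim_diff_at_0])

lemma evol_time_deriv:
  assumes v: "v \<in> Dom_L"
  shows "((\<lambda>s. H1_norm (\<lambda>x. (evol s v x - evol t v x) / complex_of_real (s - t) - evol t (op_L v) x)) \<longlongrightarrow> 0) (at t within S)"
proof -
  note H = Dom_L_imp_H1_tilde[OF v]
  have "H1_norm (\<lambda>x. (evol s v x - evol t v x) / complex_of_real (s - t) - evol t (op_L v) x)
     = H1_norm (\<lambda>x. (evol (s - t) v x - v x) / complex_of_real (s - t) - op_L v x)" for s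
  proof -
    let ?c = "inverse (complex_of_real (s - t))"
    let ?f = "\<lambda>x. ?c * (evol (s - t) v x - v x) - op_L v x"
    have "?f \<in> H1_tilde" by (intro H1_tilde_diff H1_tilde_cmult evol_H1_tilde H)
    moreover have "evol t ?f = (\<lambda>x. ?c * (evol s v x - evol t v x) - evol t (op_L v) x)"
      by (simp only: evol_diff evol_cmult evol_evol[OF H(1)]) simp
    ultimately have "H1_norm (\<lambda>x. ?c * (evol s v x - evol t v x) - evol t (op_L v) x) = H1_norm ?f"
      using evol_H1_tilde(2)[of ?f t] by simp
    thus ?thesis by (simp add: divide_inverse mult.commute)
  qed
  thus ?thesis
    using filterlim_compose[OF evol_quotient_tendsto_0[OF v] filterlim_diff_at_0[of t S]] by simp
qed

lemma evol_global_solution: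
  assumes v: "v0 \<in> Dom_L"
  shows "global_solution v0 (\<lambda>t. evol t v0)"
proof -
  note H = Dom_L_imp_H1_tilde[OF v]
  have "continuous_wrt graph_norm (\<lambda>t. evol t v0)"
    unfolding continuous_wrt_def graph_norm_def
  proof (intro allI impI)
    fix t :: real
    \<comment> \<open>Linearity and commutation turn the second part of the graph norm into a
      difference along the orbit of \<open>op_L v0\<close>.\<close>
    have "op_L (\<lambda>x. evol s v0 x - evol t v0 x) = (\<lambda>x. evol s (op_L v0) x - evol t (op_L v0) x)" for s
      using op_L_diff evol_Dom_L[OF v] by simp
    thus "((\<lambda>s. H1_norm (\<lambda>x. evol s v0 x - evol t v0 x) + H1_norm (op_L (\<lambda>x. evol s v0 x - evol t v0 x))) \<longlongrightarrow> 0) (at t within {0..})"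
      using tendsto_add[OF evol_continuous_wrt[OF H(1), of t "{0..}"] evol_continuous_wrt[OF H(2), of t "{0..}"]] by simp
  qed
  moreover have "continuous_wrt H1_norm (\<lambda>t. evol t (op_L v0))"
    unfolding continuous_wrt_def by (intro allI impI evol_continuous_wrt H)
  moreover have "has_time_deriv_wrt H1_norm (\<lambda>t. evol t v0) (\<lambda>t. evol t (op_L v0))"
    unfolding has_time_deriv_wrt_def by (intro allI impI evol_time_deriv v)
  ultimately show ?thesis
    unfolding global_solution_def
    using evol_Dom_L[OF v] evol_0[OF H(1)] evol_H1_tilde(1)[OF H(2)]
    by (intro conjI exI[of _ "\<lambda>t. evol t (op_L v0)"]) auto
qed

lemma global_solution_unique:
  assumes w: "global_solution v0 w" and t: "t \<ge> 0"
  shows "w t = evol t v0"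
proof -
  obtain w' where wD: "\<And>t. t \<ge> 0 \<Longrightarrow> w t \<in> Dom_L"
    and wd: "has_time_deriv_wrt H1_norm w w'" and w': "\<And>t. t \<ge> 0 \<Longrightarrow> w' t = op_L (w t)" and w0: "w 0 = v0"
    using w unfolding global_solution_def by auto
  have wH: "w t \<in> H1_tilde" "op_L (w t) \<in> H1_tilde" if "t \<ge> 0" for t
    using Dom_L_imp_H1_tilde[OF wD[OF that]] by auto
  have v0H: "v0 \<in> H1_tilde" using wH(1)[of 0] w0 by simp
  define e where "e t = evol (- t) (w t)" for t
  \<comment> \<open>A real-valued distance stands in for the curve: a real function with derivative
    zero on \<open>{0..}\<close> is constant, so calculus with values in a function space is
    avoided.\<close>
  define \<rho> where "\<rho> t = H1_norm (\<lambda>x. e t x - v0 x)" for t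
  have eH: "e t \<in> H1_tilde" if "t \<ge> 0" for t
    unfolding e_def by (intro evol_H1_tilde wH that)
  have "(\<rho> has_real_derivative 0) (at t within {0..})" if t: "t \<ge> 0" for t
    unfolding has_field_derivative_iff
  proof (rule tendsto_rabs_zero_cancel, rule tendsto_sandwich[OF _ _ tendsto_const])
    \<comment> \<open>The defects of the difference quotients of \<open>w\<close> and of the orbit
      through \<open>w t\<close>; the same generator value is subtracted in both.\<close>
    let ?p = "\<lambda>s x. (w s x - w t x) / complex_of_real (s - t) - op_L (w t) x"
    let ?q = "\<lambda>s x. (evol (s - t) (w t) x - w t x) / complex_of_real (s - t) - op_L (w t) x"
    have "((\<lambda>s. H1_norm (?p s)) \<longlongrightarrow> 0) (at t within {0..})"
      using wd t unfolding has_time_deriv_wrt_def w'[OF t, symmetric] by blast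
    moreover have "((\<lambda>s. H1_norm (?q s)) \<longlongrightarrow> 0) (at t within {0..})"
      by (rule filterlim_compose[OF evol_quotient_tendsto_0[OF wD[OF t]] filterlim_diff_at_0])
    ultimately show "((\<lambda>s. H1_norm (?p s) + H1_norm (?q s)) \<longlongrightarrow> 0) (at t within {0..})"
      using tendsto_add by fastforce
    have "\<bar>(\<rho> s - \<rho> t) / (s - t)\<bar> \<le> H1_norm (?p s) + H1_norm (?q s)" if s: "s \<ge> 0" "s \<noteq> t" for s
    proof -
      let ?c = "complex_of_real (s - t)"
      have c: "?c \<noteq> 0" using s by simp
      have eq: "(\<lambda>x. f x / ?c - g x) = (\<lambda>x. inverse ?c * f x - g x)" for f g :: "real \<Rightarrow> complex"
        by (simp add: divide_inverse mult.commute)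
      have pH: "?p s \<in> H1_tilde" and qH: "?q s \<in> H1_tilde"
        unfolding eq by (intro H1_tilde_diff H1_tilde_cmult evol_H1_tilde wH s t)+
      have dH: "(\<lambda>x. w s x - evol (s - t) (w t) x) \<in> H1_tilde"
        by (intro H1_tilde_diff evol_H1_tilde wH s t)
      have "\<bar>\<rho> s - \<rho> t\<bar> \<le> H1_norm (\<lambda>x. (e s x - v0 x) - (e t x - v0 x))"
        unfolding \<rho>_def by (intro H1_norm_reverse_triangle H1_tilde_diff eH s t v0H)
      \<comment> \<open>The group law allows \<open>evol (- s)\<close>, an isometry, to be factored
        out of the difference.\<close>
      also have "(\<lambda>x. (e s x - v0 x) - (e t x - v0 x)) = evol (- s) (\<lambda>x. w s x - evol (s - t) (w t) x)"
        by (simp add: evol_diff evol_evol[OF wH(1)[OF t]] e_def)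
      also have "H1_norm \<dots> = H1_norm (\<lambda>x. w s x - evol (s - t) (w t) x)"
        by (rule evol_H1_tilde(2)[OF dH])
      \<comment> \<open>In \<open>?p s - ?q s\<close> the values \<open>op_L (w t)\<close> and
        \<open>w t\<close> cancel.\<close>
      also have "(\<lambda>x. w s x - evol (s - t) (w t) x) = (\<lambda>x. ?c * (?p s x - ?q s x))"
      proof
        fix x
        have "?c * (?p s x - ?q s x) = ?c * ((w s x - w t x) / ?c) - ?c * ((evol (s - t) (w t) x - w t x) / ?c)"
          by (simp only: right_diff_distrib) simp
        also have "\<dots> = (w s x - w t x) - (evol (s - t) (w t) x - w t x)"
          by (simp only: times_divide_eq_right nonzero_mult_div_cancel_left[OF c])
        finally show "w s x - evol (s - t) (w t) x = ?c * (?p s x - ?q s x)" by simp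
      qed
      also have "H1_norm \<dots> = \<bar>s - t\<bar> * H1_norm (\<lambda>x. ?p s x - ?q s x)"
        using H1_norm_cmult[OF H1_tilde_diff[OF pH qH], of ?c] by (simp only: norm_of_real)
      also have "\<dots> \<le> \<bar>s - t\<bar> * (H1_norm (?p s) + H1_norm (?q s))"
        by (intro mult_left_mono H1_norm_diff_le pH qH) simp
      finally show ?thesis using s by (simp add: abs_divide divide_le_eq mult.commute)
    qed
    thus "\<forall>\<^sub>F s in at t within {0..}. \<bar>(\<rho> s - \<rho> t) / (s - t)\<bar> \<le> H1_norm (?p s) + H1_norm (?q s)"
      by (auto simp: eventually_at_filter)
  qed auto
  hence "\<exists>c. \<forall>t\<in>{0..}. \<rho> t = c"
    by (intro has_field_derivative_zero_constant) auto
  moreover have "\<rho> 0 = 0"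
    using H1_norm_cmult[OF v0H, of 0] by (simp add: \<rho>_def e_def w0 evol_0[OF v0H])
  ultimately have "\<rho> t = 0" using t by force
  hence "(\<lambda>x. e t x - v0 x) = (\<lambda>_. 0)"
    unfolding \<rho>_def by (intro H1_norm_eq_0D H1_tilde_diff eH t v0H)
  hence "e t = v0" by (simp add: fun_eq_iff)
  hence "evol t v0 = evol t (evol (- t) (w t))" by (simp add: e_def)
  thus ?thesis using evol_evol[OF wH(1)[OF t]] evol_0[OF wH(1)[OF t]] by simp
qed

theorem proposition5p2:
  fixes v0 :: "real \<Rightarrow> complex"
  assumes "v0 \<in> Dom_L"
  shows "\<exists>v. global_solution v0 v \<and>
             (\<forall>w. global_solution v0 w \<longrightarrow> (\<forall>t\<ge>0. w t = v t)) \<and>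
             (\<forall>t\<ge>0. H1_norm (v t) = H1_norm v0)"
proof (intro exI[of _ "\<lambda>t. evol t v0"] conjI allI impI)
  show "global_solution v0 (\<lambda>t. evol t v0)" by (rule evol_global_solution[OF assms])
  show "w t = evol t v0" if "global_solution v0 w" "t \<ge> 0" for w t
    using that by (rule global_solution_unique)
  show "H1_norm (evol t v0) = H1_norm v0" for t
    by (rule evol_H1_tilde(2)[OF Dom_L_imp_H1_tilde(1)[OF assms]])
qed

end
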